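(* Let $d,n\ge1$ be integers, let $\mathcal{A}\subseteq\mathrm{End}(\mathbb{C}^d)$ be a von Neumann algebra with gauge group $G_{\mathcal{A}}$, and fix a sign $\pm$. Then for any POVM $M:\sigma(\Omega)\to\mathrm{End}((\mathbb{C}^d)^{\otimes n})$ which has global symmetry with respect to $G_{\mathcal{A}}$ there is a POVM $\tilde M_{\pm}$ with local symmetry with respect to $G_{\mathcal{A}}$ (i.e. $\tilde M_{\pm}:\sigma(\Omega)\to\mathcal{A}^{\otimes n}$) which has exactly the same statistics for all states whose supports are confined to the symmetric (respectively antisymmetric) subspace; that is, $\mathrm{tr}(\rho\tilde M_{\pm}(B))=\mathrm{tr}(\rho M(B))$ for all $B\in\sigma(\Omega)$ and all density operators $\rho$ on $(\mathbb{C}^d)^{\otimes n}$ with $\Pi_{\pm}\rho\Pi_{\pm}=\rho$. In particular, one can choose $\tilde M_{\pm}=\mathcal{L}_{\pm}(M)$, where $\mathcal{L}_{\pm}$ is the superoperator $$\mathcal{L}_{\pm}(\cdot)=\Phi_{\pm}(\cdot)+\mathrm{tr}(\cdot)\,\frac{\mathbb{I}^{\otimes n}-\Phi_{\pm}(\mathbb{I}^{\otimes n})}{d^n},\qquad \Phi_{\pm}(\cdot)=\sum_{\mu:\,p_{\mu,\pm}\ne0}p_{\mu,\pm}^{-1}\,P_{\mu}\big[\mathcal{T}_{G_{\mathcal{A}}}^{\otimes n}(\Pi_{\pm}(\cdot)\Pi_{\pm})\big]P_{\mu}.$$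
   Context: A von Neumann algebra $\mathcal{A}\subseteq\mathrm{End}(\mathbb{C}^d)$ is a complex subalgebra containing the identity and closed under adjoint; its gauge group $G_{\mathcal{A}}$ is the group of all unitaries in $\mathrm{U}(d)$ commuting with every element of $\mathcal{A}$, and $G'_{\mathcal{A}}$ is the centralizer of $G_{\mathcal{A}}$ in $\mathrm{U}(d)$. $\Pi_{\pm}$ are the orthogonal projectors onto the totally symmetric ($+$) and totally antisymmetric ($-$) subspaces of $(\mathbb{C}^d)^{\otimes n}$. A POVM with outcome space a measurable space $(\Omega,\sigma(\Omega))$ is a countably additive map $M$ from $\sigma(\Omega)$ to positive operators in $\mathrm{End}((\mathbb{C}^d)^{\otimes n})$ with $M(\Omega)=\mathbb{I}^{\otimes n}$. $M$ has global symmetry with respect to $G_{\mathcal{A}}$ if every $M(B)$ commutes with $V^{\otimes n}$ for all $V\in G_{\mathcal{A}}$; it has local symmetry if every $M(B)$ commutes with $\mathbb{I}^{\otimes k}\otimes V\otimes\mathbb{I}^{\otimes(n-k-1)}$ for all $V\in G_{\mathcal{A}}$, $0\le k\le n-1$. $\mathcal{L}_\pm(M)$ denotes the map $B\mapsto\mathcal{L}_\pm(M(B))$. In the definition of $\Phi_\pm$: $\mathcal{T}_{G_{\mathcal{A}}}(X)=\int_{G_{\mathcal{A}}}d\mu(V)\,VXV^{\dagger}$ with normalized Haar measure; $\mu$ labels the irreps of $G'_{\mathcal{A}}$ occurring in the representation $V\mapsto V^{\otimes n}$ of $G'_{\mathcal{A}}$ on $(\mathbb{C}^d)^{\otimes n}$;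 $P_\mu$ is the projector onto the corresponding isotypic component; and $p_{\mu,\pm}=\mathrm{tr}(P_\mu\mathcal{T}^{\otimes n}_{G_{\mathcal{A}}}(\Pi_\pm))/\mathrm{tr}(P_\mu)$. *)

theory Defs
  imports "HOL-Analysis.Analysis" "HOL-Probability.Probability"
begin

(* Operators on C^d are matrices indexed by a finite type 'd with CARD('d) = d.  The n tensor
   factors are indexed by a finite type 'n with CARD('n) = n, so that the product basis of
   (C^d)^{\<otimes>n} is indexed by 'n \<Rightarrow> 'd. *)

type_synonym 'm cmat = "complex ^ 'm ^ 'm"
type_synonym ('n, 'd) tensor_mat = "((complex, 'n \<Rightarrow> 'd) vec, 'n \<Rightarrow> 'd) vec"

section \<open>Complex matrices\<close>

(* The library's scaling of complex matrices is by reals only. *)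
definition cscale :: "complex \<Rightarrow> 'm::finite cmat \<Rightarrow> 'm cmat"  (infixr "*\<^sub>m" 75) where
  "c *\<^sub>m A = (\<chi> i j. c * A $ i $ j)"

interpretation cmat: vector_space cscale
  by unfold_locales (simp_all add: cscale_def vec_eq_iff algebra_simps)

definition adj :: "'m::finite cmat \<Rightarrow> 'm cmat" where
  "adj A = (\<chi> i j. cnj (A $ j $ i))"

definition unitary :: "'m::finite cmat \<Rightarrow> bool" where
  "unitary U \<longleftrightarrow> adj U ** U = mat 1 \<and> U ** adj U = mat 1"

definition cinner :: "complex ^ 'm::finite \<Rightarrow> complex ^ 'm \<Rightarrow> complex" where
  "cinner u v = (\<Sum>i\<in>UNIV. cnj (u $ i) * v $ i)"

definition positive_op :: "'m::finite cmat \<Rightarrow> bool" where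
  "positive_op A \<longleftrightarrow> adj A = A \<and> (\<forall>v. 0 \<le> Re (cinner v (A *v v)))"

definition density_op :: "'m::finite cmat \<Rightarrow> bool" where
  "density_op A \<longleftrightarrow> positive_op A \<and> trace A = 1"

definition orth_proj :: "(complex ^ 'm::finite) set \<Rightarrow> 'm cmat" where
  "orth_proj S = (THE P. adj P = P \<and> P ** P = P \<and> range ((*v) P) = S)"

section \<open>Von Neumann algebras and gauge groups\<close>

definition von_neumann_algebra :: "'m::finite cmat set \<Rightarrow> bool" where
  "von_neumann_algebra \<A> \<longleftrightarrow>
     cmat.subspace \<A> \<and> mat 1 \<in> \<A> \<and>
     (\<forall>A\<in>\<A>. \<forall>B\<in>\<A>. A ** B \<in> \<A>) \<and> (\<forall>A\<in>\<A>. adj A \<in> \<A>)"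

definition unitary_centralizer :: "'m::finite cmat set \<Rightarrow> 'm cmat set" where
  "unitary_centralizer S = {U. unitary U \<and> (\<forall>A\<in>S. U ** A = A ** U)}"

abbreviation gauge_group :: "'m::finite cmat set \<Rightarrow> 'm cmat set" where
  "gauge_group \<A> \<equiv> unitary_centralizer \<A>"

abbreviation gauge_group' :: "'m::finite cmat set \<Rightarrow> 'm cmat set" where
  "gauge_group' \<A> \<equiv> unitary_centralizer (gauge_group \<A>)"

section \<open>Haar measure and twirling\<close>

definition is_normalized_haar :: "'m::finite cmat set \<Rightarrow> 'm cmat measure \<Rightarrow> bool" where
  "is_normalized_haar G \<mu> \<longleftrightarrow>
     prob_space \<mu> \<and> sets \<mu> = sets (restrict_space borel G) \<and>
     (\<forall>V\<in>G. \<forall>B\<in>sets \<mu>. emeasure \<mu> ((\<lambda>W. V ** W) ` B) = emeasure \<mu> B)"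

(* For a compact group G, such as a gauge group, exactly one measure satisfies the predicate (and
   it is also right-invariant), so the choice operator picks the normalized Haar measure. *)
definition haar :: "'m::finite cmat set \<Rightarrow> 'm cmat measure" where
  "haar G = (SOME \<mu>. is_normalized_haar G \<mu>)"

definition twirl :: "'m::finite cmat set \<Rightarrow> 'm cmat \<Rightarrow> 'm cmat" where
  "twirl G X = (\<integral>V. V ** X ** adj V \<partial>haar G)"

section \<open>Tensor products\<close>

(* The product operator \<Otimes>k. f k, with matrix entries \<Prod>k. (f k)_{a k, b k}. *)
definition tensor_op :: "('n::finite \<Rightarrow> 'd::finite cmat) \<Rightarrow> ('n, 'd) tensor_mat" where
  "tensor_op f = (\<chi> a b. \<Prod>k\<in>UNIV. f k $ a k $ b k)"

definition tensor_pow :: "'d::finite cmat \<Rightarrow> ('n::finite, 'd) tensor_mat" where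
  "tensor_pow V = tensor_op (\<lambda>_. V)"

definition local_op :: "'n::finite \<Rightarrow> 'd::finite cmat \<Rightarrow> ('n, 'd) tensor_mat" where
  "local_op k V = tensor_op (\<lambda>j. if j = k then V else mat 1)"

definition tensor_pow_algebra :: "'d::finite cmat set \<Rightarrow> ('n::finite, 'd) tensor_mat set" where
  "tensor_pow_algebra \<A> = cmat.span {tensor_op f | f. \<forall>k. f k \<in> \<A>}"

definition mat_unit :: "'d::finite \<Rightarrow> 'd \<Rightarrow> 'd cmat" where
  "mat_unit a b = (\<chi> i j. if i = a \<and> j = b then 1 else 0)"

(* The n-th tensor power of a linear superoperator: expand X in the product basis of matrix units
   and apply T in every factor.  It is pinned down by its value on product operators, see
   superop_pow_tensor_op below. *)
definition superop_pow ::
  "('d::finite cmat \<Rightarrow> 'd cmat) \<Rightarrow> ('n::finite, 'd) tensor_mat \<Rightarrow> ('n, 'd) tensor_mat" where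
  "superop_pow T X =
     (\<Sum>a\<in>UNIV. \<Sum>b\<in>UNIV. X $ a $ b *\<^sub>m tensor_op (\<lambda>k. T (mat_unit (a k) (b k))))"

lemma cmat_sum_units: "A = (\<Sum>x\<in>UNIV. \<Sum>y\<in>UNIV. A $ x $ y *\<^sub>m mat_unit x y)"
proof -
  have *: "(\<Sum>y\<in>UNIV. if P then g y else 0) = (if P then \<Sum>y\<in>UNIV. g y else 0)"
    for P and g :: "'a \<Rightarrow> complex"
    by simp
  show ?thesis
    by (simp add: vec_eq_iff cscale_def mat_unit_def if_distrib[of "times _"] *
        flip: if_if_eq_conj cong: if_cong)
qed

lemma prod_sum_UNIV:
  fixes g :: "'n::finite \<Rightarrow> 'b::finite \<Rightarrow> complex"
  shows "(\<Prod>k\<in>UNIV. \<Sum>x\<in>UNIV. g k x) = (\<Sum>a\<in>UNIV. \<Prod>k\<in>UNIV. g k (a k))"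
  using prod_sum_PiE[of UNIV "\<lambda>_. UNIV" g] by simp

lemma superop_pow_tensor_op:
  assumes "Vector_Spaces.linear cscale cscale T"
  shows "superop_pow T (tensor_op f) = tensor_op (\<lambda>k. T (f k))"
proof -
  interpret T: Vector_Spaces.linear cscale cscale T by fact
  have "T (f k) = (\<Sum>x\<in>UNIV. \<Sum>y\<in>UNIV. f k $ x $ y *\<^sub>m T (mat_unit x y))" for k
    by (subst cmat_sum_units[of "f k"]) (simp only: T.sum T.scale)
  then show ?thesis
    unfolding superop_pow_def
    by (simp add: vec_eq_iff tensor_op_def cscale_def prod_sum_UNIV prod.distrib)
qed

section \<open>Symmetric and antisymmetric subspaces\<close>

datatype exchange_sign = Plus | Minus

fun exchange_char :: "exchange_sign \<Rightarrow> ('n::finite \<Rightarrow> 'n) \<Rightarrow> complex" where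
  "exchange_char Plus \<pi> = 1"
| "exchange_char Minus \<pi> = of_int (sign \<pi>)"

(* A permutation \<pi> of the tensor factors sends \<psi> to the vector with entries \<psi>_(a \<circ> \<pi>). *)
definition exchange_subspace ::
  "exchange_sign \<Rightarrow> (complex, 'n::finite \<Rightarrow> 'd::finite) vec set" where
  "exchange_subspace s =
     {\<psi>. \<forall>\<pi>. \<pi> permutes UNIV \<longrightarrow> (\<chi> a. \<psi> $ (a \<circ> \<pi>)) = exchange_char s \<pi> *s \<psi>}"

definition exchange_proj :: "exchange_sign \<Rightarrow> ('n::finite, 'd::finite) tensor_mat" where
  "exchange_proj s = orth_proj (exchange_subspace s)"

section \<open>Isotypic components of a representation\<close>

definition invariant_subspace ::
  "'g set \<Rightarrow> ('g \<Rightarrow> 'm::finite cmat) \<Rightarrow> (complex ^ 'm) set \<Rightarrow> bool" where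
  "invariant_subspace G R W \<longleftrightarrow> vec.subspace W \<and> (\<forall>g\<in>G. \<forall>w\<in>W. R g *v w \<in> W)"

definition irreducible_subspace ::
  "'g set \<Rightarrow> ('g \<Rightarrow> 'm::finite cmat) \<Rightarrow> (complex ^ 'm) set \<Rightarrow> bool" where
  "irreducible_subspace G R W \<longleftrightarrow>
     invariant_subspace G R W \<and> W \<noteq> {0} \<and>
     (\<forall>U. invariant_subspace G R U \<and> U \<subseteq> W \<longrightarrow> U = {0} \<or> U = W)"

(* Every linear map between subspaces is the restriction of a matrix. *)
definition isomorphic_subreps ::
  "'g set \<Rightarrow> ('g \<Rightarrow> 'm::finite cmat) \<Rightarrow> (complex ^ 'm) set \<Rightarrow> (complex ^ 'm) set \<Rightarrow> bool" where
  "isomorphic_subreps G R W W' \<longleftrightarrow>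
     (\<exists>T :: 'm cmat. bij_betw ((*v) T) W W' \<and>
        (\<forall>g\<in>G. \<forall>w\<in>W. T *v (R g *v w) = R g *v (T *v w)))"

(* An irrep occurring in R is an isomorphism class of irreducible subrepresentations. *)
definition occurring_irreps ::
  "'g set \<Rightarrow> ('g \<Rightarrow> 'm::finite cmat) \<Rightarrow> (complex ^ 'm) set set set" where
  "occurring_irreps G R =
     {W. irreducible_subspace G R W} //
     {(W, W'). irreducible_subspace G R W \<and> irreducible_subspace G R W' \<and>
               isomorphic_subreps G R W W'}"

definition isotypic_proj :: "(complex ^ 'm::finite) set set \<Rightarrow> 'm cmat" where
  "isotypic_proj \<mu> = orth_proj (vec.span (\<Union>\<mu>))"

section \<open>POVMs and their symmetries\<close>

definition povm :: "'w set \<Rightarrow> 'w set set \<Rightarrow> ('w set \<Rightarrow> 'm::finite cmat) \<Rightarrow> bool" where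
  "povm \<Omega> \<Sigma> M \<longleftrightarrow>
     (\<forall>B\<in>\<Sigma>. positive_op (M B)) \<and>
     (\<forall>B :: nat \<Rightarrow> 'w set. range B \<subseteq> \<Sigma> \<longrightarrow> disjoint_family B \<longrightarrow>
        (\<lambda>i. M (B i)) sums M (\<Union>i. B i)) \<and>
     M \<Omega> = mat 1"

definition global_symmetry ::
  "'d::finite cmat set \<Rightarrow> 'w set set \<Rightarrow> ('w set \<Rightarrow> ('n::finite, 'd) tensor_mat) \<Rightarrow> bool" where
  "global_symmetry G \<Sigma> M \<longleftrightarrow>
     (\<forall>B\<in>\<Sigma>. \<forall>V\<in>G. M B ** tensor_pow V = tensor_pow V ** M B)"

definition local_symmetry ::
  "'d::finite cmat set \<Rightarrow> 'w set set \<Rightarrow> ('w set \<Rightarrow> ('n::finite, 'd) tensor_mat) \<Rightarrow> bool" where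
  "local_symmetry G \<Sigma> M \<longleftrightarrow>
     (\<forall>B\<in>\<Sigma>. \<forall>V\<in>G. \<forall>k. M B ** local_op k V = local_op k V ** M B)"

definition same_statistics ::
  "exchange_sign \<Rightarrow> 'w set set \<Rightarrow> ('w set \<Rightarrow> ('n::finite, 'd::finite) tensor_mat) \<Rightarrow>
   ('w set \<Rightarrow> ('n, 'd) tensor_mat) \<Rightarrow> bool" where
  "same_statistics s \<Sigma> M' M \<longleftrightarrow>
     (\<forall>B\<in>\<Sigma>. \<forall>\<rho>. density_op \<rho> \<and> exchange_proj s ** \<rho> ** exchange_proj s = \<rho> \<longrightarrow>
        trace (\<rho> ** M' B) = trace (\<rho> ** M B))"

section \<open>The superoperators\<close>

definition twirl_pow ::
  "'d::finite cmat set \<Rightarrow> ('n::finite, 'd) tensor_mat \<Rightarrow> ('n, 'd) tensor_mat" where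
  "twirl_pow \<A> = superop_pow (twirl (gauge_group \<A>))"

definition irrep_labels ::
  "'d::finite cmat set \<Rightarrow> (complex, 'n::finite \<Rightarrow> 'd) vec set set set" where
  "irrep_labels \<A> = occurring_irreps (gauge_group' \<A>) tensor_pow"

definition p_coeff ::
  "'d::finite cmat set \<Rightarrow> exchange_sign \<Rightarrow> (complex, 'n::finite \<Rightarrow> 'd) vec set set \<Rightarrow> complex" where
  "p_coeff \<A> s \<mu> =
     trace (isotypic_proj \<mu> ** twirl_pow \<A> (exchange_proj s)) / trace (isotypic_proj \<mu>)"

definition Phi ::
  "'d::finite cmat set \<Rightarrow> exchange_sign \<Rightarrow> ('n::finite, 'd) tensor_mat \<Rightarrow> ('n, 'd) tensor_mat" where
  "Phi \<A> s X =
     (\<Sum>\<mu> | \<mu> \<in> irrep_labels \<A> \<and> p_coeff \<A> s \<mu> \<noteq> 0.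
        inverse (p_coeff \<A> s \<mu>) *\<^sub>m
        (isotypic_proj \<mu> ** twirl_pow \<A> (exchange_proj s ** X ** exchange_proj s)
           ** isotypic_proj \<mu>))"

definition localizer ::
  "'d::finite cmat set \<Rightarrow> exchange_sign \<Rightarrow> ('n::finite, 'd) tensor_mat \<Rightarrow> ('n, 'd) tensor_mat" where
  "localizer \<A> s X =
     Phi \<A> s X +
     (trace X / of_nat (CARD('d) ^ CARD('n))) *\<^sub>m (mat 1 - Phi \<A> s (mat 1))"

end

theory Submission
  imports Defs
begin

text \<open>
  Write \<open>T\<close> for the \<open>n\<close>-th tensor power of the twirl, \<open>Q\<close> for the exchange projection and \<open>Z = T(Q)\<close>.
  \<open>T\<close> averages \<open>U X U\<^sup>*\<close> over local unitaries \<open>U = \<Otimes>\<^sub>k V\<^sub>k\<close> with \<open>V\<^sub>k\<close> in the gauge group, so it is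
  positive and has values in the tensor power of \<open>\<A>\<close>.

  Let \<open>X = Q X Q\<close> commute with all \<open>V \<otimes> \<dots> \<otimes> V\<close>.  By polarization \<open>X\<close> then commutes with every
  compression \<open>Q U\<^sup>* Q\<close>, hence \<open>U X U\<^sup>* Q = U Q U\<^sup>* X\<close> and, after averaging, \<open>T(X) Q = Z X\<close>.
  \<open>Z\<close> and \<open>T(X)\<close> lie in the tensor power of \<open>\<A>\<close> and are invariant under permutations of the factors,
  so by polarization again they commute with the commutant of \<open>{W \<otimes> \<dots> \<otimes> W}\<close>.
  By Schur's lemma \<open>Z\<close> acts on the isotypic component \<open>\<mu>\<close> as the scalar \<open>p\<^sub>\<mu>\<close>, and \<open>p\<^sub>\<mu> = 0\<close> forces
  \<open>P\<^sub>\<mu> Q = 0\<close> because \<open>T\<close> preserves the trace.  Therefore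
  \<open>\<Phi>(X) Q = \<Sum> p\<^sub>\<mu>\<^sup>-\<^sup>1 P\<^sub>\<mu> T(X) P\<^sub>\<mu> Q = \<Sum> p\<^sub>\<mu>\<^sup>-\<^sup>1 P\<^sub>\<mu> Z X = X\<close>,
  and \<open>\<Phi>(1)\<close> is the sum of the \<open>P\<^sub>\<mu>\<close> with \<open>p\<^sub>\<mu> \<noteq> 0\<close>, which fixes \<open>Q\<close>.
\<close>

section \<open>Matrix algebra\<close>

text \<open>\<open>haar\<close> is a choice operator, so nothing is known about the twirl until a
  normalized invariant measure is shown to exist; it is obtained as an image of Lebesgue measure
  under a map that commutes with left multiplication by the group. Left invariance puts every
  twirled operator into the commutant of the gauge group, and that this commutant is no larger than
  \<A> is the double commutant theorem.

  Polarization needs commutation with \<open>tensor_pow A\<close> for all elements A of an algebra,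
  whereas symmetry supplies only the unitary ones. Cayley transforms of skew-adjoint elements turn
  the unitary relation into a polynomial one, which extends to the whole algebra. This is used for
  the commutant of \<A>, to handle X, and for \<A> itself, to handle Z and T(X).

  Compression by Q makes the first use possible: Q absorbs permutations up to a sign that occurs
  twice, so Q U Q equals Q S Q for the average S of U over permutations of its factors, and
  polarization reaches S but not U.\<close>

lemma cscale_nth [simp]: "(c *\<^sub>m A) $ i $ j = c * A $ i $ j"
  by (simp add: cscale_def)

lemma adj_nth [simp]: "adj A $ i $ j = cnj (A $ j $ i)"
  by (simp add: adj_def)

lemma mat_unit_nth: "mat_unit a b $ i $ j = (if i = a \<and> j = b then 1 else 0)"
  by (simp add: mat_unit_def)

lemma matrix_mult_nth: "(A ** B) $ i $ j = (\<Sum>k\<in>UNIV. A $ i $ k * B $ k $ j)"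
  by (simp add: matrix_matrix_mult_def)

lemma matrix_vector_mult_nth: "(A *v x) $ i = (\<Sum>k\<in>UNIV. A $ i $ k * x $ k)"
  by (simp add: matrix_vector_mult_def)

lemma adj_adj [simp]: "adj (adj A) = A"
  by (simp add: vec_eq_iff)

lemma adj_mult: "adj (A ** B) = adj B ** adj A"
  by (simp add: vec_eq_iff matrix_mult_nth mult.commute)

lemma adj_mat_1 [simp]: "adj (mat 1) = mat 1"
  by (simp add: vec_eq_iff mat_def)

lemma adj_add: "adj (A + B) = adj A + adj B"
  and adj_diff: "adj (A - B) = adj A - adj B"
  and adj_zero [simp]: "adj 0 = 0"
  and adj_cscale: "adj (c *\<^sub>m A) = cnj c *\<^sub>m adj A"
  by (simp_all add: vec_eq_iff)

lemma adj_sum: "adj (sum f I) = (\<Sum>i\<in>I. adj (f i))"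
  by (induction I rule: infinite_finite_induct) (simp_all add: adj_add)

lemma mult_cscale_left: "(c *\<^sub>m A) ** B = c *\<^sub>m (A ** B)"
  and mult_cscale_right: "A ** (c *\<^sub>m B) = c *\<^sub>m (A ** B)"
  by (simp_all add: vec_eq_iff matrix_mult_nth sum_distrib_left mult_ac)

lemma cscale_mult_vec: "(c *\<^sub>m A) *v x = c *s (A *v x)"
  by (simp add: vec_eq_iff matrix_vector_mult_nth sum_distrib_left mult_ac)

lemma scaleR_eq_cscale: "r *\<^sub>R A = of_real r *\<^sub>m A"
  by (simp add: vec_eq_iff complex_eq_iff)

lemma scaleR_eq_smult: "r *\<^sub>R (x :: complex ^ 'm) = of_real r *s x"
  by (simp add: vec_eq_iff complex_eq_iff)

lemma matrix_add_rdistrib: "(A + B) ** C = A ** C + B ** (C :: 'm::finite cmat)"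
  by (simp add: vec_eq_iff matrix_mult_nth distrib_right sum.distrib)

lemma mat_mult_sum_left: "sum f I ** B = (\<Sum>i\<in>I. f i ** (B :: 'm::finite cmat))"
  by (induction I rule: infinite_finite_induct) (simp_all add: matrix_add_rdistrib)

lemma mat_mult_sum_right: "B ** sum f I = (\<Sum>i\<in>I. (B :: 'm::finite cmat) ** f i)"
  by (induction I rule: infinite_finite_induct) (simp_all add: matrix_add_ldistrib)

lemma mat_mult_diff_left: "(A - B) ** C = A ** C - B ** (C :: 'm::finite cmat)"
  and mat_mult_diff_right: "C ** (A - B) = C ** A - C ** (B :: 'm::finite cmat)"
  by (simp_all add: vec_eq_iff matrix_mult_nth algebra_simps sum_subtractf)

lemma matrix_mult_mat_unit: "A ** mat_unit a b = (\<Sum>x\<in>UNIV. A $ x $ a *\<^sub>m mat_unit x b)"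
proof (unfold vec_eq_iff, intro allI)
  fix i j
  have "(A ** mat_unit a b) $ i $ j = (if j = b then A $ i $ a else 0)"
    by (cases "j = b") (simp_all add: matrix_mult_nth mat_unit_nth if_distrib[of "times _"] cong: if_cong)
  also have "\<dots> = (\<Sum>x\<in>UNIV. A $ x $ a *\<^sub>m mat_unit x b) $ i $ j"
    by (cases "j = b") (simp_all add: sum_component mat_unit_nth if_distrib[of "times _"] cong: if_cong)
  finally show "(A ** mat_unit a b) $ i $ j = (\<Sum>x\<in>UNIV. A $ x $ a *\<^sub>m mat_unit x b) $ i $ j" .
qed

lemma mat_1_eq_sum_units: "mat 1 = (\<Sum>x\<in>UNIV. mat_unit x x :: 'm::finite cmat)"
  by (auto simp: vec_eq_iff mat_def mat_unit_nth simp flip: if_if_eq_conj)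

lemma matrix_vector_mult_minus: "(- A) *v x = - (A *v (x :: complex ^ 'm::finite))"
  by (simp add: vec_eq_iff matrix_vector_mult_nth sum_negf)

lemma trace_cyclic: "trace (A ** B) = trace (B ** (A :: 'm::finite cmat))"
  unfolding trace_def matrix_mult_nth by (subst sum.swap) (simp add: mult.commute)

lemma trace_cscale: "trace (c *\<^sub>m A) = c * trace A"
  by (simp add: trace_def sum_distrib_left)

lemma cinner_adj: "cinner u (A *v v) = cinner (adj A *v u) v"
  unfolding cinner_def matrix_vector_mult_nth sum_distrib_left sum_distrib_right cnj_sum
  by (subst sum.swap) (simp add: mult_ac)

lemma inner_eq_cinner: "inner u v = Re (cinner u v)"
  by (simp add: inner_vec_def cinner_def inner_complex_def)

lemma inner_adj: "inner (A *v u) v = inner u (adj A *v v)"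
  by (metis adj_adj cinner_adj inner_eq_cinner)

lemma inner_smult: "inner (c *s u) v = inner u (cnj c *s (v :: complex ^ 'm::finite))"
  by (simp add: inner_eq_cinner cinner_def mult_ac)

lemma inner_cmat: "inner A B = Re (trace (adj A ** B))"
  unfolding inner_vec_def trace_def matrix_mult_nth Re_sum
  by (subst sum.swap) (simp add: inner_complex_def)

lemma inner_mult_left: "inner (V ** A) B = inner A (adj V ** (B :: 'm::finite cmat))"
  by (simp add: inner_cmat adj_mult matrix_mul_assoc)

lemma inner_cscale: "inner (c *\<^sub>m A) B = inner A (cnj c *\<^sub>m B)"
  by (simp add: inner_cmat adj_cscale mult_cscale_left mult_cscale_right)

lemma cinner_self: "cinner v v = of_real ((norm v)\<^sup>2)"
proof -
  have "cinner v v = of_real (\<Sum>i\<in>UNIV. (norm (v $ i))\<^sup>2)"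
    by (simp add: cinner_def complex_norm_square[symmetric] mult.commute del: of_real_power)
  also have "(\<Sum>i\<in>UNIV. (norm (v $ i))\<^sup>2) = (norm v)\<^sup>2"
    by (simp add: norm_vec_def L2_set_def sum_nonneg)
  finally show ?thesis .
qed

lemma cinner_smult_right: "cinner u (c *s v) = c * cinner u v"
  by (simp add: cinner_def sum_distrib_left mult_ac)

lemma cnj_cinner: "cnj (cinner u v) = cinner v u"
  by (simp add: cinner_def mult.commute)

lemma trace_adj_mult_eq_0: "trace (adj A ** A) = 0 \<longleftrightarrow> A = 0"
proof
  assume "trace (adj A ** A) = 0"
  then have "inner A A = 0" by (simp add: inner_cmat)
  then show "A = 0" by simp
qed (simp add: trace_def matrix_mult_nth)

section \<open>Orthogonal projections\<close>

text \<open>Taken for the real inner product, so that one notion serves subspaces of vectors as well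
  as subspaces of matrices, where \<open>inner\<close> is the real part of the Hilbert-Schmidt
  product; complex linearity is recovered through \<open>proj_commute\<close>.\<close>

definition proj :: "'a::euclidean_space set \<Rightarrow> 'a \<Rightarrow> 'a" where
  "proj S x = (SOME y. y \<in> S \<and> (\<forall>s\<in>S. inner (x - y) s = 0))"

lemma proj:
  assumes "subspace S"
  shows proj_in: "proj S x \<in> S" and proj_orth: "s \<in> S \<Longrightarrow> inner (x - proj S x) s = 0"
proof -
  obtain y z where "y \<in> span S" "\<And>w. w \<in> span S \<Longrightarrow> orthogonal z w" "x = y + z"
    using orthogonal_subspace_decomp_exists[of S x] by metis
  then have "y \<in> S \<and> (\<forall>s\<in>S. inner (x - y) s = 0)"
    using assms by (auto simp: span_eq_iff[THEN iffD2] orthogonal_def span_base)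
  from someI[of "\<lambda>y. y \<in> S \<and> (\<forall>s\<in>S. inner (x - y) s = 0)", OF this]
  show "proj S x \<in> S" "s \<in> S \<Longrightarrow> inner (x - proj S x) s = 0"
    unfolding proj_def by blast+
qed

lemma proj_unique:
  assumes S: "subspace S" and y: "y \<in> S" and o: "\<And>s. s \<in> S \<Longrightarrow> inner (x - y) s = 0"
  shows "proj S x = y"
proof -
  let ?d = "proj S x - y"
  have d: "?d \<in> S" using S y proj_in[OF S] by (simp add: subspace_diff)
  have "inner ?d ?d = inner (x - y) ?d - inner (x - proj S x) ?d"
    by (simp add: algebra_simps)
  also have "\<dots> = 0" using o[OF d] proj_orth[OF S d] by simp
  finally show ?thesis by simp
qed

lemma proj_id: "subspace S \<Longrightarrow> x \<in> S \<Longrightarrow> proj S x = x"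
  by (rule proj_unique) auto

text \<open>\<open>R\<close> maps the orthogonal complement of \<open>S\<close> into itself because
  its adjoint \<open>R'\<close> preserves \<open>S\<close>. Homogeneity over the complex numbers and
  linearity over an algebra are both instances.\<close>

lemma proj_commute:
  assumes S: "subspace S" and R: "linear R"
    and "\<And>s. s \<in> S \<Longrightarrow> R s \<in> S" "\<And>s. s \<in> S \<Longrightarrow> R' s \<in> S"
    and adj: "\<And>x y. inner (R x) y = inner x (R' y)"
  shows "proj S (R x) = R (proj S x)"
proof (rule proj_unique)
  fix s assume "s \<in> S"
  have "inner (R x - R (proj S x)) s = inner (R (x - proj S x)) s"
    by (simp add: linear_diff[OF R])
  then show "inner (R x - R (proj S x)) s = 0"
    using adj assms(4)[OF \<open>s \<in> S\<close>] proj_orth[OF S] by simp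
qed (use assms proj_in[OF S] in auto)

lemma linear_proj: assumes S: "subspace S" shows "linear (proj S)"
proof (rule linearI)
  fix x y show "proj S (x + y) = proj S x + proj S y"
  proof (rule proj_unique[OF S])
    fix s assume s: "s \<in> S"
    show "inner (x + y - (proj S x + proj S y)) s = 0"
      using proj_orth[OF S s, of x] proj_orth[OF S s, of y] by (simp add: algebra_simps)
  qed (use S proj_in[OF S] in \<open>auto simp: subspace_add\<close>)
next
  fix r x show "proj S (r *\<^sub>R x) = r *\<^sub>R proj S x"
    by (rule proj_commute[OF S, where R' = "scaleR r"]) (use S in \<open>auto simp: subspace_scale linear_scale_self\<close>)
qed

lemma subspace_vec_subspace: "vec.subspace S \<Longrightarrow> subspace (S :: (complex ^ 'm::finite) set)"
  unfolding subspace_def vec.subspace_def scaleR_eq_smult by simp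

lemma subspace_cmat_subspace: "cmat.subspace S \<Longrightarrow> subspace S"
  unfolding subspace_def cmat.subspace_def scaleR_eq_cscale by simp

lemma proj_smult:
  assumes "vec.subspace S"
  shows "proj S (c *s x) = c *s proj S (x :: complex ^ 'm::finite)"
proof (rule proj_commute[where R' = "\<lambda>x. cnj c *s x"])
  show "linear (\<lambda>x. c *s (x :: complex ^ 'm))"
    by (rule linearI) (simp_all add: vec_eq_iff algebra_simps scaleR_conv_of_real)
qed (use assms in \<open>auto simp: subspace_vec_subspace inner_smult vec.subspace_scale\<close>)

text \<open>Turns the definite description in \<open>orth_proj\<close> into a usable object: the
  matrix of \<open>proj S\<close> satisfies it, and no other matrix does.\<close>

lemma orth_proj_characterization:
  assumes S: "vec.subspace S"
  shows "adj P = P \<and> P ** P = P \<and> range ((*v) P) = S \<longleftrightarrow> P = orth_proj S"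
    and orth_proj_vec: "orth_proj S *v x = proj S x"
proof -
  let ?char = "\<lambda>P :: 'a cmat. adj P = P \<and> P ** P = P \<and> range ((*v) P) = S"
  have S': "subspace S" by (rule subspace_vec_subspace[OF S])
  define Q where "Q = matrix (proj S)"
  have Q: "Q *v x = proj S x" for x
    unfolding Q_def
  proof (rule matrix_works, unfold_locales)
    show "proj S (c *s x) = c *s proj S x" for c x by (rule proj_smult[OF S])
    show "proj S (x + y) = proj S x + proj S y" for x y
      by (rule linear_add[OF linear_proj[OF S']])
  qed
  have "inner ((adj Q - Q) *v x) y = 0" for x y
  proof -
    have "inner (proj S x) (y - proj S y) = 0"
      by (subst inner_commute) (rule proj_orth[OF S' proj_in[OF S']])
    moreover have "inner (x - proj S x) (proj S y) = 0"
      by (rule proj_orth[OF S' proj_in[OF S']])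
    ultimately have "inner (proj S x) y = inner x (proj S y)"
      by (simp add: algebra_simps)
    then show ?thesis
      by (simp add: matrix_vector_mult_diff_rdistrib inner_diff_left inner_adj Q)
  qed
  then have "(adj Q - Q) *v x = 0" for x by (metis inner_eq_zero_iff)
  then have "adj Q *v x = Q *v x" for x
    by (simp add: matrix_vector_mult_diff_rdistrib)
  then have "adj Q = Q" by (simp add: matrix_eq)
  moreover have "Q ** Q = Q"
    by (simp add: matrix_eq matrix_vector_mul_assoc[symmetric] Q proj_id proj_in S')
  moreover have "range ((*v) Q) = S"
    unfolding Q using proj_in[OF S'] proj_id[OF S'] by (auto simp: image_iff) metis
  ultimately have ex: "?char Q" by blast
  \<comment> \<open>Equal ranges give P1 P2 = P2 and P2 P1 = P1; the adjoint of the first is P2 P1 =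
    P2.\<close>
  have uniq: "P1 = P2" if 1: "?char P1" and 2: "?char P2" for P1 P2
  proof -
    have "P1 ** P2 = P2"
    proof (unfold matrix_eq matrix_vector_mul_assoc[symmetric], rule allI)
      fix x obtain y where "P2 *v x = P1 *v y" using 1 2 by blast
      then show "P1 *v (P2 *v x) = P2 *v x"
        using 1 by (simp add: matrix_vector_mul_assoc)
    qed
    moreover have "P2 ** P1 = P1"
    proof (unfold matrix_eq matrix_vector_mul_assoc[symmetric], rule allI)
      fix x obtain y where "P1 *v x = P2 *v y" using 1 2 by blast
      then show "P2 *v (P1 *v x) = P1 *v x"
        using 2 by (simp add: matrix_vector_mul_assoc)
    qed
    ultimately show ?thesis using 1 2 adj_mult by metis
  qed
  have the: "orth_proj S = Q"
    unfolding orth_proj_def by (rule the_equality) (use ex uniq in blast)+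
  show "?char P \<longleftrightarrow> P = orth_proj S" using the ex uniq by blast
  show "orth_proj S *v x = proj S x" using the Q by simp
qed

lemma orth_proj:
  assumes "vec.subspace S"
  shows adj_orth_proj: "adj (orth_proj S) = orth_proj S"
    and orth_proj_idem: "orth_proj S ** orth_proj S = orth_proj S"
    and range_orth_proj: "range ((*v) (orth_proj S)) = S"
  using orth_proj_characterization[OF assms] by blast+

lemma orth_proj_fixes: "vec.subspace S \<Longrightarrow> x \<in> S \<Longrightarrow> orth_proj S *v x = x"
  by (simp add: orth_proj_vec proj_id subspace_vec_subspace)

lemma orth_proj_in: "vec.subspace S \<Longrightarrow> orth_proj S *v x \<in> S"
  using range_orth_proj by blast

lemma orth_proj_commute:
  assumes S: "vec.subspace S"
    and "\<And>s. s \<in> S \<Longrightarrow> C *v s \<in> S" "\<And>s. s \<in> S \<Longrightarrow> adj C *v s \<in> S"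
  shows "orth_proj S ** C = C ** orth_proj S"
  unfolding matrix_eq matrix_vector_mul_assoc[symmetric] orth_proj_vec[OF S]
  using assms by (intro allI proj_commute[where R' = "(*v) (adj C)"])
    (auto simp: subspace_vec_subspace inner_adj)

section \<open>Von Neumann algebras\<close>

definition commutant :: "'m::finite cmat set \<Rightarrow> 'm cmat set" where
  "commutant S = {X. \<forall>A\<in>S. X ** A = A ** X}"

lemma commutantD: "X \<in> commutant S \<Longrightarrow> A \<in> S \<Longrightarrow> X ** A = A ** X"
  by (simp add: commutant_def)

lemma subspace_commutant: "cmat.subspace (commutant S)"
  by (auto simp: cmat.subspace_def commutant_def matrix_add_ldistrib matrix_add_rdistrib
      mult_cscale_left mult_cscale_right)

lemma von_neumann_algebraD:
  assumes "von_neumann_algebra \<A>"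
  shows "cmat.subspace \<A>" "mat 1 \<in> \<A>"
    and "A \<in> \<A> \<Longrightarrow> B \<in> \<A> \<Longrightarrow> A ** B \<in> \<A>"
    and "A \<in> \<A> \<Longrightarrow> adj A \<in> \<A>"
    and "A \<in> \<A> \<Longrightarrow> B \<in> \<A> \<Longrightarrow> A + B \<in> \<A>"
    and "A \<in> \<A> \<Longrightarrow> B \<in> \<A> \<Longrightarrow> A - B \<in> \<A>"
    and "A \<in> \<A> \<Longrightarrow> c *\<^sub>m A \<in> \<A>"
  using assms by (auto simp: von_neumann_algebra_def cmat.subspace_add cmat.subspace_diff
      cmat.subspace_scale)

lemma von_neumann_commutant:
  assumes "\<And>A. A \<in> S \<Longrightarrow> adj A \<in> S"
  shows "von_neumann_algebra (commutant S)"
  unfolding von_neumann_algebra_def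
proof (intro conjI ballI)
  fix A B assume A: "A \<in> commutant S"
  { assume "B \<in> commutant S"
    then show "A ** B \<in> commutant S"
      using A unfolding commutant_def by (auto simp: matrix_mul_assoc) (metis matrix_mul_assoc) }
  { have "adj A ** X = X ** adj A" if "X \<in> S" for X
      using commutantD[OF A assms[OF that]] adj_mult adj_adj by metis
    then show "adj A \<in> commutant S" by (simp add: commutant_def) }
qed (use subspace_commutant in \<open>auto simp: commutant_def\<close>)

text \<open>\<open>E\<close> is the orthogonal projection of the matrix space onto \<A>. It commutes
  with left multiplication by \<A>, so its coefficient blocks lie in the commutant and X commutes
  with them; hence \<open>E\<close> also commutes with left multiplication by X, and at the identity
  this reads X = E(X).\<close>

theorem double_commutant:
  assumes \<A>: "von_neumann_algebra \<A>"
  shows "commutant (commutant \<A>) = \<A>"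
proof
  show "\<A> \<subseteq> commutant (commutant \<A>)" by (auto simp: commutant_def)
  show "commutant (commutant \<A>) \<subseteq> \<A>"
  proof
    fix X assume X: "X \<in> commutant (commutant \<A>)"
    note vn = von_neumann_algebraD[OF \<A>]
    define E where "E = proj \<A>"
    have S: "subspace \<A>" by (rule subspace_cmat_subspace[OF vn(1)])
    have E_mult: "E (A ** Y) = A ** E Y" if "A \<in> \<A>" for A Y
      unfolding E_def
      by (rule proj_commute[OF S, where R' = "(**) (adj A)"])
        (use that vn in \<open>auto simp: inner_mult_left scaleR_eq_cscale mult_cscale_right
          matrix_add_ldistrib intro!: linearI\<close>)
    have E_scale: "E (c *\<^sub>m Y) = c *\<^sub>m E Y" for c Y
      unfolding E_def
      by (rule proj_commute[OF S, where R' = "cscale (cnj c)"])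
        (use vn in \<open>auto simp: inner_cscale scaleR_eq_cscale mult_ac
          cmat.scale_right_distrib intro!: linearI\<close>)
    have E_units: "E (A ** mat_unit a b) = (\<Sum>x\<in>UNIV. A $ x $ a *\<^sub>m E (mat_unit x b))" for A a b
      unfolding matrix_mult_mat_unit E_def linear_sum[OF linear_proj[OF S]]
      by (simp flip: E_def add: E_scale)
    \<comment> \<open>The matrix entries of the projection, seen as an operator on \<open>\<complex>\<^sup>d \<otimes> \<complex>\<^sup>d\<close>, with
        respect to the second factor.\<close>
    define C where "C k l = (\<chi> i j. E (mat_unit j k) $ i $ l)" for k l
    have "C k l ** A = A ** C k l" if "A \<in> \<A>" for k l A
    proof (unfold vec_eq_iff, intro allI)
      fix i j
      have "(C k l ** A) $ i $ j = E (A ** mat_unit j k) $ i $ l"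
        by (simp add: E_units C_def matrix_mult_nth sum_component mult.commute)
      also have "\<dots> = (A ** C k l) $ i $ j"
        by (simp add: E_mult[OF that] C_def matrix_mult_nth)
      finally show "(C k l ** A) $ i $ j = (A ** C k l) $ i $ j" .
    qed
    then have comm: "X ** C k l = C k l ** X" for k l
      using X by (auto simp: commutant_def)
    have "X ** E (mat_unit j k) = E (X ** mat_unit j k)" for j k
    proof (unfold vec_eq_iff, intro allI)
      fix i l
      have "E (X ** mat_unit j k) $ i $ l = (C k l ** X) $ i $ j"
        by (simp add: E_units C_def matrix_mult_nth sum_component mult.commute)
      also have "\<dots> = (X ** C k l) $ i $ j" by (simp add: comm)
      also have "\<dots> = (X ** E (mat_unit j k)) $ i $ l"
        by (simp add: C_def matrix_mult_nth)
      finally show "(X ** E (mat_unit j k)) $ i $ l = E (X ** mat_unit j k) $ i $ l" by simp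
    qed
    then have "X ** E (mat 1) = E (X ** mat 1)"
      unfolding mat_1_eq_sum_units mat_mult_sum_right E_def linear_sum[OF linear_proj[OF S]]
      by (simp add: E_def mat_mult_sum_right)
    then have "X = E X" by (simp add: E_def proj_id[OF S vn(2)])
    then show "X \<in> \<A>" using proj_in[OF S, of X] by (simp add: E_def)
  qed
qed

text \<open>The inverse commutes with everything that \<open>A\<close> commutes with, so the double
  commutant theorem keeps it in the algebra.\<close>

lemma von_neumann_inverse:
  assumes \<A>: "von_neumann_algebra \<A>" and "A \<in> \<A>" and "A ** B = mat 1" and "B ** A = mat 1"
  shows "B \<in> \<A>"
proof -
  have "B ** X = X ** B" if "X \<in> commutant \<A>" for X
  proof -
    have "B ** X = B ** X ** (A ** B)" by (simp add: assms)
    also have "\<dots> = B ** (X ** A) ** B" by (simp add: matrix_mul_assoc)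
    also have "\<dots> = (B ** A) ** X ** B"
      using that \<open>A \<in> \<A>\<close> by (simp add: commutant_def matrix_mul_assoc)
    finally show ?thesis by (simp add: assms)
  qed
  then show ?thesis using double_commutant[OF \<A>] by (auto simp: commutant_def)
qed

text \<open>\<open>mat 1 - K\<close> is injective: K x = x would give |x|^2 = -|x|^2 by skewness.
  \<open>J\<close> is its inverse and \<open>(mat 1 + K) ** J\<close> the Cayley transform.\<close>

lemma cayley_inverse:
  assumes "von_neumann_algebra \<A>" "K \<in> \<A>" "adj K = - K"
  obtains J where "J \<in> \<A>" "J ** (mat 1 - K) = mat 1" "(mat 1 - K) ** J = mat 1"
    "unitary ((mat 1 + K) ** J)"
proof -
  have "x = 0" if "(mat 1 - K) *v x = 0" for x
  proof -
    have "K *v x = x" using that by (simp add: matrix_vector_mult_diff_rdistrib)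
    have "adj K *v x = - x"
      using \<open>K *v x = x\<close> by (simp add: assms(3) matrix_vector_mult_minus)
    then have "inner x x = - inner x x" using inner_adj[of K x x] \<open>K *v x = x\<close> by simp
    then show ?thesis by simp
  qed
  then obtain J where J: "J ** (mat 1 - K) = mat 1"
    using matrix_left_invertible_ker by blast
  then have J': "(mat 1 - K) ** J = mat 1" using matrix_left_right_inverse by blast
  have JA: "J \<in> \<A>"
    by (rule von_neumann_inverse[OF assms(1) _ J' J]) (use assms in \<open>simp add: von_neumann_algebraD\<close>)
  let ?U = "(mat 1 + K) ** J"
  have "adj ?U = adj J ** (mat 1 - K)" by (simp add: adj_mult adj_add assms)
  moreover have aJ: "adj J ** (mat 1 + K) = mat 1"
    using J' assms(3) by (metis adj_adj adj_diff adj_mat_1 adj_mult diff_minus_eq_add)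
  have "(mat 1 - K) ** (mat 1 + K) = (mat 1 + K) ** (mat 1 - K)"
    by (simp add: matrix_add_ldistrib matrix_add_rdistrib mat_mult_diff_left mat_mult_diff_right)
  then have "adj J ** (mat 1 - K) ** ((mat 1 + K) ** J) = adj J ** (mat 1 + K) ** ((mat 1 - K) ** J)"
    by (metis matrix_mul_assoc)
  ultimately have "adj ?U ** ?U = mat 1" by (simp add: aJ J')
  then have "unitary ?U" unfolding unitary_def using matrix_left_right_inverse by blast
  with JA J J' that show ?thesis by blast
qed

text \<open>The Cartesian decomposition with both parts taken skew-adjoint, the form in which Cayley
  transforms apply.\<close>

lemma skew_decomposition:
  assumes "von_neumann_algebra \<A>" "A \<in> \<A>"
  obtains K L where "K \<in> \<A>" "adj K = - K" "L \<in> \<A>" "adj L = - L" "A = K + \<i> *\<^sub>m L"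
proof
  note vn = von_neumann_algebraD[OF assms(1)]
  show "(1/2) *\<^sub>m (A - adj A) \<in> \<A>" "(- \<i>/2) *\<^sub>m (A + adj A) \<in> \<A>"
    by (rule vn(7)[OF vn(6)[OF assms(2) vn(4)[OF assms(2)]]],
        rule vn(7)[OF vn(5)[OF assms(2) vn(4)[OF assms(2)]]])
  show "A = (1/2) *\<^sub>m (A - adj A) + \<i> *\<^sub>m ((- \<i>/2) *\<^sub>m (A + adj A))"
    by (simp add: vec_eq_iff field_simps)
qed (simp_all add: adj_cscale adj_diff adj_add vec_eq_iff field_simps)

text \<open>Commuting with the Cayley transform \<open>2 *\<^sub>m J - mat 1\<close> means commuting
  with \<open>J\<close>, hence with its inverse \<open>mat 1 - K\<close> and with \<open>K\<close>;
  skew-adjoint elements span the algebra over the complex numbers.\<close>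

lemma commute_unitaries:
  assumes \<A>: "von_neumann_algebra \<A>" and "A \<in> \<A>"
    and comm: "\<And>U. unitary U \<Longrightarrow> U \<in> \<A> \<Longrightarrow> X ** U = U ** X"
  shows "X ** A = A ** X"
proof -
  note vn = von_neumann_algebraD[OF \<A>]
  have skew: "X ** K = K ** X" if K: "K \<in> \<A>" "adj K = - K" for K
  proof -
    obtain J where J: "J \<in> \<A>" "J ** (mat 1 - K) = mat 1" "(mat 1 - K) ** J = mat 1"
      "unitary ((mat 1 + K) ** J)"
      using cayley_inverse[OF \<A> K] .
    have "(mat 1 + K) ** J = 2 *\<^sub>m J - mat 1"
    proof -
      have "(mat 1 + K) ** J = 2 *\<^sub>m J - (mat 1 - K) ** J"
        by (simp add: matrix_add_rdistrib mat_mult_diff_left vec_eq_iff)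
      then show ?thesis by (simp add: J)
    qed
    moreover have "X ** ((mat 1 + K) ** J) = (mat 1 + K) ** J ** X"
      using J K vn by (intro comm) auto
    ultimately have "2 *\<^sub>m (X ** J) = 2 *\<^sub>m (J ** X)"
      by (simp add: mat_mult_diff_left mat_mult_diff_right mult_cscale_left mult_cscale_right)
    then have XJ: "X ** J = J ** X"
      using cmat.scale_left_imp_eq[of 2 "X ** J" "J ** X"] by simp
    have "(mat 1 - K) ** X = (mat 1 - K) ** (X ** J) ** (mat 1 - K)"
      by (metis J(2) matrix_mul_assoc matrix_mul_rid)
    also have "\<dots> = ((mat 1 - K) ** J) ** X ** (mat 1 - K)"
      unfolding XJ by (simp only: matrix_mul_assoc)
    finally have "(mat 1 - K) ** X = X ** (mat 1 - K)" by (simp add: J)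
    then show ?thesis by (simp add: mat_mult_diff_left mat_mult_diff_right)
  qed
  obtain K L where "K \<in> \<A>" "adj K = - K" "L \<in> \<A>" "adj L = - L" "A = K + \<i> *\<^sub>m L"
    using skew_decomposition[OF \<A> \<open>A \<in> \<A>\<close>] .
  then show ?thesis
    by (simp add: matrix_add_ldistrib matrix_add_rdistrib mult_cscale_left mult_cscale_right skew)
qed

lemma gauge_group_eq: "gauge_group \<A> = {U \<in> commutant \<A>. unitary U}"
  by (auto simp: unitary_centralizer_def commutant_def)

text \<open>Commuting with the unitaries of the commutant means commuting with all of it, so this is
  the double commutant theorem in unitary form. It locates twirled operators in \<A> and identifies
  \<open>gauge_group'\<close> with the unitaries of \<A>.\<close>

lemma commutant_gauge_group:
  assumes "von_neumann_algebra \<A>"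
  shows "commutant (gauge_group \<A>) = \<A>"
proof -
  have vn: "von_neumann_algebra (commutant \<A>)"
    by (rule von_neumann_commutant) (use assms in \<open>simp add: von_neumann_algebraD\<close>)
  have "X \<in> commutant (commutant \<A>)" if X: "X \<in> commutant (gauge_group \<A>)" for X
    unfolding commutant_def[of "commutant \<A>"]
    using commute_unitaries[OF vn] commutantD[OF X] by (simp add: gauge_group_eq) 
  then have "commutant (gauge_group \<A>) \<subseteq> \<A>"
    using double_commutant[OF assms] by blast
  moreover have "\<A> \<subseteq> commutant (gauge_group \<A>)"
    by (auto simp: commutant_def unitary_centralizer_def)
  ultimately show ?thesis by blast
qed

lemma gauge_group'_eq:
  assumes "von_neumann_algebra \<A>"
  shows "gauge_group' \<A> = {U \<in> \<A>. unitary U}"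
  using commutant_gauge_group[OF assms] gauge_group_eq by metis

section \<open>Haar measure on the unitary group of a von Neumann algebra\<close>

lemma nn_integral_lborel_shift:
  fixes h :: "'a::euclidean_space \<Rightarrow> ennreal"
  assumes [measurable]: "h \<in> borel_measurable borel"
  shows "(\<integral>\<^sup>+x. h (c + x) \<partial>lborel) = (\<integral>\<^sup>+x. h x \<partial>lborel)"
proof -
  have "(\<integral>\<^sup>+x. h x \<partial>lborel) = (\<integral>\<^sup>+x. h x \<partial>distr lborel borel ((+) c))"
    by (simp add: lborel_distr_plus)
  also have "\<dots> = (\<integral>\<^sup>+x. h (c + x) \<partial>lborel)"
    by (subst nn_integral_distr) auto
  finally show ?thesis by simp
qed

text \<open>Two translation-invariant measures \<open>\<mu>\<close> and \<open>\<nu>\<close> satisfy \<open>\<mu>(A) \<nu>(B) = \<nu>(A) \<mu>(- B)\<close>;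
  here \<open>\<mu>\<close> is the image of Lebesgue measure \<open>\<nu>\<close>, and \<open>B\<close> is the unit ball, whose measure does
  not change.\<close>

lemma lborel_distr_isometry:
  fixes f :: "'a::euclidean_space \<Rightarrow> 'a"
  assumes f: "linear f" and norm: "\<And>x. norm (f x) = norm x"
  shows "distr lborel borel f = lborel"
proof (rule measure_eqI)
  fix A :: "'a set" assume "A \<in> sets (distr lborel borel f)"
  then have A [measurable]: "A \<in> sets borel" by simp
  have [measurable]: "f \<in> borel_measurable borel"
    using f by (intro borel_measurable_continuous_onI linear_continuous_on) (simp add: linear_conv_bounded_linear)
  have "inj f"
    using f norm by (metis linear_injective_0 norm_eq_zero)
  then have "surj f" using f linear_injective_imp_surjective by blast
  then obtain g where g: "f (g y) = y" for y by (metis surjD)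
  define B where "B = ball (0 :: 'a) 1"
  have [measurable]: "B \<in> sets borel" by (simp add: B_def)
  have "emeasure (distr lborel borel f) A * emeasure lborel B
      = (\<integral>\<^sup>+y. emeasure (distr lborel borel f) A * indicator B y \<partial>lborel)"
    by (simp add: nn_integral_cmult_indicator)
  also have "\<dots> = (\<integral>\<^sup>+y. (\<integral>\<^sup>+x. indicator A (f x + y) * indicator B y \<partial>lborel) \<partial>lborel)"
  proof (rule nn_integral_cong)
    fix y
    have "emeasure (distr lborel borel f) A = (\<integral>\<^sup>+x. indicator A x \<partial>distr lborel borel f)"
      by (simp add: nn_integral_indicator)
    also have "\<dots> = (\<integral>\<^sup>+x. indicator A (f x) \<partial>lborel)"
      by (subst nn_integral_distr) auto
    also have "\<dots> = (\<integral>\<^sup>+x. indicator A (f (g y + x)) \<partial>lborel)"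
      by (subst nn_integral_lborel_shift) auto
    also have "\<dots> = (\<integral>\<^sup>+x. indicator A (f x + y) \<partial>lborel)"
      by (simp add: linear_add[OF f] g add.commute)
    finally show "emeasure (distr lborel borel f) A * indicator B y
        = (\<integral>\<^sup>+x. indicator A (f x + y) * indicator B y \<partial>lborel)"
      by (subst nn_integral_multc) auto
  qed
  also have "\<dots> = (\<integral>\<^sup>+x. (\<integral>\<^sup>+y. indicator A (f x + y) * indicator B y \<partial>lborel) \<partial>lborel)"
    by (rule lborel_pair.Fubini') measurable
  also have "\<dots> = (\<integral>\<^sup>+x. (\<integral>\<^sup>+y. indicator A y * indicator B (y - f x) \<partial>lborel) \<partial>lborel)"
  proof (rule nn_integral_cong)
    fix x
    have "(\<integral>\<^sup>+y. indicator A y * indicator B (y - f x) \<partial>lborel)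
        = (\<integral>\<^sup>+y. indicator A (f x + y) * indicator B (f x + y - f x) \<partial>lborel)"
      by (subst nn_integral_lborel_shift[of "\<lambda>y. indicator A y * indicator B (y - f x)"]) auto
    then show "(\<integral>\<^sup>+y. indicator A (f x + y) * indicator B y \<partial>lborel)
        = (\<integral>\<^sup>+y. indicator A y * indicator B (y - f x) \<partial>lborel)"
      by simp
  qed
  also have "\<dots> = (\<integral>\<^sup>+y. (\<integral>\<^sup>+x. indicator A y * indicator B (y - f x) \<partial>lborel) \<partial>lborel)"
    by (rule lborel_pair.Fubini'[symmetric]) measurable
  also have "\<dots> = (\<integral>\<^sup>+y. indicator A y * emeasure lborel B \<partial>lborel)"
  proof (rule nn_integral_cong)
    fix y
    have "(\<integral>\<^sup>+x. indicator B (y - f x) \<partial>lborel) = (\<integral>\<^sup>+x. indicator B (y - f (g y + x)) \<partial>lborel)"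
      by (subst nn_integral_lborel_shift[of "\<lambda>x. indicator B (y - f x)"]) auto
    \<comment> \<open>Here y - f (g y + x) equals - f x, and the ball is invariant under
      \<open>f\<close> and under negation.\<close>
    also have "\<dots> = (\<integral>\<^sup>+x. indicator B x \<partial>lborel)"
      by (intro nn_integral_cong) (simp add: linear_add[OF f] g norm B_def indicator_def)
    finally show "(\<integral>\<^sup>+x. indicator A y * indicator B (y - f x) \<partial>lborel) = indicator A y * emeasure lborel B"
      by (subst nn_integral_cmult) (auto simp: nn_integral_indicator)
  qed
  also have "\<dots> = emeasure lborel A * emeasure lborel B"
    by (subst nn_integral_multc) (auto simp: nn_integral_indicator)
  finally have "emeasure (distr lborel borel f) A * emeasure lborel B = emeasure lborel A * emeasure lborel B" .
  moreover have "emeasure lborel B \<noteq> 0"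
    unfolding B_def using content_ball_pos[of 1 "0 :: 'a"] by (auto simp: measure_def)
  moreover have "emeasure lborel B \<noteq> \<infinity>"
    unfolding B_def using emeasure_lborel_ball_finite[of "0 :: 'a" 1] by simp
  ultimately show "emeasure (distr lborel borel f) A = emeasure lborel A"
    using ennreal_mult_cancel_left[of "emeasure lborel B" "emeasure (distr lborel borel f) A" "emeasure lborel A"]
    by (simp only: mult.commute[of "emeasure lborel B"] infinity_ennreal_def) blast
qed simp

lemma norm_cmat: "norm (A :: 'm::finite cmat) = L2_set (\<lambda>i. L2_set (\<lambda>j. cmod (A $ i $ j)) UNIV) UNIV"
  by (simp add: norm_vec_def)

lemma norm_adj [simp]: "norm (adj A) = norm (A :: 'm::finite cmat)"
proof -
  have "(norm B)\<^sup>2 = (\<Sum>i\<in>UNIV. \<Sum>j\<in>UNIV. (cmod (B $ i $ j))\<^sup>2)" for B :: "'m cmat"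
    by (simp add: norm_cmat L2_set_def sum_nonneg)
  then have "(norm (adj A))\<^sup>2 = (norm A)\<^sup>2" using sum.swap by simp
  then show ?thesis by simp
qed

lemma norm_mult_le:
  fixes A B :: "'m::finite cmat"
  shows "norm (A ** B) \<le> norm A * norm B"
proof -
  let ?row = "\<lambda>i. L2_set (\<lambda>k. cmod (A $ i $ k)) UNIV"
  let ?col = "\<lambda>j. L2_set (\<lambda>k. cmod (B $ k $ j)) UNIV"
  have entry: "cmod ((A ** B) $ i $ j) \<le> ?row i * ?col j" for i j
  proof -
    have "cmod ((A ** B) $ i $ j) \<le> (\<Sum>k\<in>UNIV. \<bar>cmod (A $ i $ k)\<bar> * \<bar>cmod (B $ k $ j)\<bar>)"
      unfolding matrix_mult_nth by (rule order_trans[OF norm_sum]) (simp add: norm_mult)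
    also have "\<dots> \<le> ?row i * ?col j" by (rule L2_set_mult_ineq)
    finally show ?thesis .
  qed
  have "norm (A ** B) \<le> L2_set (\<lambda>i. L2_set (\<lambda>j. ?row i * ?col j) UNIV) UNIV"
    unfolding norm_cmat[of "A ** B"]
    by (rule L2_set_mono[OF L2_set_mono[OF entry]]) simp_all
  also have "\<dots> = L2_set ?row UNIV * L2_set ?col UNIV"
    by (simp add: L2_set_right_distrib[symmetric] L2_set_left_distrib[symmetric])
  also have "L2_set ?row UNIV = norm A" by (simp add: norm_cmat)
  also have "L2_set ?col UNIV = norm (adj B)" by (simp add: norm_cmat del: norm_adj)
  finally show ?thesis by simp
qed

lemma bounded_bilinear_mat_mult: "bounded_bilinear ((**) :: 'm::finite cmat \<Rightarrow> 'm cmat \<Rightarrow> 'm cmat)"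
  by unfold_locales (auto simp: matrix_add_ldistrib matrix_add_rdistrib scaleR_eq_cscale
      mult_cscale_left mult_cscale_right intro!: exI[of _ 1] norm_mult_le)

lemma bounded_linear_adj: "bounded_linear (adj :: 'm::finite cmat \<Rightarrow> 'm cmat)"
  by (rule bounded_linear_intro[where K = 1])
    (auto simp: adj_add scaleR_eq_cscale adj_cscale)

lemmas tendsto_mat_mult = bounded_bilinear.tendsto[OF bounded_bilinear_mat_mult]
lemmas continuous_on_mat_mult = bounded_bilinear.continuous_on[OF bounded_bilinear_mat_mult]
lemmas tendsto_adj = bounded_linear.tendsto[OF bounded_linear_adj]
lemmas continuous_on_adj = bounded_linear.continuous_on[OF bounded_linear_adj]

lemma unitaryD:
  assumes "unitary U"
  shows "adj U ** U = mat 1" "U ** adj U = mat 1" "adj U ** (U ** X) = X" "U ** (adj U ** X) = X"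
  using assms by (auto simp: unitary_def matrix_mul_assoc)

lemma unitary_adj: "unitary U \<Longrightarrow> unitary (adj U)"
  by (simp add: unitary_def)

lemma unitary_mult: "unitary U \<Longrightarrow> unitary V \<Longrightarrow> unitary (U ** V)"
  by (simp add: unitary_def adj_mult) (metis matrix_mul_assoc matrix_mul_rid)

lemma norm_unitary_mult: "unitary U \<Longrightarrow> norm (U ** A) = norm (A :: 'm::finite cmat)"
  by (simp add: norm_eq_sqrt_inner inner_mult_left unitaryD)

section \<open>Polar factor of a nearly unitary matrix\<close>

definition unitary_defect :: "'m::finite cmat \<Rightarrow> 'm cmat" where
  "unitary_defect Y = mat 1 - adj Y ** Y"

text \<open>The Newton--Schulz iteration for the unitary factor of the polar decomposition; it is
  polynomial and equivariant under left multiplication by unitaries.\<close>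

definition newton_schulz :: "'m::finite cmat \<Rightarrow> 'm cmat" where
  "newton_schulz Y = Y + (1/2) *\<^sub>R (Y ** unitary_defect Y)"

text \<open>\<open>lim\<close> always returns some value; it is a genuine limit when the defect has
  norm at most 1/2. Being given by \<open>lim\<close> of polynomial maps, it is Borel measurable
  everywhere.\<close>

definition polar_part :: "'m::finite cmat \<Rightarrow> 'm cmat" where
  "polar_part Y = lim (\<lambda>k. (newton_schulz ^^ k) Y)"

lemma
  fixes A B :: "'m::finite cmat"
  shows scaleR_mult_left: "(r *\<^sub>R A) ** B = r *\<^sub>R (A ** B)"
    and scaleR_mult_right: "A ** (r *\<^sub>R B) = r *\<^sub>R (A ** B)"
  by (simp_all add: scaleR_eq_cscale mult_cscale_left mult_cscale_right)

text \<open>With \<open>R\<close> the defect, \<open>adj Y ** Y\<close> is 1 - R and commutes with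
  \<open>R\<close>, so the new defect is 1 - (1 + R/2)^2 (1 - R). The constant 1/2 in the iteration
  is the one that cancels the linear term.\<close>

lemma unitary_defect_newton_schulz:
  fixes Y :: "'m::finite cmat"
  shows "unitary_defect (newton_schulz Y) =
     (3/4) *\<^sub>R (unitary_defect Y ** unitary_defect Y) +
     (1/4) *\<^sub>R (unitary_defect Y ** unitary_defect Y ** unitary_defect Y)"
proof -
  define R where "R = unitary_defect Y"
  have R: "adj Y ** Y = mat 1 - R" "adj R = R"
    by (simp_all add: R_def unitary_defect_def adj_diff adj_mult)
  have N: "newton_schulz Y = Y ** (mat 1 + (1/2) *\<^sub>R R)"
    by (simp add: newton_schulz_def R_def matrix_add_ldistrib scaleR_eq_cscale mult_cscale_right)
  have "adj (newton_schulz Y) ** newton_schulz Y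
      = (mat 1 + (1/2) *\<^sub>R R) ** (adj Y ** Y) ** (mat 1 + (1/2) *\<^sub>R R)"
    by (simp add: N adj_mult adj_add scaleR_eq_cscale adj_cscale R(2) matrix_mul_assoc)
  also have "\<dots> = (mat 1 - (1/2) *\<^sub>R R - (1/2) *\<^sub>R (R ** R)) ** (mat 1 + (1/2) *\<^sub>R R)"
  proof -
    have "(mat 1 + (1/2) *\<^sub>R R) ** (mat 1 - R) = mat 1 - (1/2) *\<^sub>R R - (1/2) *\<^sub>R (R ** R)"
      by (simp add: matrix_add_rdistrib mat_mult_diff_right scaleR_mult_left vec_eq_iff complex_eq_iff)
    then show ?thesis by (simp only: R(1))
  qed
  also have "\<dots> = mat 1 - (3/4) *\<^sub>R (R ** R) - (1/4) *\<^sub>R (R ** R ** R)"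
    by (simp add: matrix_add_ldistrib matrix_add_rdistrib mat_mult_diff_left scaleR_mult_left
        scaleR_mult_right vec_eq_iff complex_eq_iff field_simps)
  finally show ?thesis by (simp add: unitary_defect_def[of "newton_schulz Y"] R_def)
qed

text \<open>Each of R^2 and R^3 has norm at most r/2, and the weights 3/4 and 1/4 add up to 1.
  Halving is weaker than the true quadratic rate but already gives geometric decay.\<close>

lemma norm_unitary_defect_newton_schulz:
  assumes "norm (unitary_defect Y) \<le> 1/2"
  shows "norm (unitary_defect (newton_schulz Y)) \<le> norm (unitary_defect Y) / 2"
proof -
  define R where "R = unitary_defect Y"
  define r where "r = norm R"
  have r: "0 \<le> r" "r \<le> 1/2" using assms by (auto simp: r_def R_def)
  have "norm (R ** R) \<le> r * r" using norm_mult_le[of R R] by (simp add: r_def)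
  also have "\<dots> \<le> r * (1/2)" using r by (intro mult_left_mono) auto
  finally have 2: "norm (R ** R) \<le> r / 2" by simp
  have "norm (R ** R ** R) \<le> norm (R ** R) * r" using norm_mult_le[of "R ** R" R] by (simp add: r_def)
  also have "\<dots> \<le> r / 2 * 1" using 2 r by (intro mult_mono) auto
  finally have 3: "norm (R ** R ** R) \<le> r / 2" by simp
  have "norm (unitary_defect (newton_schulz Y)) \<le> 3/4 * norm (R ** R) + 1/4 * norm (R ** R ** R)"
    unfolding unitary_defect_newton_schulz R_def[symmetric] by (rule norm_triangle_le) simp
  then show ?thesis using 2 3 by (simp add: r_def R_def)
qed

text \<open>The squared Frobenius norm is the trace of \<open>adj Y ** Y\<close>, that is, the inner
  product of the identity with 1 minus the defect.\<close>

lemma norm_le_of_unitary_defect: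
  fixes Y :: "'m::finite cmat"
  assumes "norm (unitary_defect Y) \<le> 1/2"
  shows "norm Y \<le> norm (mat 1 :: 'm cmat) + 1"
proof -
  let ?n = "norm (mat 1 :: 'm cmat)"
  have "(norm Y)\<^sup>2 = inner (mat 1) (mat 1 - unitary_defect Y)"
    unfolding power2_norm_eq_inner by (simp add: inner_cmat unitary_defect_def)
  also have "\<dots> \<le> ?n * (?n + 1/2)"
    by (rule order_trans[OF norm_cauchy_schwarz])
      (use assms norm_triangle_ineq4[of "mat 1" "unitary_defect Y"] in \<open>auto intro!: mult_left_mono\<close>)
  also have "\<dots> \<le> (?n + 1)\<^sup>2" by (simp add: power2_eq_square algebra_simps)
  finally show ?thesis by (rule power2_le_imp_le) simp
qed

lemma newton_schulz_iterates:
  assumes "norm (unitary_defect Y) \<le> 1/2"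
  shows "norm (unitary_defect ((newton_schulz ^^ k) Y)) \<le> (1/2) ^ (k + 1)"
proof (induction k)
  case (Suc k)
  have "(1/2::real) ^ (k + 1) \<le> (1/2) ^ 1" by (rule power_decreasing) auto
  then have "norm (unitary_defect ((newton_schulz ^^ k) Y)) \<le> 1/2" using Suc by simp
  from norm_unitary_defect_newton_schulz[OF this] Suc show ?case by simp
qed (use assms in simp)

text \<open>Consecutive iterates differ by half of \<open>Y ** unitary_defect Y\<close>: the first
  factor stays bounded and the second decays geometrically, so the increments are summable and
  telescope.\<close>

lemma newton_schulz_tendsto:
  fixes Y :: "'m::finite cmat"
  assumes Y: "norm (unitary_defect Y) \<le> 1/2"
  shows "(\<lambda>k. (newton_schulz ^^ k) Y) \<longlonglongrightarrow> polar_part Y"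
proof -
  define y where "y k = (newton_schulz ^^ k) Y" for k
  define b where "b = norm (mat 1 :: 'm cmat) + 1"
  note defect = newton_schulz_iterates[OF Y, folded y_def]
  have "norm (y (Suc k) - y k) \<le> b * (1/2) ^ k" for k
  proof -
    have small: "norm (unitary_defect (y k)) \<le> 1/2"
      using defect[of k] power_decreasing[of 1 "k + 1" "1/2 :: real"] by simp
    have "norm (y (Suc k) - y k) = 1/2 * norm (y k ** unitary_defect (y k))"
      by (simp add: y_def newton_schulz_def)
    also have "\<dots> \<le> 1 * (norm (y k) * norm (unitary_defect (y k)))"
      by (intro mult_mono norm_mult_le) auto
    also have "\<dots> \<le> b * (1/2) ^ k"
    proof -
      have "norm (unitary_defect (y k)) \<le> (1/2) ^ k"
        using order_trans[OF defect[of k] power_decreasing[of k "k + 1" "1/2 :: real"]] by simp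
      then show ?thesis
        unfolding mult_1 using norm_le_of_unitary_defect[OF small]
        by (intro mult_mono) (auto simp: b_def)
    qed
    finally show ?thesis .
  qed
  then have "summable (\<lambda>k. y (Suc k) - y k)"
    by (intro summable_comparison_test'[OF summable_mult[OF summable_geometric], of "1/2" 0 _ b]) auto
  then have "convergent (\<lambda>n. \<Sum>k<n. y (Suc k) - y k)" by (simp add: summable_iff_convergent)
  then have "convergent (\<lambda>n. y n - y 0)" by (simp add: sum_lessThan_telescope)
  from convergent_add[OF this convergent_const[of "y 0"]] have "convergent y" by simp
  then show ?thesis by (simp add: convergent_LIMSEQ_iff polar_part_def y_def[abs_def])
qed

lemma unitary_polar_part:
  assumes Y: "norm (unitary_defect Y) \<le> 1/2"
  shows "unitary (polar_part Y)"
proof -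
  have "(\<lambda>k. unitary_defect ((newton_schulz ^^ k) Y)) \<longlonglongrightarrow> unitary_defect (polar_part Y)"
    unfolding unitary_defect_def
    by (intro tendsto_diff tendsto_const tendsto_mat_mult tendsto_adj newton_schulz_tendsto[OF Y])
  moreover have "(\<lambda>k. unitary_defect ((newton_schulz ^^ k) Y)) \<longlonglongrightarrow> 0"
  proof (rule Lim_null_comparison[where g = "\<lambda>k. (1/2) ^ (k + 1)"])
    show "(\<lambda>k. (1/2::real) ^ (k + 1)) \<longlonglongrightarrow> 0"
      by (rule LIMSEQ_ignore_initial_segment[OF LIMSEQ_power_zero]) simp
  qed (use newton_schulz_iterates[OF Y] in auto)
  ultimately have "unitary_defect (polar_part Y) = 0" by (rule LIMSEQ_unique)
  then have "adj (polar_part Y) ** polar_part Y = mat 1" by (simp add: unitary_defect_def)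
  then show ?thesis unfolding unitary_def using matrix_left_right_inverse by blast
qed

lemma polar_part_in:
  assumes K: "von_neumann_algebra \<K>" and Y: "norm (unitary_defect Y) \<le> 1/2" "Y \<in> \<K>"
  shows "polar_part Y \<in> \<K>"
proof -
  note vn = von_neumann_algebraD[OF K]
  have "newton_schulz X \<in> \<K>" if "X \<in> \<K>" for X
    unfolding newton_schulz_def unitary_defect_def scaleR_eq_cscale using that vn by simp
  then have "(newton_schulz ^^ k) Y \<in> \<K>" for k
    by (induction k) (use Y in auto)
  moreover have "closed \<K>" by (rule closed_subspace[OF subspace_cmat_subspace[OF vn(1)]])
  ultimately show ?thesis
    using closed_sequentially[OF _ _ newton_schulz_tendsto[OF Y(1)]] by simp
qed

lemma unitary_defect_mult: "unitary V \<Longrightarrow> unitary_defect (V ** Y) = unitary_defect Y"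
  by (simp add: unitary_defect_def adj_mult matrix_mul_assoc[symmetric] unitaryD)

lemma polar_part_mult:
  assumes V: "unitary V" and Y: "norm (unitary_defect Y) \<le> 1/2"
  shows "polar_part (V ** Y) = V ** polar_part Y"
proof -
  have "newton_schulz (V ** X) = V ** newton_schulz X" for X
    by (simp add: newton_schulz_def unitary_defect_mult[OF V] matrix_add_ldistrib scaleR_eq_cscale
        mult_cscale_right matrix_mul_assoc)
  then have "(newton_schulz ^^ k) (V ** Y) = V ** (newton_schulz ^^ k) Y" for k
    by (induction k) auto
  moreover have "(\<lambda>k. V ** (newton_schulz ^^ k) Y) \<longlonglongrightarrow> V ** polar_part Y"
    by (intro tendsto_mat_mult tendsto_const newton_schulz_tendsto[OF Y])
  ultimately have "(\<lambda>k. (newton_schulz ^^ k) (V ** Y)) \<longlonglongrightarrow> V ** polar_part Y" by simp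
  then show ?thesis unfolding polar_part_def[of "V ** Y"] by (rule limI)
qed

text \<open>Haar measure is the image of Lebesgue measure, restricted to a bounded invariant open set of
  matrices, under projection to \<open>\<K>\<close> followed by \<^const>\<open>polar_part\<close>.\<close>

theorem normalized_haar_exists:
  fixes \<K> :: "'m::finite cmat set"
  assumes K: "von_neumann_algebra \<K>"
  shows "\<exists>\<mu>. is_normalized_haar {U \<in> \<K>. unitary U} \<mu>"
proof -
  note vn = von_neumann_algebraD[OF K]
  define G where "G = {U \<in> \<K>. unitary U}"
  have S: "subspace \<K>" by (rule subspace_cmat_subspace[OF vn(1)])
  define E where "E = proj \<K>"
  have E_in: "E X \<in> \<K>" for X unfolding E_def by (rule proj_in[OF S])
  have E_mult: "E (V ** X) = V ** E X" if "V \<in> \<K>" for V X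
    unfolding E_def
    by (rule proj_commute[OF S, where R' = "(**) (adj V)"])
      (use that vn in \<open>auto simp: inner_mult_left scaleR_eq_cscale mult_cscale_right
        matrix_add_ldistrib intro!: linearI\<close>)
  have contE: "continuous_on UNIV E"
    unfolding E_def using linear_proj[OF S] by (simp add: linear_continuous_on linear_conv_bounded_linear)
  \<comment> \<open>The first bound makes the Lebesgue measure of \<open>D\<close> finite and
    exceeds the norm of the identity, which therefore lies in \<open>D\<close>; the second is the
    range in which the iteration converges.\<close>
  define D where "D = {X. norm X < norm (mat 1 :: 'm cmat) + 1 \<and> norm (unitary_defect (E X)) < 1/2}"
  have "open D"
    unfolding D_def unitary_defect_def
    by (intro open_Collect_conj open_Collect_less continuous_intros continuous_on_mat_mult
        continuous_on_adj contE)
  then have [measurable]: "D \<in> sets borel" by simp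
  have "mat 1 \<in> D" by (simp add: D_def unitary_defect_def E_def proj_id[OF S vn(2)])
  have "bounded D" unfolding bounded_iff D_def by (auto intro!: exI[of _ "norm (mat 1 :: 'm cmat) + 1"])
  have D0: "emeasure lborel D \<noteq> 0"
  proof -
    obtain e where e: "e > 0" "ball (mat 1) e \<subseteq> D"
      using \<open>open D\<close> \<open>mat 1 \<in> D\<close> open_contains_ball by blast
    then have "emeasure lborel (ball (mat 1 :: 'm cmat) e) \<le> emeasure lborel D"
      by (intro emeasure_mono) auto
    moreover have "emeasure lborel (ball (mat 1 :: 'm cmat) e) \<noteq> 0"
      using content_ball_pos[OF e(1), of "mat 1 :: 'm cmat"] by (auto simp: measure_def)
    ultimately show ?thesis by auto
  qed
  have D1: "emeasure lborel D \<noteq> \<infinity>"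
    using emeasure_bounded_finite[OF \<open>bounded D\<close>] by simp
  \<comment> \<open>Off \<open>D\<close>, a null set for the uniform measure on \<open>D\<close>,
    the default \<open>mat 1\<close> keeps the values in \<open>G\<close>.\<close>
  define f where "f X = (if X \<in> D then polar_part (E X) else mat 1)" for X
  have f_in: "f X \<in> G" for X
    using E_in vn(2) by (auto simp: f_def D_def G_def unitary_def[of "mat 1"] intro!: unitary_polar_part polar_part_in[OF K])
  have [measurable]: "f \<in> borel_measurable borel"
  proof -
    have "continuous_on UNIV (\<lambda>X. (newton_schulz ^^ k) (E X))" for k
    proof (induction k)
      case (Suc k)
      then show ?case
        by (simp add: newton_schulz_def unitary_defect_def) (intro continuous_intros continuous_on_mat_mult continuous_on_adj)
    qed (use contE in simp)
    then have [measurable]: "(\<lambda>X. (newton_schulz ^^ k) (E X)) \<in> borel_measurable borel" for k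
      by (rule borel_measurable_continuous_onI)
    have [measurable]: "(\<lambda>X. polar_part (E X)) \<in> borel_measurable borel"
      unfolding polar_part_def by measurable
    show ?thesis unfolding f_def by measurable
  qed
  have VD: "V ** X \<in> D \<longleftrightarrow> X \<in> D" if "V \<in> G" for V X
    using that by (simp add: D_def G_def norm_unitary_mult E_mult unitary_defect_mult)
  have fV: "f (V ** X) = V ** f X" if "V \<in> G" "X \<in> D" for V X
  proof -
    have "f (V ** X) = polar_part (V ** E X)"
      using that VD[OF that(1), of X] E_mult[of V X] by (simp add: f_def G_def)
    also have "\<dots> = V ** polar_part (E X)"
      using that by (intro polar_part_mult) (auto simp: G_def D_def)
    finally show ?thesis using that by (simp add: f_def)
  qed
  have G_adj: "adj V \<in> G" if "V \<in> G" for V using that vn by (auto simp: G_def unitary_adj)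
  have G_mult: "V ** W \<in> G" if "V \<in> G" "W \<in> G" for V W using that vn by (auto simp: G_def unitary_mult)
  define U where "U = uniform_measure lborel D"
  define \<mu> where "\<mu> = distr U (restrict_space borel G) f"
  have fU: "f \<in> measurable U (restrict_space borel G)"
    unfolding U_def by (intro measurable_restrict_space2) (auto simp: f_in)
  have "is_normalized_haar G \<mu>"
    unfolding is_normalized_haar_def
  proof (intro conjI ballI)
    have "prob_space U" unfolding U_def using D0 D1 by (intro prob_space_uniform_measure) auto
    then show "prob_space \<mu>" unfolding \<mu>_def using fU by (rule prob_space.prob_space_distr)
    show "sets \<mu> = sets (restrict_space borel G)" by (simp add: \<mu>_def)
    fix V B assume V: "V \<in> G" and B: "B \<in> sets \<mu>"
    then have B': "B \<in> sets (restrict_space borel G)" by (simp add: \<mu>_def)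
    then have BG: "B \<subseteq> G" using sets.sets_into_space[OF B'] by (simp add: space_restrict_space)
    have meas: "(\<lambda>W :: 'm cmat. adj V ** W) \<in> borel_measurable borel"
    proof (rule borel_measurable_continuous_onI)
      show "continuous_on UNIV (\<lambda>W :: 'm cmat. adj V ** W)"
        using continuous_on_mat_mult[OF continuous_on_const continuous_on_id] .
    qed
    have u: "unitary V" using V unfolding G_def by blast
    have in_image: "W \<in> (\<lambda>W. V ** W) ` B \<longleftrightarrow> adj V ** W \<in> B" for W
    proof
      assume "adj V ** W \<in> B"
      then have "V ** (adj V ** W) \<in> (\<lambda>W. V ** W) ` B" by (rule imageI)
      then show "W \<in> (\<lambda>W. V ** W) ` B" by (simp only: unitaryD[OF u])
    next
      assume "W \<in> (\<lambda>W. V ** W) ` B"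
      then obtain X where "X \<in> B" "W = V ** X" by blast
      then show "adj V ** W \<in> B" by (simp add: unitaryD[OF u])
    qed
    have "(\<lambda>W. V ** W) ` B = (**) (adj V) -` B \<inter> space (restrict_space borel G)"
      using BG G_mult[OF V] in_image by (auto simp: space_restrict_space unitaryD(3)[OF u])
    moreover have "(**) (adj V) \<in> measurable (restrict_space borel G) (restrict_space borel G)"
      by (intro measurable_restrict_space2 measurable_restrict_space1 meas)
        (auto simp: space_restrict_space G_mult[OF G_adj[OF V]])
    ultimately have VB: "(\<lambda>W. V ** W) ` B \<in> sets (restrict_space borel G)"
      using B' by (metis measurable_sets)
    have uni: "emeasure \<mu> B = emeasure lborel (D \<inter> f -` B) / emeasure lborel D"
      if "B \<in> sets (restrict_space borel G)" for B
      using measurable_sets[OF fU that] that fU unfolding \<mu>_def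
      by (subst emeasure_distr) (auto simp: U_def)
    \<comment> \<open>By equivariance the preimage of the translated set is a translate of the
      preimage, and left multiplication by a unitary is a linear isometry of the matrix space, hence
      preserves Lebesgue measure.\<close>
    have "D \<inter> f -` ((\<lambda>W. V ** W) ` B) = (**) (adj V) -` (D \<inter> f -` B)"
      unfolding vimage_def in_image using VD[OF G_adj[OF V]] fV[OF G_adj[OF V]] by auto
    moreover have "D \<inter> f -` B \<in> sets borel"
      using measurable_sets[OF fU B'] by (simp add: U_def)
    moreover have "distr lborel borel (\<lambda>W :: 'm cmat. adj V ** W) = lborel"
      using V by (intro lborel_distr_isometry linearI)
        (auto simp: matrix_add_ldistrib scaleR_mult_right G_def norm_unitary_mult unitary_adj)
    ultimately have "emeasure lborel (D \<inter> f -` ((\<lambda>W. V ** W) ` B)) = emeasure lborel (D \<inter> f -` B)"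
      using emeasure_distr[of "(**) (adj V)" lborel borel "D \<inter> f -` B"] meas by simp
    then show "emeasure \<mu> ((\<lambda>W. V ** W) ` B) = emeasure \<mu> B"
      by (simp add: uni B' VB)
  qed
  then show ?thesis by (auto simp: G_def)
qed

section \<open>Twirling\<close>

text \<open>The gauge group is the unitary group of the commutant, itself a von Neumann algebra, so
  the choice in \<open>haar\<close> has a witness.\<close>

lemma haar_normalized:
  assumes "von_neumann_algebra \<A>"
  shows "is_normalized_haar (gauge_group \<A>) (haar (gauge_group \<A>))"
proof -
  have "von_neumann_algebra (commutant \<A>)"
    by (rule von_neumann_commutant) (use assms in \<open>simp add: von_neumann_algebraD\<close>)
  then show ?thesis
    unfolding haar_def gauge_group_eq by (rule someI_ex[OF normalized_haar_exists])
qed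

lemma gauge_groupD:
  assumes "V \<in> gauge_group \<A>"
  shows "unitary V" and "A \<in> \<A> \<Longrightarrow> V ** A = A ** V"
  using assms by (auto simp: unitary_centralizer_def)

lemma unitary_commutes_adj:
  assumes "unitary V" "V ** A = A ** V"
  shows "adj V ** A = A ** adj V"
proof -
  have "adj V ** A = adj V ** (A ** V) ** adj V"
    by (simp add: matrix_mul_assoc[symmetric] unitaryD[OF assms(1)])
  also have "\<dots> = A ** adj V"
    by (simp add: assms(2)[symmetric] matrix_mul_assoc[symmetric] unitaryD[OF assms(1)])
  finally show ?thesis .
qed

lemma gauge_group_adj: "V \<in> gauge_group \<A> \<Longrightarrow> adj V \<in> gauge_group \<A>"
  by (simp add: unitary_centralizer_def unitary_adj unitary_commutes_adj)

lemma gauge_group_mult: "V \<in> gauge_group \<A> \<Longrightarrow> W \<in> gauge_group \<A> \<Longrightarrow> V ** W \<in> gauge_group \<A>"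
  unfolding unitary_centralizer_def by (auto simp: unitary_mult) (metis matrix_mul_assoc)

locale gauge =
  fixes \<A> :: "'d::finite cmat set"
  assumes vN: "von_neumann_algebra \<A>"
begin

abbreviation "G \<equiv> gauge_group \<A>"

lemma prob_haar: "prob_space (haar G)"
  and sets_haar [measurable_cong]: "sets (haar G) = sets (restrict_space borel G)"
  and haar_invariant: "V \<in> G \<Longrightarrow> B \<in> sets (haar G) \<Longrightarrow> emeasure (haar G) ((\<lambda>W. V ** W) ` B) = emeasure (haar G) B"
  using haar_normalized[OF vN] unfolding is_normalized_haar_def by blast+

lemma space_haar: "space (haar G) = G"
  using sets_eq_imp_space_eq[OF sets_haar] by (simp add: space_restrict_space)

lemma borel_measurable_haar: "continuous_on UNIV f \<Longrightarrow> f \<in> borel_measurable (haar G)"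
  by (subst measurable_cong_sets[OF sets_haar refl])
    (rule measurable_restrict_space1[OF borel_measurable_continuous_onI])

text \<open>\<open>is_normalized_haar\<close> speaks of images of sets and a change of variables
  needs preimages; the preimage under \<open>V\<close> is the image under
  \<open>adj V\<close>.\<close>

lemma distr_haar_mult:
  assumes V: "V \<in> G"
  shows "distr (haar G) (haar G) (\<lambda>W. V ** W) = haar G"
proof (rule measure_eqI)
  have mult: "(\<lambda>W. V ** W) \<in> measurable (haar G) (haar G)"
  proof (subst measurable_cong_sets[OF refl sets_haar], rule measurable_restrict_space2)
    show "(\<lambda>W. V ** W) \<in> space (haar G) \<rightarrow> G"
      using gauge_group_mult[OF V] by (simp add: space_haar)
    show "(\<lambda>W. V ** W) \<in> borel_measurable (haar G)"
      by (intro borel_measurable_haar continuous_on_mat_mult continuous_on_const continuous_on_id)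
  qed
  fix B assume "B \<in> sets (distr (haar G) (haar G) (\<lambda>W. V ** W))"
  then have B: "B \<in> sets (haar G)" by simp
  then have BG: "B \<subseteq> G" using sets.sets_into_space[OF B] by (simp add: space_haar)
  have u: "unitary V" using gauge_groupD(1)[OF V] .
  have "(\<lambda>W. adj V ** W) ` B = (\<lambda>W. V ** W) -` B \<inter> space (haar G)"
  proof (intro equalityI subsetI)
    fix W assume "W \<in> (\<lambda>W. adj V ** W) ` B"
    then obtain X where "X \<in> B" "W = adj V ** X" by blast
    then show "W \<in> (\<lambda>W. V ** W) -` B \<inter> space (haar G)"
      using BG gauge_group_mult[OF gauge_group_adj[OF V]] by (auto simp: unitaryD(4)[OF u] space_haar)
  next
    fix W assume "W \<in> (\<lambda>W. V ** W) -` B \<inter> space (haar G)"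
    then have "adj V ** (V ** W) \<in> (\<lambda>W. adj V ** W) ` B" by blast
    then show "W \<in> (\<lambda>W. adj V ** W) ` B" by (simp only: unitaryD(3)[OF u])
  qed
  then show "emeasure (distr (haar G) (haar G) (\<lambda>W. V ** W)) B = emeasure (haar G) B"
    using haar_invariant[OF gauge_group_adj[OF V] B] emeasure_distr[OF mult B] by simp
qed simp

text \<open>The integrand is bounded, all unitaries having the norm of the identity; without
  integrability the integral in \<open>twirl\<close> would default to zero.\<close>

lemma conj_integrable: "integrable (haar G) (\<lambda>V. V ** X ** adj V)"
proof -
  interpret prob_space "haar G" by (rule prob_haar)
  have "norm (V ** X ** adj V) \<le> norm X * norm (mat 1 :: 'd cmat)" if "V \<in> G" for V
  proof -
    have u: "unitary V" by (rule gauge_groupD(1)[OF that])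
    have "norm (V ** X ** adj V) = norm (X ** adj V)"
      using norm_unitary_mult[OF u] by (simp add: matrix_mul_assoc[symmetric])
    also have "\<dots> \<le> norm X * norm (adj V)" by (rule norm_mult_le)
    also have "norm (adj V) = norm (mat 1 :: 'd cmat)"
      using norm_unitary_mult[OF u, of "mat 1"] by simp
    finally show ?thesis .
  qed
  then show ?thesis
    by (intro integrable_const_bound[where B = "norm X * norm (mat 1 :: 'd cmat)"] borel_measurable_haar
        continuous_on_mat_mult continuous_on_const continuous_on_id continuous_on_adj)
      (auto simp: space_haar)
qed

text \<open>Substituting W V for V conjugates the integral by W and leaves its value unchanged, so
  it commutes with the whole gauge group, whose commutant is \<A>.\<close>

lemma twirl_in: "twirl G X \<in> \<A>"
proof -
  have "twirl G X ** W = W ** twirl G X" if W: "W \<in> G" for W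
  proof -
    have u: "unitary W" using gauge_groupD(1)[OF W] .
    have bl: "bounded_linear (\<lambda>A. W ** A ** adj W)"
      by (intro bounded_linear_compose[OF bounded_bilinear.bounded_linear_left[OF bounded_bilinear_mat_mult]]
          bounded_bilinear.bounded_linear_right[OF bounded_bilinear_mat_mult])
    have "twirl G X = (\<integral>V. V ** X ** adj V \<partial>distr (haar G) (haar G) (\<lambda>V. W ** V))"
      by (simp add: distr_haar_mult[OF W] twirl_def)
    also have "\<dots> = (\<integral>V. (W ** V) ** X ** adj (W ** V) \<partial>haar G)"
    proof (rule integral_distr)
      show "(\<lambda>V. W ** V) \<in> measurable (haar G) (haar G)"
      proof (subst measurable_cong_sets[OF refl sets_haar], rule measurable_restrict_space2)
        show "(\<lambda>V. W ** V) \<in> space (haar G) \<rightarrow> G"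
          using gauge_group_mult[OF W] by (simp add: space_haar)
      qed (intro borel_measurable_haar continuous_on_mat_mult continuous_on_const continuous_on_id)
    qed (use conj_integrable borel_measurable_integrable in blast)
    also have "\<dots> = (\<integral>V. W ** (V ** X ** adj V) ** adj W \<partial>haar G)"
      by (simp add: adj_mult matrix_mul_assoc)
    also have "\<dots> = W ** twirl G X ** adj W"
      unfolding twirl_def by (rule integral_bounded_linear[OF bl conj_integrable])
    finally have "twirl G X ** W = W ** twirl G X ** adj W ** W" by simp
    then show ?thesis by (simp add: matrix_mul_assoc[symmetric] unitaryD[OF u])
  qed
  then show ?thesis using commutant_gauge_group[OF vN] by (auto simp: commutant_def)
qed

end

section \<open>Tensor products\<close>

lemma tensor_op_nth: "tensor_op f $ a $ b = (\<Prod>k\<in>UNIV. f k $ a k $ b k)"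
  by (simp add: tensor_op_def)

lemma tensor_op_mult: "tensor_op f ** tensor_op g = tensor_op (\<lambda>k. f k ** g k)"
  by (simp add: vec_eq_iff matrix_mult_nth tensor_op_nth prod_sum_UNIV prod.distrib)

lemma adj_tensor_op: "adj (tensor_op f) = tensor_op (\<lambda>k. adj (f k))"
  by (simp add: vec_eq_iff tensor_op_nth)

lemma tensor_op_one: "tensor_op (\<lambda>_. mat 1) = mat 1"
proof -
  have "(\<Prod>k\<in>UNIV. mat 1 $ a k $ b k) = (if a = b then 1 else (0 :: complex))" for a b :: "'a \<Rightarrow> 'b"
  proof (cases "a = b")
    case False
    then obtain k where "a k \<noteq> b k" by blast
    then show ?thesis using False by (intro prod_zero[THEN trans]) (auto simp: mat_def)
  qed (simp add: mat_def)
  then show ?thesis by (simp add: vec_eq_iff tensor_op_nth mat_def)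
qed

lemma tensor_pow_mult: "tensor_pow V ** tensor_pow W = tensor_pow (V ** W)"
  and adj_tensor_pow: "adj (tensor_pow V) = tensor_pow (adj V)"
  and tensor_pow_one: "tensor_pow (mat 1) = mat 1"
  by (simp_all add: tensor_pow_def tensor_op_mult adj_tensor_op tensor_op_one)

lemma superop_pow_add: "superop_pow T (X + Y) = superop_pow T X + superop_pow T Y"
  by (simp add: superop_pow_def cmat.scale_left_distrib sum.distrib)

lemma superop_pow_cscale: "superop_pow T (c *\<^sub>m X) = c *\<^sub>m superop_pow T X"
  by (simp add: superop_pow_def cmat.scale_sum_right)

definition tensor_permute :: "('n::finite \<Rightarrow> 'n) \<Rightarrow> ('n, 'd::finite) tensor_mat \<Rightarrow> ('n, 'd) tensor_mat" where
  "tensor_permute \<pi> X = (\<chi> a b. X $ (a \<circ> \<pi>) $ (b \<circ> \<pi>))"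

lemma bij_comp_permutes:
  assumes "\<pi> permutes UNIV"
  shows "bij (\<lambda>a. a \<circ> \<pi>)"
  using permutes_inv_o[OF assms]
  by (intro o_bij[of "\<lambda>a. a \<circ> inv \<pi>"]) (auto simp: fun_eq_iff comp_def)

text \<open>The same \<open>T\<close> acts in every factor, so permuting the factors only reindexes
  the expansion in matrix units.\<close>

lemma superop_pow_permute:
  assumes \<pi>: "\<pi> permutes UNIV"
  shows "superop_pow T (tensor_permute \<pi> X) = tensor_permute \<pi> (superop_pow T X)"
proof -
  have perm: "tensor_permute \<pi> (tensor_op (\<lambda>k. f (a k) (b k))) = tensor_op (\<lambda>k. f ((a \<circ> inv \<pi>) k) ((b \<circ> inv \<pi>) k))"
    for f and a b :: "'a \<Rightarrow> 'b"
  proof -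
    have "(\<Prod>k\<in>UNIV. f (a k) (b k) $ c (\<pi> k) $ e (\<pi> k)) = (\<Prod>k\<in>UNIV. f (a (inv \<pi> k)) (b (inv \<pi> k)) $ c k $ e k)" for c e
      using prod.reindex_bij_betw[OF permutes_imp_bij[OF \<pi>],
          of "\<lambda>k. f (a (inv \<pi> k)) (b (inv \<pi> k)) $ c k $ e k"]
      by (simp add: permutes_inverses[OF \<pi>])
    then show ?thesis by (simp add: tensor_permute_def tensor_op_nth vec_eq_iff)
  qed
  have "superop_pow T (tensor_permute \<pi> X) =
      (\<Sum>a\<in>UNIV. \<Sum>b\<in>UNIV. X $ (a \<circ> \<pi>) $ (b \<circ> \<pi>) *\<^sub>m tensor_op (\<lambda>k. T (mat_unit (a k) (b k))))"
    by (simp add: superop_pow_def tensor_permute_def)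
  also have "\<dots> = (\<Sum>a\<in>UNIV. \<Sum>b\<in>UNIV. X $ a $ b *\<^sub>m tensor_permute \<pi> (tensor_op (\<lambda>k. T (mat_unit (a k) (b k)))))"
  proof -
    have "tensor_permute \<pi> (tensor_op (\<lambda>k. T (mat_unit ((a \<circ> \<pi>) k) ((b \<circ> \<pi>) k)))) = tensor_op (\<lambda>k. T (mat_unit (a k) (b k)))"
      for a b
      using perm[of "\<lambda>x y. T (mat_unit x y)" "a \<circ> \<pi>" "b \<circ> \<pi>"] by (simp add: permutes_inverses[OF \<pi>])
    then show ?thesis
      by (subst sum.reindex_bij_betw[OF bij_comp_permutes[OF \<pi>], symmetric],
          subst (2) sum.reindex_bij_betw[OF bij_comp_permutes[OF \<pi>], symmetric]) simp
  qed
  also have "\<dots> = tensor_permute \<pi> (superop_pow T X)"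
    by (simp add: superop_pow_def tensor_permute_def vec_eq_iff sum_component)
  finally show ?thesis .
qed

context gauge
begin

abbreviation "local_haar \<equiv> PiM (UNIV :: 'n::finite set) (\<lambda>_. haar G)"

lemma prob_local_haar: "prob_space (local_haar :: ('n::finite \<Rightarrow> _) measure)"
  by (rule prob_space_PiM) (rule prob_haar)

lemma space_local_haar: "V \<in> space (local_haar :: ('n::finite \<Rightarrow> _) measure) \<longleftrightarrow> (\<forall>k. V k \<in> G)"
  by (auto simp: space_PiM space_haar PiE_def)

text \<open>Each entry of the conjugated operator is a sum of products with one integrand per tensor
  factor, so Fubini for the product measure splits the average into the one-factor twirls that
  define \<open>superop_pow\<close>.\<close>

lemma twirl_pow_integral:
  fixes X :: "('n::finite, 'd) tensor_mat"
  shows "integrable local_haar (\<lambda>V. tensor_op V ** X ** adj (tensor_op V))" (is "integrable _ ?Q")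
    and "twirl_pow \<A> X = (\<integral>V. tensor_op V ** X ** adj (tensor_op V) \<partial>local_haar)"
proof -
  interpret prob_space "haar G" by (rule prob_haar)
  interpret product_sigma_finite "\<lambda>_ :: 'n. haar G" ..
  have entry: "integrable (haar G) (\<lambda>V. V $ c $ a * cnj (V $ e $ b))"
      "twirl G (mat_unit a b) $ c $ e = (\<integral>V. V $ c $ a * cnj (V $ e $ b) \<partial>haar G)" for a b c e
  proof -
    have unit: "(V ** mat_unit a b ** adj V) $ c $ e = V $ c $ a * cnj (V $ e $ b)" for V
    proof -
      have "(V ** mat_unit a b) $ c $ k = (if k = b then V $ c $ a else 0)" for k
        by (cases "k = b") (simp_all add: matrix_mult_nth mat_unit_nth if_distrib[of "times _"] cong: if_cong)
      then show ?thesis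
        by (simp add: matrix_mult_nth[of "V ** mat_unit a b"] if_distrib[of "\<lambda>x. x * _"] cong: if_cong)
    qed
    have bl: "bounded_linear (\<lambda>A :: 'd cmat. A $ c $ e)"
      by (intro bounded_linear_compose[OF bounded_linear_vec_nth bounded_linear_vec_nth])
    show "integrable (haar G) (\<lambda>V. V $ c $ a * cnj (V $ e $ b))"
      using integrable_bounded_linear[OF bl conj_integrable[of "mat_unit a b"]] by (simp add: unit)
    show "twirl G (mat_unit a b) $ c $ e = (\<integral>V. V $ c $ a * cnj (V $ e $ b) \<partial>haar G)"
      using integral_bounded_linear[OF bl conj_integrable[of "mat_unit a b"]] by (simp add: unit twirl_def)
  qed
  have Q: "?Q V $ c $ e = (\<Sum>a\<in>UNIV. \<Sum>b\<in>UNIV. X $ a $ b * (\<Prod>k\<in>UNIV. V k $ c k $ a k * cnj (V k $ e k $ b k)))" for V c e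
  proof -
    have "?Q V $ c $ e = (\<Sum>b\<in>UNIV. \<Sum>a\<in>UNIV. X $ a $ b * (\<Prod>k\<in>UNIV. V k $ c k $ a k * cnj (V k $ e k $ b k)))"
      by (simp add: matrix_mult_nth tensor_op_nth adj_tensor_op sum_distrib_left sum_distrib_right prod.distrib mult_ac)
    then show ?thesis by (subst sum.swap) simp
  qed
  have int_prod: "integrable local_haar (\<lambda>V. \<Prod>k\<in>UNIV. V k $ c k $ a k * cnj (V k $ e k $ b k))"
    for a b c e :: "'n \<Rightarrow> 'd"
    by (rule product_integrable_prod[where f = "\<lambda>k V. V $ c k $ a k * cnj (V $ e k $ b k)"]) (auto intro: entry)
  have int_entry: "integrable local_haar (\<lambda>V. ?Q V $ c $ e)" for c e
    unfolding Q by (intro Bochner_Integration.integrable_sum integrable_mult_right int_prod)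
  have "integrable local_haar (\<lambda>V. \<Sum>c\<in>UNIV. \<Sum>e\<in>UNIV. (?Q V $ c $ e) *\<^sub>m mat_unit c e)"
  proof (intro Bochner_Integration.integrable_sum)
    fix c e :: "'n \<Rightarrow> 'd"
    have "linear (\<lambda>z. z *\<^sub>m mat_unit c e)"
      by (rule linearI) (simp_all add: cmat.scale_left_distrib scaleR_eq_cscale scaleR_conv_of_real)
    then show "integrable local_haar (\<lambda>V. (?Q V $ c $ e) *\<^sub>m mat_unit c e)"
      by (intro integrable_bounded_linear[OF _ int_entry]) (simp add: linear_conv_bounded_linear)
  qed
  then show int: "integrable local_haar ?Q" by (simp only: cmat_sum_units[symmetric])
  show "twirl_pow \<A> X = integral\<^sup>L local_haar ?Q"
  proof (unfold vec_eq_iff, intro allI)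
    fix c e
    have bl: "bounded_linear (\<lambda>A :: ('n, 'd) tensor_mat. A $ c $ e)"
      by (intro bounded_linear_compose[OF bounded_linear_vec_nth bounded_linear_vec_nth])
    have "integral\<^sup>L local_haar ?Q $ c $ e = (\<integral>V. ?Q V $ c $ e \<partial>local_haar)"
      by (rule integral_bounded_linear[OF bl int, symmetric])
    also have "\<dots> = (\<Sum>a\<in>UNIV. \<Sum>b\<in>UNIV. X $ a $ b * (\<integral>V. (\<Prod>k\<in>UNIV. V k $ c k $ a k * cnj (V k $ e k $ b k)) \<partial>local_haar))"
      unfolding Q by (subst Bochner_Integration.integral_sum, intro Bochner_Integration.integrable_sum integrable_mult_right int_prod)
        (simp add: int_prod)
    also have "\<dots> = (\<Sum>a\<in>UNIV. \<Sum>b\<in>UNIV. X $ a $ b * (\<Prod>k\<in>UNIV. twirl G (mat_unit (a k) (b k)) $ c k $ e k))"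
      by (subst product_integral_prod[where f = "\<lambda>k V. V $ c k $ _ k * cnj (V $ e k $ _ k)"]) (auto simp: entry)
    also have "\<dots> = twirl_pow \<A> X $ c $ e"
      by (simp add: twirl_pow_def superop_pow_def sum_component tensor_op_nth)
    finally show "twirl_pow \<A> X $ c $ e = integral\<^sup>L local_haar ?Q $ c $ e" by simp
  qed
qed

lemma twirl_pow_linear_integral:
  fixes f :: "('n::finite, 'd) tensor_mat \<Rightarrow> 'b::euclidean_space"
  assumes "linear f"
  shows "integrable local_haar (\<lambda>V. f (tensor_op V ** X ** adj (tensor_op V)))"
    and "f (twirl_pow \<A> X) = (\<integral>V. f (tensor_op V ** X ** adj (tensor_op V)) \<partial>local_haar)"
proof -
  have "bounded_linear f" using assms by (simp add: linear_conv_bounded_linear)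
  then show "integrable local_haar (\<lambda>V. f (tensor_op V ** X ** adj (tensor_op V)))"
    "f (twirl_pow \<A> X) = (\<integral>V. f (tensor_op V ** X ** adj (tensor_op V)) \<partial>local_haar)"
    unfolding twirl_pow_integral(2)
    by (auto intro: integrable_bounded_linear twirl_pow_integral(1)
        integral_bounded_linear[OF _ twirl_pow_integral(1), symmetric])
qed

text \<open>An identity that holds for each product of gauge unitaries passes to the average.
  Linearity is over the reals, so \<open>adj\<close> is an admissible \<open>f\<close>.\<close>

lemma twirl_pow_transfer:
  fixes f :: "('n::finite, 'd) tensor_mat \<Rightarrow> 'b::euclidean_space"
  assumes "linear f" "linear g"
    and "\<And>V. (\<And>k. V k \<in> G) \<Longrightarrow> f (tensor_op V ** X ** adj (tensor_op V)) = g (tensor_op V ** Y ** adj (tensor_op V))"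
  shows "f (twirl_pow \<A> X) = g (twirl_pow \<A> Y)"
  unfolding twirl_pow_linear_integral(2)[OF assms(1)] twirl_pow_linear_integral(2)[OF assms(2)]
  by (rule Bochner_Integration.integral_cong) (auto simp: space_local_haar assms(3))

lemma twirl_pow_const:
  fixes f :: "('n::finite, 'd) tensor_mat \<Rightarrow> 'b::euclidean_space"
  assumes "linear f"
    and "\<And>V. (\<And>k. V k \<in> G) \<Longrightarrow> f (tensor_op V ** X ** adj (tensor_op V)) = c"
  shows "f (twirl_pow \<A> X) = c"
proof -
  interpret prob_space "local_haar :: ('n \<Rightarrow> _) measure" by (rule prob_local_haar)
  have "f (twirl_pow \<A> X) = (\<integral>V. c \<partial>(local_haar :: ('n \<Rightarrow> _) measure))"
    unfolding twirl_pow_linear_integral(2)[OF assms(1)]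
    by (rule Bochner_Integration.integral_cong) (auto simp: space_local_haar assms(2))
  then show ?thesis by (simp add: prob_space)
qed

lemma twirl_pow_nonneg:
  fixes f :: "('n::finite, 'd) tensor_mat \<Rightarrow> real"
  assumes "linear f"
    and "\<And>V. (\<And>k. V k \<in> G) \<Longrightarrow> 0 \<le> f (tensor_op V ** X ** adj (tensor_op V))"
  shows "0 \<le> f (twirl_pow \<A> X)"
  unfolding twirl_pow_linear_integral(2)[OF assms(1)]
  by (rule Bochner_Integration.integral_nonneg) (auto simp: space_local_haar assms(2))

lemma twirl_pow_in: "twirl_pow \<A> X \<in> tensor_pow_algebra \<A>"
  unfolding twirl_pow_def superop_pow_def tensor_pow_algebra_def
  by (intro cmat.span_sum cmat.span_scale cmat.span_base) (auto intro: twirl_in)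

end

section \<open>Commutants of tensor powers\<close>

text \<open>One complex variable is enough: the density arguments below run along a complex line in
  the algebra, on which infinitely many zeros force vanishing everywhere.\<close>

definition polynomial_mat :: "(complex \<Rightarrow> 'm::finite cmat) \<Rightarrow> bool" where
  "polynomial_mat F \<longleftrightarrow> (\<forall>i j. \<exists>p. \<forall>z. F z $ i $ j = poly p z)"

lemma poly_fun_sum:
  assumes "finite I" "\<And>i. i \<in> I \<Longrightarrow> \<exists>p. \<forall>z. f i z = poly p (z :: complex)"
  shows "\<exists>p. \<forall>z. (\<Sum>i\<in>I. f i z) = poly p z"
proof -
  obtain p where "\<forall>i\<in>I. \<forall>z. f i z = poly (p i) z" using assms(2) by metis
  then show ?thesis by (intro exI[of _ "sum p I"]) (simp add: poly_sum)
qed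

lemma poly_fun_prod:
  assumes "finite I" "\<And>i. i \<in> I \<Longrightarrow> \<exists>p. \<forall>z. f i z = poly p (z :: complex)"
  shows "\<exists>p. \<forall>z. (\<Prod>i\<in>I. f i z) = poly p z"
proof -
  obtain p where "\<forall>i\<in>I. \<forall>z. f i z = poly (p i) z" using assms(2) by metis
  then show ?thesis by (intro exI[of _ "prod p I"]) (simp add: poly_prod)
qed

lemma polynomial_mat_const: "polynomial_mat (\<lambda>_. A)"
  unfolding polynomial_mat_def
proof (intro allI)
  fix i j show "\<exists>p. \<forall>z. A $ i $ j = poly p z" by (intro exI[of _ "[: A $ i $ j :]"]) simp
qed

lemma polynomial_mat_diff:
  assumes "polynomial_mat F" "polynomial_mat H"
  shows "polynomial_mat (\<lambda>z. F z - H z)"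
  unfolding polynomial_mat_def
proof (intro allI)
  fix i j
  obtain p q where "\<forall>z. F z $ i $ j = poly p z" "\<forall>z. H z $ i $ j = poly q z"
    using assms unfolding polynomial_mat_def by metis
  then show "\<exists>p. \<forall>z. (F z - H z) $ i $ j = poly p z" by (intro exI[of _ "p - q"]) simp
qed

lemma polynomial_mat_mult:
  assumes "polynomial_mat F" "polynomial_mat H"
  shows "polynomial_mat (\<lambda>z. F z ** H z)"
  unfolding polynomial_mat_def
proof (intro allI)
  fix i j
  have "\<exists>r. \<forall>z. F z $ i $ k * H z $ k $ j = poly r z" for k
  proof -
    obtain p q where "\<forall>z. F z $ i $ k = poly p z" "\<forall>z. H z $ k $ j = poly q z"
      using assms unfolding polynomial_mat_def by metis
    then show ?thesis by (intro exI[of _ "p * q"]) simp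
  qed
  then show "\<exists>p. \<forall>z. (F z ** H z) $ i $ j = poly p z"
    unfolding matrix_mult_nth by (intro poly_fun_sum) auto
qed

lemma polynomial_mat_tensor_pow: "polynomial_mat (\<lambda>z. tensor_pow (A + z *\<^sub>m B))"
  unfolding polynomial_mat_def tensor_pow_def tensor_op_nth
proof (intro allI poly_fun_prod)
  fix a b k
  show "\<exists>p. \<forall>z. (A + z *\<^sub>m B) $ a k $ b k = poly p z"
    by (intro exI[of _ "[: A $ a k $ b k, B $ a k $ b k :]"]) simp
qed simp

lemma polynomial_mat_eq_0:
  assumes F: "polynomial_mat F" and inf: "infinite {z. F z = 0}"
  shows "F z = 0"
proof (unfold vec_eq_iff, intro allI)
  fix i j
  obtain p where p: "\<And>z. F z $ i $ j = poly p z" using F unfolding polynomial_mat_def by metis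
  have "{z. F z = 0} \<subseteq> {z. poly p z = 0}" by (auto simp flip: p)
  then have "infinite {z. poly p z = 0}" using inf finite_subset by blast
  then have "p = 0" using poly_roots_finite by blast
  then show "F z $ i $ j = 0 $ i $ j" by (simp add: p)
qed

lemma infinite_complex_greater: "infinite {complex_of_real r | r. r > b}"
proof
  assume "finite {complex_of_real r | r. r > b}"
  then have "finite (Re ` {complex_of_real r | r. r > b})" by (rule finite_imageI)
  moreover have "Re ` {complex_of_real r | r. r > b} = {b<..}" by force
  ultimately show False using infinite_Ioi[of b] by metis
qed

lemma cscale_mult_cscale: "(c *\<^sub>m A) ** (e *\<^sub>m B) = (c * e) *\<^sub>m (A ** B)"
  by (simp add: mult_cscale_left mult_cscale_right mult.commute)

lemma sum_constant_cmat: "(\<Sum>i\<in>I. A) = of_nat (card I) *\<^sub>m (A :: 'm::finite cmat)"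
  by (induction I rule: infinite_finite_induct) (simp_all add: cmat.scale_left_distrib del: sum_constant)

text \<open>Carries the passage from powers of unitaries to powers of all elements and then to
  symmetric operators; instantiated both with the commutant of \<A> and with \<A>.\<close>

locale commutes_with_unitary_powers =
  fixes \<K> :: "'d::finite cmat set" and C :: "('n::finite, 'd) tensor_mat"
  assumes K: "von_neumann_algebra \<K>"
    and unitary_powers: "\<And>U. U \<in> \<K> \<Longrightarrow> unitary U \<Longrightarrow> C ** tensor_pow U = tensor_pow U ** C"
begin

lemmas vn = von_neumann_algebraD[OF K]

abbreviation T :: "'d cmat \<Rightarrow> ('n, 'd) tensor_mat" where "T \<equiv> tensor_pow"

text \<open>Commutation with the power of the Cayley transform (1 + H) J, multiplied by the power of
  1 - H on both sides: the inverse J cancels and a relation polynomial in H remains.\<close>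

lemma cayley_skew:
  assumes H: "H \<in> \<K>" "adj H = - H"
  shows "T (mat 1 - H) ** C ** T (mat 1 + H) = T (mat 1 + H) ** C ** T (mat 1 - H)"
proof -
  obtain J where J: "J \<in> \<K>" "J ** (mat 1 - H) = mat 1" "(mat 1 - H) ** J = mat 1"
      "unitary ((mat 1 + H) ** J)"
    using cayley_inverse[OF K H] .
  have "C ** (T (mat 1 + H) ** T J) = T (mat 1 + H) ** T J ** C"
    using unitary_powers[OF _ J(4)] J(1) H vn by (simp add: tensor_pow_mult)
  then have "T (mat 1 - H) ** (C ** (T (mat 1 + H) ** T J)) ** T (mat 1 - H)
      = T (mat 1 - H) ** (T (mat 1 + H) ** T J ** C) ** T (mat 1 - H)" by simp
  moreover have "T (mat 1 - H) ** (C ** (T (mat 1 + H) ** T J)) ** T (mat 1 - H)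
      = T (mat 1 - H) ** C ** T (mat 1 + H) ** (T J ** T (mat 1 - H))"
    by (simp only: matrix_mul_assoc)
  moreover have "T J ** T (mat 1 - H) = mat 1" by (simp add: tensor_pow_mult J tensor_pow_one)
  moreover have comm: "T (mat 1 - H) ** T (mat 1 + H) = T (mat 1 + H) ** T (mat 1 - H)"
    by (simp add: tensor_pow_mult matrix_add_ldistrib matrix_add_rdistrib mat_mult_diff_left mat_mult_diff_right)
  have "T (mat 1 - H) ** (T (mat 1 + H) ** T J ** C) ** T (mat 1 - H)
      = T (mat 1 - H) ** T (mat 1 + H) ** T J ** C ** T (mat 1 - H)"
    by (simp only: matrix_mul_assoc)
  moreover have "T (mat 1 - H) ** T (mat 1 + H) ** T J ** C ** T (mat 1 - H)
      = T (mat 1 + H) ** (T (mat 1 - H) ** T J) ** C ** T (mat 1 - H)"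
    unfolding comm by (simp only: matrix_mul_assoc)
  moreover have "T (mat 1 - H) ** T J = mat 1" by (simp add: tensor_pow_mult J tensor_pow_one)
  ultimately show ?thesis by simp
qed

text \<open>The relation is polynomial in \<open>H\<close>, and the skew-adjoint elements are Zariski dense.\<close>

lemma cayley_all:
  assumes H: "H \<in> \<K>"
  shows "T (mat 1 - H) ** C ** T (mat 1 + H) = T (mat 1 + H) ** C ** T (mat 1 - H)"
proof -
  obtain L M where L: "L \<in> \<K>" "adj L = - L" and M: "M \<in> \<K>" "adj M = - M" and HLM: "H = L + \<i> *\<^sub>m M"
    using skew_decomposition[OF K H] .
  \<comment> \<open>\<open>F\<close> is the difference of both sides at
    \<open>L + z *\<^sub>m M\<close>, which is skew-adjoint for real z and equals \<open>H\<close>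
    at z = \<i>.\<close>
  define F where "F z = T ((mat 1 - L) + z *\<^sub>m (- M)) ** C ** T ((mat 1 + L) + z *\<^sub>m M)
      - T ((mat 1 + L) + z *\<^sub>m M) ** C ** T ((mat 1 - L) + z *\<^sub>m (- M))" for z
  have F: "F z = T (mat 1 - (L + z *\<^sub>m M)) ** C ** T (mat 1 + (L + z *\<^sub>m M))
      - T (mat 1 + (L + z *\<^sub>m M)) ** C ** T (mat 1 - (L + z *\<^sub>m M))" for z
    by (simp add: F_def algebra_simps)
  have "polynomial_mat F"
    unfolding F_def
    by (intro polynomial_mat_diff polynomial_mat_mult polynomial_mat_const polynomial_mat_tensor_pow)
  moreover have "F (complex_of_real r) = 0" for r
    unfolding F
    by (subst cayley_skew) (use L M vn in \<open>auto simp: adj_add adj_cscale algebra_simps\<close>)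
  then have "{complex_of_real r | r. r > 0} \<subseteq> {z. F z = 0}" by blast
  then have "infinite {z. F z = 0}" using infinite_complex_greater finite_subset by blast
  ultimately have "F \<i> = 0" by (rule polynomial_mat_eq_0)
  then show ?thesis by (simp add: F HLM)
qed

text \<open>H = (A - 1)(A + 1)^-1 inverts the Cayley transform: 1 - H = 2 J and 1 + H = 2 A J.
  Multiplying the relation for \<open>H\<close> on both sides by the power of (1 + A)/2 removes J
  and leaves the claim.\<close>

lemma tensor_pow_invertible_commutes:
  assumes A: "A \<in> \<K>" and J: "J ** (mat 1 + A) = mat 1" "(mat 1 + A) ** J = mat 1"
  shows "C ** T A = T A ** C"
proof -
  have "J \<in> \<K>"
    by (rule von_neumann_inverse[OF K _ J(2) J(1)]) (use A vn in simp)
  have AJ: "J ** A = A ** J"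
  proof -
    have "J ** (mat 1 + A) = (mat 1 + A) ** J" using J by simp
    then show ?thesis by (simp add: matrix_add_ldistrib matrix_add_rdistrib)
  qed
  define H where "H = (A - mat 1) ** J"
  have sum: "J + A ** J = mat 1" using J(2) by (simp add: matrix_add_rdistrib)
  then have J_eq: "J = mat 1 - A ** J" by (simp add: eq_diff_eq)
  have minus: "mat 1 - H = 2 *\<^sub>m J" and plus: "mat 1 + H = 2 *\<^sub>m (A ** J)"
  proof -
    have H: "H = A ** J - J" by (simp add: H_def mat_mult_diff_left)
    have "mat 1 - H = (J + A ** J) - (A ** J - J)" by (simp add: sum H)
    then show "mat 1 - H = 2 *\<^sub>m J" by (simp add: vec_eq_iff)
    have "mat 1 + H = (J + A ** J) + (A ** J - J)" by (simp add: sum H)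
    then show "mat 1 + H = 2 *\<^sub>m (A ** J)" by (simp add: vec_eq_iff)
  qed
  let ?B = "(1/2) *\<^sub>m (mat 1 + A)"
  have BJ: "?B ** (2 *\<^sub>m J) = mat 1" "?B ** (2 *\<^sub>m (A ** J)) = A" "(2 *\<^sub>m J) ** ?B = mat 1" "(2 *\<^sub>m (A ** J)) ** ?B = A"
  proof -
    have "(mat 1 + A) ** (A ** J) = A ** ((mat 1 + A) ** J)"
      by (simp add: matrix_add_ldistrib matrix_add_rdistrib matrix_mul_assoc)
    then have 1: "(mat 1 + A) ** (A ** J) = A" by (simp add: J)
    have 2: "A ** J ** (mat 1 + A) = A" by (simp add: matrix_mul_assoc[symmetric] J)
    show "?B ** (2 *\<^sub>m J) = mat 1" "?B ** (2 *\<^sub>m (A ** J)) = A" "(2 *\<^sub>m J) ** ?B = mat 1" "(2 *\<^sub>m (A ** J)) ** ?B = A"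
      by (simp_all only: cscale_mult_cscale 1 2 J) simp_all
  qed
  have "H \<in> \<K>" using A \<open>J \<in> \<K>\<close> vn by (simp add: H_def)
  from cayley_all[OF this]
  have "T (2 *\<^sub>m J) ** C ** T (2 *\<^sub>m (A ** J)) = T (2 *\<^sub>m (A ** J)) ** C ** T (2 *\<^sub>m J)"
    by (simp only: minus plus)
  then have "T ?B ** (T (2 *\<^sub>m J) ** C ** T (2 *\<^sub>m (A ** J))) ** T ?B
      = T ?B ** (T (2 *\<^sub>m (A ** J)) ** C ** T (2 *\<^sub>m J)) ** T ?B" by simp
  then have "(T ?B ** T (2 *\<^sub>m J)) ** C ** (T (2 *\<^sub>m (A ** J)) ** T ?B)
      = (T ?B ** T (2 *\<^sub>m (A ** J))) ** C ** (T (2 *\<^sub>m J) ** T ?B)"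
    by (simp only: matrix_mul_assoc)
  then show ?thesis by (simp only: tensor_pow_mult BJ tensor_pow_one matrix_mul_lid matrix_mul_rid)
qed

text \<open>Shifting by a large real multiple r of the identity makes 1 + A + r invertible; the
  commutator is polynomial in the shift, so its vanishing for all large r carries over to shift
  0.\<close>

lemma tensor_pow_commutes:
  assumes A: "A \<in> \<K>"
  shows "C ** T A = T A ** C"
proof -
  define F where "F z = C ** T (A + z *\<^sub>m mat 1) - T (A + z *\<^sub>m mat 1) ** C" for z
  have "polynomial_mat F"
    unfolding F_def
    by (intro polynomial_mat_diff polynomial_mat_mult polynomial_mat_const polynomial_mat_tensor_pow)
  moreover obtain b where b: "b > 0" "\<And>x. norm (A *v x) \<le> b * norm x"
    using linear_bounded_pos[OF matrix_vector_mul_linear[of A]] by blast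
  have "F (complex_of_real r) = 0" if "r > b" for r
  proof -
    let ?A = "A + complex_of_real r *\<^sub>m mat 1"
    have "x = 0" if x: "(mat 1 + ?A) *v x = 0" for x
    proof (rule ccontr)
      assume "x \<noteq> 0"
      have "A *v x = - ((r + 1) *\<^sub>R x)"
        using x by (simp add: matrix_vector_mult_add_rdistrib cscale_mult_vec scaleR_eq_smult[symmetric]
            scaleR_left_distrib add_eq_0_iff algebra_simps)
      then have "norm (A *v x) = (r + 1) * norm x" using \<open>r > b\<close> b(1) by simp
      moreover have "b * norm x < (r + 1) * norm x" using \<open>r > b\<close> \<open>x \<noteq> 0\<close> by simp
      ultimately show False using b(2)[of x] by simp
    qed
    then obtain J where "J ** (mat 1 + ?A) = mat 1" using matrix_left_invertible_ker by blast
    moreover from this have "(mat 1 + ?A) ** J = mat 1" using matrix_left_right_inverse by blast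
    ultimately have "C ** T ?A = T ?A ** C"
      by (intro tensor_pow_invertible_commutes) (use A vn in auto)
    then show ?thesis by (simp add: F_def)
  qed
  then have "{complex_of_real r | r. r > b} \<subseteq> {z. F z = 0}" by blast
  then have "infinite {z. F z = 0}" using infinite_complex_greater finite_subset by blast
  ultimately have "F 0 = 0" by (rule polynomial_mat_eq_0)
  then show ?thesis by (simp add: F_def)
qed

end

text \<open>Polarization, by inclusion--exclusion over the ranges of maps from factors to factors.\<close>

lemma tensor_pow_polarization:
  fixes f :: "'n::finite \<Rightarrow> 'd::finite cmat"
  shows "(\<Sum>\<pi> | \<pi> permutes UNIV. tensor_op (f \<circ> \<pi>)) =
    (\<Sum>S\<in>UNIV. (-1) ^ card (- S) *\<^sub>m tensor_pow (\<Sum>k\<in>S. f k))"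
proof (unfold vec_eq_iff, intro allI)
  fix a b :: "'n \<Rightarrow> 'd"
  define h where "h g = (\<Prod>j\<in>UNIV. f (g j) $ a j $ b j)" for g
  \<comment> \<open>The sum expands the product of 1 + u_k over all k, which vanishes as soon as
    some k is missed by \<open>g\<close>; so the signs select the surjective maps, which are the
    permutations.\<close>
  have alt: "(\<Sum>S\<in>UNIV. (-1) ^ card (- S) * (if range g \<subseteq> S then 1 else 0)) = (if surj g then 1 else (0 :: complex))"
    for g :: "'n \<Rightarrow> 'n"
  proof -
    let ?u = "\<lambda>k. if k \<in> range g then 0 else (-1 :: complex)"
    have "(\<Prod>k\<in>UNIV. 1 + ?u k) = (\<Sum>S\<in>Pow UNIV. (\<Prod>k\<in>S. 1) * (\<Prod>k\<in>UNIV - S. ?u k))"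
      by (rule prod_add) simp
    also have "\<dots> = (\<Sum>S\<in>UNIV. (-1) ^ card (- S) * (if range g \<subseteq> S then 1 else 0))"
    proof (rule sum.cong)
      fix S :: "'n set"
      show "(\<Prod>k\<in>S. 1) * (\<Prod>k\<in>UNIV - S. ?u k) = (-1) ^ card (- S) * (if range g \<subseteq> S then 1 else 0)"
      proof (cases "range g \<subseteq> S")
        case True
        then have "(\<Prod>k\<in>- S. ?u k) = (\<Prod>k\<in>- S. -1)" by (intro prod.cong) auto
        then show ?thesis using True by (simp add: Compl_eq_Diff_UNIV)
      next
        case False
        then obtain k where "k \<in> range g" "k \<notin> S" by blast
        then have "(\<Prod>k\<in>- S. ?u k) = 0" by (intro prod_zero) auto
        then show ?thesis using False by (simp add: Compl_eq_Diff_UNIV)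
      qed
    qed simp
    also have "(\<Prod>k\<in>UNIV. 1 + ?u k) = (if surj g then 1 else 0)"
    proof (cases "surj g")
      case False
      then obtain k where "k \<notin> range g" by auto
      then have "(\<Prod>k\<in>UNIV. 1 + ?u k) = 0" by (intro prod_zero) auto
      then show ?thesis using False by simp
    qed simp
    finally show ?thesis by simp
  qed
  have pow: "tensor_pow (\<Sum>k\<in>S. f k) $ a $ b = (\<Sum>g\<in>UNIV. (if range g \<subseteq> S then 1 else 0) * h g)" for S
  proof -
    have "tensor_pow (\<Sum>k\<in>S. f k) $ a $ b = (\<Sum>g\<in>PiE UNIV (\<lambda>_. S). h g)"
      by (simp add: tensor_pow_def tensor_op_nth sum_component prod_sum_PiE h_def)
    also have "\<dots> = (\<Sum>g\<in>UNIV. if g \<in> PiE UNIV (\<lambda>_. S) then h g else 0)"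
      by (simp add: sum.If_cases)
    also have "\<dots> = (\<Sum>g\<in>UNIV. (if range g \<subseteq> S then 1 else 0) * h g)"
      by (intro sum.cong) (auto simp: PiE_def)
    finally show ?thesis .
  qed
  have "(\<Sum>S\<in>UNIV. (-1) ^ card (- S) *\<^sub>m tensor_pow (\<Sum>k\<in>S. f k)) $ a $ b
      = (\<Sum>S\<in>UNIV. \<Sum>g\<in>UNIV. (-1) ^ card (- S) * (if range g \<subseteq> S then 1 else 0) * h g)"
    by (simp only: sum_component cscale_nth pow sum_distrib_left mult.assoc)
  also have "\<dots> = (\<Sum>g\<in>UNIV. (\<Sum>S\<in>UNIV. (-1) ^ card (- S) * (if range g \<subseteq> S then 1 else 0)) * h g)"
    by (subst sum.swap) (simp only: sum_distrib_right)
  also have "\<dots> = (\<Sum>g\<in>{g. surj g}. h g)"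
    unfolding alt by (simp add: sum.If_cases if_distrib[of "\<lambda>x. x * _"] cong: if_cong)
  also have "{g :: 'n \<Rightarrow> 'n. surj g} = {\<pi>. \<pi> permutes UNIV}"
    using finite_UNIV_surj_inj[of _ , OF finite] by (auto simp: bij_def dest: permutes_surj intro!: bij_imp_permutes)
  finally show "(\<Sum>\<pi> | \<pi> permutes UNIV. tensor_op (f \<circ> \<pi>)) $ a $ b
      = (\<Sum>S\<in>UNIV. (-1) ^ card (- S) *\<^sub>m tensor_pow (\<Sum>k\<in>S. f k)) $ a $ b"
    by (simp add: sum_component tensor_op_nth h_def)
qed

definition permute_op :: "('n::finite \<Rightarrow> 'n) \<Rightarrow> ('n, 'd::finite) tensor_mat" where
  "permute_op \<pi> = (\<chi> a b. if b = a \<circ> \<pi> then 1 else 0)"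

lemma permute_op_vec: "permute_op \<pi> *v \<psi> = (\<chi> a. \<psi> $ (a \<circ> \<pi>))"
  by (simp add: vec_eq_iff matrix_vector_mult_nth permute_op_def if_distrib[of "\<lambda>x. x * _"] cong: if_cong)

lemma tensor_permute_eq: "tensor_permute \<pi> X = permute_op \<pi> ** X ** adj (permute_op \<pi>)"
proof (unfold vec_eq_iff, intro allI)
  fix a b
  have "(permute_op \<pi> ** X) $ a $ c = X $ (a \<circ> \<pi>) $ c" for c
    by (simp add: matrix_mult_nth permute_op_def if_distrib[of "\<lambda>x. x * _"] cong: if_cong)
  then show "tensor_permute \<pi> X $ a $ b = (permute_op \<pi> ** X ** adj (permute_op \<pi>)) $ a $ b"
    by (simp add: matrix_mult_nth[of "permute_op \<pi> ** X"] tensor_permute_def)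
      (simp add: permute_op_def if_distrib[of "times _"] if_distrib[of cnj] cong: if_cong)
qed

lemma unitary_permute_op:
  assumes \<pi>: "\<pi> permutes UNIV"
  shows "unitary (permute_op \<pi> :: ('n::finite, 'd::finite) tensor_mat)"
proof -
  have "inj (\<lambda>a :: 'n \<Rightarrow> 'd. a \<circ> \<pi>)" using bij_comp_permutes[OF \<pi>] bij_is_inj by blast
  then have "tensor_permute \<pi> (mat 1) = (mat 1 :: ('n, 'd) tensor_mat)"
    by (auto simp: tensor_permute_def vec_eq_iff mat_def inj_def)
  then have "permute_op \<pi> ** adj (permute_op \<pi>) = (mat 1 :: ('n, 'd) tensor_mat)"
    by (simp add: tensor_permute_eq)
  then show ?thesis unfolding unitary_def using matrix_left_right_inverse by blast
qed

lemma tensor_permute_fixed_iff: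
  assumes "\<pi> permutes UNIV"
  shows "tensor_permute \<pi> X = X \<longleftrightarrow> permute_op \<pi> ** X = X ** permute_op \<pi>"
proof -
  note u = unitary_permute_op[OF assms]
  show ?thesis
    unfolding tensor_permute_eq
    by (metis matrix_mul_assoc matrix_mul_rid unitaryD(1,2)[OF u])
qed

lemma tensor_permute_tensor_op:
  assumes \<pi>: "\<pi> permutes UNIV"
  shows "tensor_permute \<pi> (tensor_op f) = tensor_op (f \<circ> inv \<pi>)"
proof -
  have "(\<Prod>k\<in>UNIV. f k $ a (\<pi> k) $ b (\<pi> k)) = (\<Prod>k\<in>UNIV. f (inv \<pi> k) $ a k $ b k)" for a b
    using prod.reindex_bij_betw[OF permutes_imp_bij[OF \<pi>], of "\<lambda>k. f (inv \<pi> k) $ a k $ b k"]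
    by (simp add: permutes_inverses[OF \<pi>])
  then show ?thesis by (simp add: tensor_permute_def tensor_op_nth vec_eq_iff)
qed

context commutes_with_unitary_powers
begin

text \<open>Polarization writes a symmetrized product operator as a combination of tensor powers of
  sums of its factors; linearity extends this to the span.\<close>

lemma symmetrized_commutes:
  assumes "X \<in> tensor_pow_algebra \<K>"
  shows "C ** (\<Sum>\<pi> | \<pi> permutes UNIV. tensor_permute \<pi> X) = (\<Sum>\<pi> | \<pi> permutes UNIV. tensor_permute \<pi> X) ** C"
proof -
  let ?S = "\<lambda>X. \<Sum>\<pi> | \<pi> permutes UNIV. tensor_permute \<pi> X"
  have base: "C ** ?S (tensor_op f) = ?S (tensor_op f) ** C" if f: "\<And>k. f k \<in> \<K>" for f
  proof -
    have "?S (tensor_op f) = (\<Sum>\<pi> | \<pi> permutes UNIV. tensor_op (f \<circ> inv \<pi>))"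
      by (intro sum.cong) (auto simp: tensor_permute_tensor_op)
    also have "\<dots> = (\<Sum>S\<in>UNIV. (-1) ^ card (- S) *\<^sub>m tensor_pow (\<Sum>k\<in>S. f k))"
      by (subst sum_permutations_inverse[symmetric]) (rule tensor_pow_polarization)
    finally show ?thesis
      using f by (simp add: mat_mult_sum_left mat_mult_sum_right mult_cscale_left mult_cscale_right
          tensor_pow_commutes cmat.subspace_sum[OF vn(1)])
  qed
  have "cmat.subspace {X. C ** ?S X = ?S X ** C}"
  proof -
    have S: "?S 0 = 0" "?S (X + Y) = ?S X + ?S Y" "?S (c *\<^sub>m X) = c *\<^sub>m ?S X" for X Y c
      by (simp_all add: tensor_permute_def vec_eq_iff sum_component sum.distrib sum_distrib_left)
    have "C ** 0 = 0" "0 ** C = 0" by (simp_all add: vec_eq_iff matrix_mult_nth)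
    then show ?thesis
      unfolding cmat.subspace_def mem_Collect_eq S
      by (simp add: matrix_add_ldistrib matrix_add_rdistrib mult_cscale_left mult_cscale_right)
  qed
  then have "cmat.span {tensor_op f | f. \<forall>k. f k \<in> \<K>} \<subseteq> {X. C ** ?S X = ?S X ** C}"
    using base by (intro cmat.span_minimal) auto
  then show ?thesis using assms unfolding tensor_pow_algebra_def by blast
qed

text \<open>A permutation-invariant operator is its own symmetrization divided by n!.\<close>

lemma symmetric_commutes:
  assumes "X \<in> tensor_pow_algebra \<K>" and "\<And>\<pi>. \<pi> permutes UNIV \<Longrightarrow> tensor_permute \<pi> X = X"
  shows "C ** X = X ** C"
proof -
  let ?c = "of_nat (card {\<pi> :: 'n \<Rightarrow> 'n. \<pi> permutes UNIV}) :: complex"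
  have "(\<Sum>\<pi> | \<pi> permutes UNIV. tensor_permute \<pi> X) = (\<Sum>\<pi> | \<pi> permutes (UNIV :: 'n set). X)"
    by (intro sum.cong) (auto simp: assms)
  also have "\<dots> = ?c *\<^sub>m X" by (rule sum_constant_cmat)
  finally have "?c *\<^sub>m (C ** X) = ?c *\<^sub>m (X ** C)"
    using symmetrized_commutes[OF assms(1)] by (simp add: mult_cscale_left mult_cscale_right)
  moreover have "?c \<noteq> 0" by (simp add: card_permutations[OF refl])
  ultimately show ?thesis by (rule cmat.scale_left_imp_eq[rotated])
qed

end

section \<open>The exchange projections\<close>

lemma exchange_char_square: "exchange_char s \<pi> * exchange_char s \<pi> = 1"
  by (cases s) (auto simp: sign_def)

lemma cnj_exchange_char: "cnj (exchange_char s \<pi>) = exchange_char s \<pi>"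
  by (cases s) auto

lemma exchange_subspace_eq:
  "exchange_subspace s = {\<psi>. \<forall>\<pi>. \<pi> permutes UNIV \<longrightarrow> permute_op \<pi> *v \<psi> = exchange_char s \<pi> *s \<psi>}"
  by (simp add: exchange_subspace_def permute_op_vec)

lemma subspace_exchange: "vec.subspace (exchange_subspace s)"
  unfolding exchange_subspace_eq vec.subspace_def
  by (auto simp: matrix_vector_right_distrib vec.scale_right_distrib vector_smult_assoc mult.commute vec.scale)

lemmas adj_exchange_proj = adj_orth_proj[OF subspace_exchange, folded exchange_proj_def]
lemmas exchange_proj_idem = orth_proj_idem[OF subspace_exchange, folded exchange_proj_def]

text \<open>Vectors in the range of \<open>exchange_proj s\<close> are eigenvectors of every
  permutation. The character is real with square 1, so passing to adjoints or inverses does not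
  change it.\<close>

lemma permute_exchange_proj:
  fixes Q P :: "('n::finite, 'd::finite) tensor_mat" and s :: exchange_sign and \<pi> :: "'n \<Rightarrow> 'n"
  defines "Q \<equiv> exchange_proj s" and "P \<equiv> permute_op \<pi>"
  assumes \<pi>: "\<pi> permutes UNIV"
  shows "P ** Q = exchange_char s \<pi> *\<^sub>m Q"
    and "Q ** P = exchange_char s \<pi> *\<^sub>m Q"
    and "Q ** adj P = exchange_char s \<pi> *\<^sub>m Q"
  unfolding Q_def P_def
proof -
  let ?\<Pi> = "exchange_proj s :: ('n, 'd) tensor_mat" and ?c = "exchange_char s \<pi>"
  have "permute_op \<pi> *v (?\<Pi> *v x) = ?c *s (?\<Pi> *v x)" for x
    using orth_proj_in[OF subspace_exchange, of s x] \<pi> unfolding exchange_proj_def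
    by (simp add: exchange_subspace_eq)
  then show 1: "permute_op \<pi> ** ?\<Pi> = ?c *\<^sub>m ?\<Pi>"
    unfolding matrix_eq matrix_vector_mul_assoc[symmetric] cscale_mult_vec by blast
  have "adj (permute_op \<pi> ** ?\<Pi>) = ?c *\<^sub>m ?\<Pi>"
    unfolding 1 by (simp add: adj_cscale adj_exchange_proj cnj_exchange_char)
  then show 3: "?\<Pi> ** adj (permute_op \<pi>) = ?c *\<^sub>m ?\<Pi>"
    by (simp add: adj_mult adj_exchange_proj)
  have "?c *\<^sub>m (?\<Pi> ** permute_op \<pi>) = ?\<Pi> ** adj (permute_op \<pi>) ** permute_op \<pi>"
    unfolding 3 by (simp add: mult_cscale_left)
  also have "\<dots> = ?\<Pi>"
    by (simp add: matrix_mul_assoc[symmetric] unitaryD[OF unitary_permute_op[OF \<pi>]])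
  finally have "?c *\<^sub>m (?c *\<^sub>m (?\<Pi> ** permute_op \<pi>)) = ?c *\<^sub>m ?\<Pi>" by (simp only:)
  then show "?\<Pi> ** permute_op \<pi> = ?c *\<^sub>m ?\<Pi>" by (simp add: exchange_char_square)
qed

text \<open>The two characters, one from each side, multiply to 1. This is why compression cannot
  tell a product operator from the average over its permutations.\<close>

lemma exchange_conj_permute:
  assumes "\<pi> permutes UNIV"
  shows "exchange_proj s ** tensor_permute \<pi> X ** exchange_proj s = exchange_proj s ** X ** exchange_proj s"
proof -
  have "exchange_proj s ** tensor_permute \<pi> X ** exchange_proj s
      = (exchange_proj s ** permute_op \<pi>) ** X ** adj (exchange_proj s ** permute_op \<pi>)"
    by (simp add: tensor_permute_eq adj_mult adj_exchange_proj matrix_mul_assoc)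
  then show ?thesis
    by (simp add: permute_exchange_proj[OF assms] adj_cscale adj_exchange_proj cnj_exchange_char
        mult_cscale_left mult_cscale_right exchange_char_square)
qed

lemma exchange_conj_permute_fixed:
  assumes "\<pi> permutes UNIV"
  shows "tensor_permute \<pi> (exchange_proj s ** X ** exchange_proj s) = exchange_proj s ** X ** exchange_proj s"
proof -
  have "tensor_permute \<pi> (exchange_proj s ** X ** exchange_proj s)
      = (permute_op \<pi> ** exchange_proj s) ** X ** (exchange_proj s ** adj (permute_op \<pi>))"
    by (simp add: tensor_permute_eq matrix_mul_assoc)
  then show ?thesis
    by (simp add: permute_exchange_proj[OF assms] mult_cscale_left mult_cscale_right exchange_char_square)
qed

text \<open>\<open>C\<close> preserves the exchange subspace, and so does its adjoint because the
  permutation operators are unitary.\<close>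

lemma exchange_proj_commute:
  fixes C :: "('n::finite, 'd::finite) tensor_mat"
  assumes "\<And>\<pi>. \<pi> permutes UNIV \<Longrightarrow> permute_op \<pi> ** C = C ** permute_op \<pi>"
  shows "exchange_proj s ** C = C ** exchange_proj s"
  unfolding exchange_proj_def
proof (rule orth_proj_commute[OF subspace_exchange])
  have *: "A *v x \<in> exchange_subspace s"
    if "\<And>\<pi>. \<pi> permutes UNIV \<Longrightarrow> permute_op \<pi> ** A = A ** permute_op \<pi>" "x \<in> exchange_subspace s"
    for A :: "('n, 'd) tensor_mat" and x
    using that by (simp add: exchange_subspace_eq matrix_vector_mul_assoc) (simp add: matrix_vector_mul_assoc[symmetric] vec.scale)
  fix x :: "(complex, 'n \<Rightarrow> 'd) vec" assume x: "x \<in> exchange_subspace s"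
  show "C *v x \<in> exchange_subspace s" by (rule * [OF assms x])
  show "adj C *v x \<in> exchange_subspace s"
  proof (rule * [OF _ x])
    fix \<pi> :: "'n \<Rightarrow> 'n" assume \<pi>: "\<pi> permutes UNIV"
    note u = unitary_permute_op[OF \<pi>]
    have "adj (permute_op \<pi>) ** C = C ** adj (permute_op \<pi>)"
      by (rule unitary_commutes_adj[OF u assms[OF \<pi>]])
    then show "permute_op \<pi> ** adj C = adj C ** permute_op \<pi>"
      by (metis adj_adj adj_mult)
  qed
qed

lemma tensor_pow_permute: "\<pi> permutes UNIV \<Longrightarrow> tensor_permute \<pi> (tensor_pow W) = tensor_pow W"
  by (simp add: tensor_pow_def tensor_permute_tensor_op comp_def)

lemma exchange_proj_tensor_pow: "exchange_proj s ** tensor_pow W = tensor_pow W ** exchange_proj s"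
  by (rule exchange_proj_commute) (simp add: tensor_permute_fixed_iff[symmetric] tensor_pow_permute)

context gauge
begin

lemma vN_commutant: "von_neumann_algebra (commutant \<A>)"
  by (rule von_neumann_commutant) (use vN in \<open>simp add: von_neumann_algebraD\<close>)

text \<open>Compression sees only the symmetrization \<open>S\<close> of \<open>tensor_op V\<close>,
  which commutes with \<open>X\<close> by polarization; since X = Q X = X Q, projections next to
  \<open>X\<close> can be inserted or dropped.\<close>

lemma global_symmetric_commutes:
  fixes X :: "('n::finite, 'd) tensor_mat"
  assumes X: "exchange_proj s ** X ** exchange_proj s = X"
    and sym: "\<And>V. V \<in> G \<Longrightarrow> X ** tensor_pow V = tensor_pow V ** X"
    and V: "\<And>k. V k \<in> commutant \<A>"
  shows "X ** (exchange_proj s ** tensor_op V ** exchange_proj s)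
       = exchange_proj s ** tensor_op V ** exchange_proj s ** X"
proof -
  interpret commutes_with_unitary_powers "commutant \<A>" X
    by unfold_locales (use vN_commutant sym in \<open>auto simp: gauge_group_eq\<close>)
  let ?\<Pi> = "exchange_proj s :: ('n, 'd) tensor_mat"
  let ?c = "of_nat (card {\<pi> :: 'n \<Rightarrow> 'n. \<pi> permutes UNIV}) :: complex"
  define S where "S = (\<Sum>\<pi> | \<pi> permutes (UNIV :: 'n set). tensor_permute \<pi> (tensor_op V))"
  have "tensor_op V \<in> tensor_pow_algebra (commutant \<A>)"
    unfolding tensor_pow_algebra_def by (rule cmat.span_base) (use V in blast)
  from symmetrized_commutes[OF this] have XS: "X ** S = S ** X" unfolding S_def .
  have "?\<Pi> ** S ** ?\<Pi> = (\<Sum>\<pi> | \<pi> permutes (UNIV :: 'n set). ?\<Pi> ** tensor_op V ** ?\<Pi>)"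
    unfolding S_def mat_mult_sum_left mat_mult_sum_right
    by (intro sum.cong) (auto simp: exchange_conj_permute)
  then have S: "?\<Pi> ** S ** ?\<Pi> = ?c *\<^sub>m (?\<Pi> ** tensor_op V ** ?\<Pi>)"
    by (simp only: sum_constant_cmat)
  have X\<Pi>: "X ** ?\<Pi> = X" "?\<Pi> ** X = X"
    by (metis X exchange_proj_idem matrix_mul_assoc)+
  have "X ** (?\<Pi> ** S ** ?\<Pi>) = X ** S ** ?\<Pi>" by (simp add: matrix_mul_assoc X\<Pi>)
  also have "\<dots> = S ** X" by (simp add: XS matrix_mul_assoc[symmetric] X\<Pi>)
  finally have 1: "X ** (?\<Pi> ** S ** ?\<Pi>) = S ** X" .
  have "?\<Pi> ** S ** ?\<Pi> ** X = ?\<Pi> ** (X ** S)" by (simp add: matrix_mul_assoc[symmetric] X\<Pi> XS)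
  also have "\<dots> = S ** X" unfolding matrix_mul_assoc X\<Pi> by (rule XS)
  finally have "?c *\<^sub>m (X ** (?\<Pi> ** tensor_op V ** ?\<Pi>)) = ?c *\<^sub>m (?\<Pi> ** tensor_op V ** ?\<Pi> ** X)"
    using 1 by (simp add: S mult_cscale_left mult_cscale_right)
  moreover have "?c \<noteq> 0" by (simp add: card_permutations[OF refl])
  ultimately show ?thesis by (rule cmat.scale_left_imp_eq[rotated])
qed

lemma twirl_pow_global_symmetric:
  fixes X :: "('n::finite, 'd) tensor_mat"
  assumes X: "exchange_proj s ** X ** exchange_proj s = X"
    and sym: "\<And>V. V \<in> G \<Longrightarrow> X ** tensor_pow V = tensor_pow V ** X"
  shows "twirl_pow \<A> X ** exchange_proj s = twirl_pow \<A> (exchange_proj s) ** X"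
proof -
  let ?\<Pi> = "exchange_proj s :: ('n, 'd) tensor_mat"
  have X\<Pi>: "X ** ?\<Pi> = X" "?\<Pi> ** X = X"
    by (metis X exchange_proj_idem matrix_mul_assoc)+
  show ?thesis
  proof (rule twirl_pow_transfer[where f = "\<lambda>A. A ** ?\<Pi>" and g = "\<lambda>A. A ** X"])
    fix V :: "'n \<Rightarrow> 'd cmat" assume V: "\<And>k. V k \<in> G"
    let ?U = "tensor_op V" and ?U' = "tensor_op (\<lambda>k. adj (V k))"
    have "adj (V k) \<in> commutant \<A>" for k
      using gauge_group_adj[OF V] by (simp add: gauge_group_eq)
    from global_symmetric_commutes[OF X sym this]
    have comm: "X ** (?\<Pi> ** ?U' ** ?\<Pi>) = ?\<Pi> ** ?U' ** ?\<Pi> ** X" .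
    have "?U ** X ** ?U' ** ?\<Pi> = ?U ** (X ** (?\<Pi> ** ?U' ** ?\<Pi>))"
      by (simp add: matrix_mul_assoc) (simp add: matrix_mul_assoc[symmetric] X\<Pi>)
    also have "\<dots> = ?U ** ?\<Pi> ** ?U' ** X"
      by (simp only: comm) (simp add: matrix_mul_assoc[symmetric] X\<Pi>)
    finally show "?U ** X ** adj ?U ** ?\<Pi> = ?U ** ?\<Pi> ** adj ?U ** X"
      by (simp add: adj_tensor_op)
  qed (auto intro!: linearI simp: matrix_add_rdistrib scaleR_mult_left)
qed

end

section \<open>Isotypic components\<close>

lemma matrix_vector_scaleR: "A *v (r *\<^sub>R x) = r *\<^sub>R (A *v (x :: complex ^ 'm::finite))"
  by (simp add: scaleR_eq_smult vec.scale)

text \<open>Closure under adjoints stands in for inverses of unitary operators: it makes the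
  projection onto an invariant subspace an intertwiner.\<close>

locale star_representation =
  fixes S :: "'g set" and R :: "'g \<Rightarrow> 'm::finite cmat"
  assumes star: "g \<in> S \<Longrightarrow> \<exists>h\<in>S. R h = adj (R g)"
begin

definition intertwiner :: "'m cmat \<Rightarrow> bool" where
  "intertwiner C \<longleftrightarrow> (\<forall>g\<in>S. C ** R g = R g ** C)"

abbreviation "invariant \<equiv> invariant_subspace S R"
abbreviation "irreducible_sub \<equiv> irreducible_subspace S R"
abbreviation "isomorphic \<equiv> isomorphic_subreps S R"

lemma intertwiner_vec: "intertwiner C \<Longrightarrow> g \<in> S \<Longrightarrow> C *v (R g *v x) = R g *v (C *v x)"
  by (simp add: intertwiner_def matrix_vector_mul_assoc)

lemma intertwiner_mult:
  assumes "intertwiner C" "intertwiner D"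
  shows "intertwiner (C ** D)"
  unfolding intertwiner_def
proof
  fix g assume "g \<in> S"
  then have C: "C ** R g = R g ** C" and D: "D ** R g = R g ** D"
    using assms by (auto simp: intertwiner_def)
  have "C ** D ** R g = C ** R g ** D" by (simp add: D matrix_mul_assoc[symmetric])
  then show "C ** D ** R g = R g ** (C ** D)" by (simp add: C matrix_mul_assoc)
qed

lemma intertwiner_adj:
  assumes "intertwiner C" shows "intertwiner (adj C)"
  unfolding intertwiner_def
proof
  fix g assume "g \<in> S"
  then obtain h where "h \<in> S" "R h = adj (R g)" using star by blast
  then have "C ** adj (R g) = adj (R g) ** C" using assms by (metis intertwiner_def)
  then show "adj C ** R g = R g ** adj C" by (metis adj_adj adj_mult)
qed

lemma intertwiner_sum: "(\<And>i. i \<in> I \<Longrightarrow> intertwiner (f i)) \<Longrightarrow> intertwiner (sum f I)"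
  by (simp add: intertwiner_def mat_mult_sum_left mat_mult_sum_right)

lemma intertwiner_orth_proj:
  assumes U: "invariant U" shows "intertwiner (orth_proj U)"
  unfolding intertwiner_def
proof
  fix g assume g: "g \<in> S"
  obtain h where h: "h \<in> S" "R h = adj (R g)" using star[OF g] by blast
  show "orth_proj U ** R g = R g ** orth_proj U"
    by (rule orth_proj_commute)
      (use U g h(1) in \<open>auto simp: invariant_subspace_def h(2)[symmetric]\<close>)
qed

lemma invariant_kernel: "intertwiner C \<Longrightarrow> invariant U \<Longrightarrow> invariant {x \<in> U. C *v x = 0}"
  by (auto simp: invariant_subspace_def vec.subspace_def intertwiner_vec matrix_vector_right_distrib vec.scale)

lemma invariant_UNIV: "invariant UNIV"
  by (simp add: invariant_subspace_def)

lemma invariant_image: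
  assumes "intertwiner C" "invariant U"
  shows "invariant ((*v) C ` U)"
  unfolding invariant_subspace_def
proof (intro conjI ballI)
  have "vec.subspace U" using assms by (simp add: invariant_subspace_def)
  then show "vec.subspace ((*v) C ` U)" by (rule vec.subspace_image)
  fix g w assume "g \<in> S" "w \<in> (*v) C ` U"
  then show "R g *v w \<in> (*v) C ` U"
    using assms by (auto simp: invariant_subspace_def intertwiner_vec[symmetric])
qed

lemma irreducible_exists:
  assumes "invariant W" "W \<noteq> {0}"
  obtains U where "irreducible_sub U" "U \<subseteq> W"
proof -
  let ?P = "\<lambda>U. invariant U \<and> U \<noteq> {0} \<and> U \<subseteq> W"
  have "?P W" using assms by simp
  then obtain U where U: "?P U" and min: "\<And>U'. ?P U' \<Longrightarrow> vec.dim U \<le> vec.dim U'"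
    using ex_has_least_nat[of ?P W vec.dim] by blast
  have "U' = {0} \<or> U' = U" if U': "invariant U'" "U' \<subseteq> U" for U'
  proof (cases "U' = {0}")
    case False
    then have "vec.dim U \<le> vec.dim U'" using U' U by (intro min) auto
    then show ?thesis
      using vec.subspace_dim_equal[of U' U] U U' by (auto simp: invariant_subspace_def)
  qed simp
  then have "irreducible_sub U" using U by (auto simp: irreducible_subspace_def)
  then show ?thesis using that U by blast
qed

lemma irreducibleD:
  assumes "irreducible_sub U"
  shows "invariant U" "U \<noteq> {0}" "vec.subspace U" "0 \<in> U"
    and "invariant W \<Longrightarrow> W \<subseteq> U \<Longrightarrow> W = {0} \<or> W = U"
  using assms by (auto simp: irreducible_subspace_def invariant_subspace_def vec.subspace_0)

text \<open>The kernel of an intertwiner inside \<open>U\<close> is invariant, so it is all of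
  \<open>U\<close> or trivial.\<close>

lemma schur_alternative:
  assumes U: "irreducible_sub U" and C: "intertwiner C"
  shows "(\<forall>x\<in>U. C *v x = 0) \<or> inj_on ((*v) C) U"
proof -
  note D = irreducibleD[OF U]
  consider "{x \<in> U. C *v x = 0} = {0}" | "{x \<in> U. C *v x = 0} = U"
    using D(5)[OF invariant_kernel[OF C D(1)]] by blast
  then show ?thesis
  proof cases
    case 1
    have "inj_on ((*v) C) U"
    proof (rule inj_onI)
      fix x y assume xy: "x \<in> U" "y \<in> U" "C *v x = C *v y"
      then have "x - y \<in> {x \<in> U. C *v x = 0}"
        using vec.subspace_diff[OF D(3)] by (simp add: matrix_vector_mult_diff_distrib)
      then show "x = y" using 1 by simp
    qed
    then show ?thesis ..
  qed blast
qed

lemma irreducible_image: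
  assumes U: "irreducible_sub U" and C: "intertwiner C" and inj: "inj_on ((*v) C) U"
  shows "irreducible_sub ((*v) C ` U)"
  unfolding irreducible_subspace_def
proof (intro conjI allI impI)
  note D = irreducibleD[OF U]
  show "invariant ((*v) C ` U)" by (rule invariant_image[OF C D(1)])
  obtain x where "x \<in> U" "x \<noteq> 0" using D(2,4) by blast
  then have "C *v x \<noteq> 0" using inj D(4) by (metis inj_onD matrix_vector_mult_0_right)
  then show "(*v) C ` U \<noteq> {0}" using \<open>x \<in> U\<close> by blast
  fix W assume W: "invariant W \<and> W \<subseteq> (*v) C ` U"
  define W' where "W' = {x \<in> U. C *v x \<in> W}"
  have "invariant W'"
    using W D(1) C by (auto simp: W'_def invariant_subspace_def vec.subspace_def intertwiner_vec
        matrix_vector_right_distrib vec.scale)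
  then have "W' = {0} \<or> W' = U" by (intro D(5)) (auto simp: W'_def)
  moreover have "W = (*v) C ` W'" using W by (auto simp: W'_def)
  ultimately show "W = {0} \<or> W = (*v) C ` U" by auto
qed

lemma iso_image:
  assumes "irreducible_sub U" "intertwiner C" "inj_on ((*v) C) U"
  shows "isomorphic U ((*v) C ` U)"
  unfolding isomorphic_subreps_def using assms
  by (intro exI[of _ C]) (auto simp: bij_betw_def intertwiner_vec)

text \<open>\<open>isomorphic_subreps\<close> constrains its matrix only on \<open>U\<close>;
  composing with the projection onto \<open>U\<close> yields one that commutes with the
  representation everywhere.\<close>

lemma iso_intertwiner:
  assumes U: "irreducible_sub U" and "isomorphic U W"
  obtains C where "intertwiner C" "bij_betw ((*v) C) U W"
proof -
  obtain T where T: "bij_betw ((*v) T) U W" "\<forall>g\<in>S. \<forall>w\<in>U. T *v (R g *v w) = R g *v (T *v w)"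
    using \<open>isomorphic U W\<close> unfolding isomorphic_subreps_def by blast
  note D = irreducibleD[OF U]
  define C where "C = T ** orth_proj U"
  have "intertwiner C"
    unfolding intertwiner_def matrix_eq C_def matrix_vector_mul_assoc[symmetric]
    using T(2) orth_proj_in[OF D(3)] by (simp add: intertwiner_vec[OF intertwiner_orth_proj[OF D(1)]])
  moreover have "bij_betw ((*v) C) U W"
    by (subst bij_betw_cong[where g = "(*v) T"])
      (auto simp: C_def matrix_vector_mul_assoc[symmetric] orth_proj_fixes[OF D(3)] T)
  ultimately show ?thesis using that by blast
qed

lemma iso_refl: "isomorphic U U"
  unfolding isomorphic_subreps_def by (rule exI[of _ "mat 1"]) (simp add: bij_betw_def inj_on_def)

lemma iso_trans:
  assumes U: "irreducible_sub U" "irreducible_sub V" and "isomorphic U V" "isomorphic V W"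
  shows "isomorphic U W"
proof -
  obtain C where C: "intertwiner C" "bij_betw ((*v) C) U V" using iso_intertwiner[OF U(1) assms(3)] .
  obtain D where D: "intertwiner D" "bij_betw ((*v) D) V W" using iso_intertwiner[OF U(2) assms(4)] .
  have "bij_betw ((*v) D \<circ> (*v) C) U W" by (rule bij_betw_trans[OF C(2) D(2)])
  moreover have "(*v) D \<circ> (*v) C = (*v) (D ** C)" by (auto simp: matrix_vector_mul_assoc)
  ultimately show ?thesis
    unfolding isomorphic_subreps_def
    by (intro exI[of _ "D ** C"]) (use intertwiner_vec[OF intertwiner_mult[OF D(1) C(1)]] in auto)
qed

text \<open>The inverse exists only on \<open>W\<close>; precomposing it with the projection onto
  \<open>W\<close> makes it a linear map on the whole space, hence a matrix.\<close>

lemma iso_sym: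
  assumes U: "irreducible_sub U" and W: "irreducible_sub W" and "isomorphic U W"
  shows "isomorphic W U"
proof -
  obtain C where C: "intertwiner C" "bij_betw ((*v) C) U W" using iso_intertwiner[OF U \<open>isomorphic U W\<close>] .
  note DU = irreducibleD[OF U] and DW = irreducibleD[OF W]
  define f where "f w = inv_into U ((*v) C) (orth_proj W *v w)" for w
  have f_in: "f w \<in> U" and Cf: "C *v f w = orth_proj W *v w" for w
  proof -
    have "orth_proj W *v w \<in> (*v) C ` U"
      using C(2) orth_proj_in[OF DW(3)] by (simp add: bij_betw_def)
    then show "f w \<in> U" "C *v f w = orth_proj W *v w"
      unfolding f_def by (rule inv_into_into, rule f_inv_into_f)
  qed
  have eqI: "x = y" if "x \<in> U" "y \<in> U" "C *v x = C *v y" for x y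
    using C(2) that unfolding bij_betw_def inj_on_def by blast
  have "Vector_Spaces.linear (*s) (*s) f"
  proof unfold_locales
    fix x y c
    show "f (x + y) = f x + f y"
      by (rule eqI) (simp_all add: f_in Cf vec.subspace_add[OF DU(3)] matrix_vector_right_distrib)
    show "f (c *s x) = c *s f x"
      by (rule eqI) (simp_all add: f_in Cf vec.subspace_scale[OF DU(3)] vec.scale)
  qed
  then have f: "matrix f *v w = f w" for w by (rule matrix_works)
  have fC: "f (C *v u) = u" if "u \<in> U" for u
  proof (rule eqI)
    have "C *v u \<in> W" using that C(2) by (auto simp: bij_betw_def)
    then show "C *v f (C *v u) = C *v u" by (simp only: Cf orth_proj_fixes[OF DW(3)])
  qed (use f_in that in auto)
  have "bij_betw f W U"
  proof (rule bij_betwI[where g = "(*v) C"])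
    show "f \<in> W \<rightarrow> U" using f_in by blast
    show "(*v) C \<in> U \<rightarrow> W" using C(2) by (auto simp: bij_betw_def)
  qed (simp_all add: Cf fC orth_proj_fixes[OF DW(3)])
  moreover have "f (R g *v w) = R g *v f w" if "g \<in> S" "w \<in> W" for g w
  proof (rule eqI)
    show "R g *v f w \<in> U" using DU(1) f_in that by (auto simp: invariant_subspace_def)
    show "C *v f (R g *v w) = C *v (R g *v f w)"
      using that by (simp add: Cf intertwiner_vec[OF C(1)] intertwiner_vec[OF intertwiner_orth_proj[OF DW(1)]])
  qed (rule f_in)
  ultimately show ?thesis
    unfolding isomorphic_subreps_def by (intro exI[of _ "matrix f"]) (simp add: f[abs_def])
qed

text \<open>Otherwise the projection onto \<open>W\<close> would be injective on \<open>U\<close>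
  and, by irreducibility of \<open>W\<close>, an isomorphism onto it.\<close>

lemma non_iso_orthogonal:
  assumes U: "irreducible_sub U" and W: "irreducible_sub W" and "\<not> isomorphic U W" and x: "x \<in> U"
  shows "orth_proj W *v x = 0"
proof -
  let ?P = "orth_proj W"
  note DU = irreducibleD[OF U] and DW = irreducibleD[OF W]
  have P: "intertwiner ?P" by (rule intertwiner_orth_proj[OF DW(1)])
  have "\<not> inj_on ((*v) ?P) U"
  proof
    assume inj: "inj_on ((*v) ?P) U"
    have "irreducible_sub ((*v) ?P ` U)" by (rule irreducible_image[OF U P inj])
    then have "(*v) ?P ` U = W"
      using DW(5)[of "(*v) ?P ` U"] orth_proj_in[OF DW(3)] irreducibleD by blast
    then show False using iso_image[OF U P inj] \<open>\<not> isomorphic U W\<close> by simp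
  qed
  then show ?thesis using schur_alternative[OF U P] x by blast
qed

section \<open>Labels and isotypic projections\<close>

abbreviation "labels \<equiv> occurring_irreps S R"

lemma labels_eq: "labels = {{W. irreducible_sub W \<and> isomorphic U W} | U. irreducible_sub U}"
  by (auto simp: occurring_irreps_def quotient_def)

lemma labelE:
  assumes "\<mu> \<in> labels"
  obtains U where "irreducible_sub U" "\<mu> = {W. irreducible_sub W \<and> isomorphic U W}" "U \<in> \<mu>"
  using assms iso_refl unfolding labels_eq by blast

lemma label_irreducible: "\<mu> \<in> labels \<Longrightarrow> W \<in> \<mu> \<Longrightarrow> irreducible_sub W"
  by (auto simp: labels_eq)

lemma label_iso_closed:
  assumes "\<mu> \<in> labels" "W \<in> \<mu>" "irreducible_sub V" "isomorphic W V"
  shows "V \<in> \<mu>"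
proof -
  obtain U where "irreducible_sub U" "\<mu> = {W. irreducible_sub W \<and> isomorphic U W}"
    using labelE[OF assms(1)] by blast
  then show ?thesis using assms iso_trans[of U W V] by blast
qed

lemma labels_non_iso:
  assumes \<mu>: "\<mu> \<in> labels" and \<nu>: "\<nu> \<in> labels" and "\<mu> \<noteq> \<nu>" "V \<in> \<mu>" "W \<in> \<nu>"
  shows "\<not> isomorphic V W"
proof
  assume isomorphic: "isomorphic V W"
  note irr = label_irreducible[OF \<mu> \<open>V \<in> \<mu>\<close>] label_irreducible[OF \<nu> \<open>W \<in> \<nu>\<close>]
  have *: "\<rho> = {W'. irreducible_sub W' \<and> isomorphic X W'}" if \<rho>: "\<rho> \<in> labels" and X: "X \<in> \<rho>" for \<rho> X
  proof -
    obtain U where U: "irreducible_sub U" "\<rho> = {W. irreducible_sub W \<and> isomorphic U W}"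
      using labelE[OF \<rho>] by blast
    then have "irreducible_sub X" "isomorphic U X" using X by auto
    then show ?thesis using U iso_trans iso_sym by blast
  qed
  have "\<mu> = \<nu>"
    using * [OF \<mu> \<open>V \<in> \<mu>\<close>] * [OF \<nu> \<open>W \<in> \<nu>\<close>] iso_trans iso_sym irr isomorphic by blast
  then show False using \<open>\<mu> \<noteq> \<nu>\<close> by simp
qed

abbreviation P :: "(complex ^ 'm) set set \<Rightarrow> 'm cmat" where "P \<equiv> isotypic_proj"

lemma adj_P: "adj (P \<mu>) = P \<mu>" and P_idem: "P \<mu> ** P \<mu> = P \<mu>"
  unfolding isotypic_proj_def by (simp_all add: adj_orth_proj orth_proj_idem)

lemma P_fixes: "x \<in> \<Union>\<mu> \<Longrightarrow> P \<mu> *v x = x"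
  unfolding isotypic_proj_def by (rule orth_proj_fixes) (auto intro: vec.span_base)

lemma matrix_eqI_isotypic:
  assumes "\<And>x. x \<in> \<Union>\<mu> \<Longrightarrow> A *v x = B *v x"
  shows "A ** P \<mu> = B ** P \<mu>"
proof -
  have "vec.subspace {x. A *v x = B *v x}"
    by (auto simp: vec.subspace_def matrix_vector_right_distrib vec.scale)
  then have "vec.span (\<Union>\<mu>) \<subseteq> {x. A *v x = B *v x}"
    using assms by (intro vec.span_minimal) auto
  then show ?thesis
    unfolding matrix_eq matrix_vector_mul_assoc[symmetric] isotypic_proj_def
    using orth_proj_in[OF vec.subspace_span] by blast
qed

text \<open>An intertwiner sends an irreducible subspace of class \<mu> to zero or to an isomorphic
  copy, hence maps the isotypic component into itself; the same holds for its adjoint.\<close>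

lemma P_commutes_intertwiner:
  assumes \<mu>: "\<mu> \<in> labels" and C: "intertwiner C"
  shows "P \<mu> ** C = C ** P \<mu>"
proof -
  have *: "D *v x \<in> vec.span (\<Union>\<mu>)" if D: "intertwiner D" and "x \<in> vec.span (\<Union>\<mu>)" for D x
  proof -
    have "D *v x \<in> vec.span (\<Union>\<mu>)" if x: "x \<in> \<Union>\<mu>" for x
    proof -
      obtain W where W: "W \<in> \<mu>" "x \<in> W" using x by blast
      have irr: "irreducible_sub W" by (rule label_irreducible[OF \<mu> W(1)])
      show ?thesis
      proof (cases "inj_on ((*v) D) W")
        case True
        have "(*v) D ` W \<in> \<mu>"
          by (rule label_iso_closed[OF \<mu> W(1) irreducible_image[OF irr D True] iso_image[OF irr D True]])
        then show ?thesis using W(2) by (intro vec.span_base) blast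
      next
        case False
        then have "D *v x = 0" using schur_alternative[OF irr D] W(2) by blast
        then show ?thesis by (simp add: vec.span_zero)
      qed
    qed
    moreover have "vec.subspace {x. D *v x \<in> vec.span (\<Union>\<mu>)}"
      by (auto simp: vec.subspace_def matrix_vector_right_distrib vec.scale vec.span_zero vec.span_add vec.span_scale)
    ultimately have "vec.span (\<Union>\<mu>) \<subseteq> {x. D *v x \<in> vec.span (\<Union>\<mu>)}"
      by (intro vec.span_minimal) auto
    then show ?thesis using that(2) by blast
  qed
  show ?thesis
    unfolding isotypic_proj_def
    by (rule orth_proj_commute) (use * C intertwiner_adj[OF C] in auto)
qed

lemma intertwiner_P:
  assumes \<mu>: "\<mu> \<in> labels" shows "intertwiner (P \<mu>)"
proof -
  have "invariant (vec.span (\<Union>\<mu>))"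
    unfolding invariant_subspace_def
  proof (intro conjI ballI)
    fix g w assume g: "g \<in> S" and w: "w \<in> vec.span (\<Union>\<mu>)"
    have "R g *v x \<in> vec.span (\<Union>\<mu>)" if "x \<in> \<Union>\<mu>" for x
      using that g label_irreducible[OF \<mu>] irreducibleD(1)
      by (intro vec.span_base) (fastforce simp: invariant_subspace_def)
    moreover have "vec.subspace {x. R g *v x \<in> vec.span (\<Union>\<mu>)}"
      by (auto simp: vec.subspace_def matrix_vector_right_distrib vec.scale vec.span_zero vec.span_add vec.span_scale)
    ultimately have "vec.span (\<Union>\<mu>) \<subseteq> {x. R g *v x \<in> vec.span (\<Union>\<mu>)}"
      by (intro vec.span_minimal) auto
    then show "R g *v w \<in> vec.span (\<Union>\<mu>)" using w by blast
  qed simp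
  then show ?thesis unfolding isotypic_proj_def by (rule intertwiner_orth_proj)
qed

lemma P_orthogonal:
  assumes \<mu>: "\<mu> \<in> labels" and \<nu>: "\<nu> \<in> labels" and "\<mu> \<noteq> \<nu>"
  shows "P \<nu> ** P \<mu> = 0"
proof -
  have "P \<nu> *v x = 0 *v x" if x: "x \<in> \<Union>\<mu>" for x
  proof -
    obtain V where V: "V \<in> \<mu>" "x \<in> V" using x by blast
    have "cinner x y = 0" if y: "y \<in> \<Union>\<nu>" for y
    proof -
      obtain W where W: "W \<in> \<nu>" "y \<in> W" using y by blast
      have irr: "irreducible_sub V" "irreducible_sub W"
        using label_irreducible \<mu> \<nu> V W by auto
      have "cinner x y = cinner (adj (orth_proj W) *v x) y"
        using cinner_adj[of x "orth_proj W" y] by (simp add: orth_proj_fixes irreducibleD irr W)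
      also have "adj (orth_proj W) *v x = 0"
        using non_iso_orthogonal[OF irr labels_non_iso[OF \<mu> \<nu> \<open>\<mu> \<noteq> \<nu>\<close> V(1) W(1)] V(2)]
        by (simp add: adj_orth_proj irreducibleD irr)
      finally show ?thesis by (simp add: cinner_def)
    qed
    moreover have "vec.subspace {y. cinner x y = 0}"
      by (simp add: vec.subspace_def cinner_smult_right) (simp add: cinner_def algebra_simps sum.distrib)
    ultimately have "vec.span (\<Union>\<nu>) \<subseteq> {y. cinner x y = 0}"
      by (intro vec.span_minimal) auto
    then have "proj (vec.span (\<Union>\<nu>)) x = 0"
      by (intro proj_unique) (auto simp: subspace_vec_subspace vec.span_zero inner_eq_cinner)
    then show ?thesis by (simp add: isotypic_proj_def orth_proj_vec)
  qed
  then show ?thesis using matrix_eqI_isotypic[of \<mu> "P \<nu>" 0] by (simp add: vec_eq_iff matrix_mult_nth)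
qed

lemma P_nonzero_vec:
  assumes "\<mu> \<in> labels"
  obtains v where "v \<noteq> 0" "P \<mu> *v v = v"
proof -
  obtain U where "irreducible_sub U" "U \<in> \<mu>" using labelE[OF assms] by blast
  then obtain v where "v \<in> U" "v \<noteq> 0" using irreducibleD(2,4) by blast
  then show ?thesis using that P_fixes[of v \<mu>] \<open>U \<in> \<mu>\<close> by blast
qed

lemma trace_P: "\<mu> \<in> labels \<Longrightarrow> trace (P \<mu>) \<noteq> 0"
proof
  assume \<mu>: "\<mu> \<in> labels" and "trace (P \<mu>) = 0"
  then have "P \<mu> = 0" using trace_adj_mult_eq_0[of "P \<mu>"] by (simp add: adj_P P_idem)
  then show False using P_nonzero_vec[OF \<mu>] by (metis matrix_vector_mult_0)
qed

text \<open>Each label contributes a nonzero vector and these are mutually orthogonal. Finiteness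
  matters because a \<open>sum\<close> over an infinite set defaults to zero.\<close>

lemma finite_labels: "finite labels"
proof -
  have "\<exists>v. v \<noteq> 0 \<and> P \<mu> *v v = v" if "\<mu> \<in> labels" for \<mu> using P_nonzero_vec[OF that] by blast
  then obtain v where v: "\<And>\<mu>. \<mu> \<in> labels \<Longrightarrow> v \<mu> \<noteq> 0" "\<And>\<mu>. \<mu> \<in> labels \<Longrightarrow> P \<mu> *v v \<mu> = v \<mu>"
    by metis
  have orth: "inner (v \<mu>) (v \<nu>) = 0" if "\<mu> \<in> labels" "\<nu> \<in> labels" "\<mu> \<noteq> \<nu>" for \<mu> \<nu>
  proof -
    have "inner (v \<mu>) (v \<nu>) = inner (P \<mu> *v v \<mu>) (P \<nu> *v v \<nu>)" using v(2) that by simp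
    also have "\<dots> = inner ((P \<nu> ** P \<mu>) *v v \<mu>) (v \<nu>)"
      by (simp add: inner_adj[of "P \<nu>"] adj_P matrix_vector_mul_assoc[symmetric])
    also have "\<dots> = 0" by (simp add: P_orthogonal that)
    finally show ?thesis .
  qed
  have "inj_on v labels" using orth v(1) by (metis inj_onI inner_eq_zero_iff)
  moreover have "finite (v ` labels)"
    by (rule pairwise_orthogonal_imp_finite) (auto simp: pairwise_def orthogonal_def intro: orth)
  ultimately show ?thesis using finite_imageD by blast
qed

text \<open>The kernel of the sum is invariant; if nonzero it would contain an irreducible subspace,
  which the projection of its own class fixes.\<close>

lemma sum_P: "(\<Sum>\<mu>\<in>labels. P \<mu>) = mat 1"
proof -
  let ?Q = "\<Sum>\<mu>\<in>labels. P \<mu>"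
  have QP: "?Q ** P \<mu> = P \<mu>" if \<mu>: "\<mu> \<in> labels" for \<mu>
  proof -
    have "?Q ** P \<mu> = (\<Sum>\<nu>\<in>labels. if \<nu> = \<mu> then P \<mu> else 0)"
      unfolding mat_mult_sum_left by (intro sum.cong) (auto simp: P_idem P_orthogonal \<mu>)
    then show ?thesis using finite_labels \<mu> by simp
  qed
  have ker: "{x. ?Q *v x = 0} = {0}"
  proof (rule ccontr)
    assume ne: "{x. ?Q *v x = 0} \<noteq> {0}"
    have "invariant {x \<in> UNIV. ?Q *v x = 0}"
      by (rule invariant_kernel[OF intertwiner_sum invariant_UNIV]) (rule intertwiner_P)
    then obtain U where U: "irreducible_sub U" "U \<subseteq> {x. ?Q *v x = 0}"
      using ne irreducible_exists[of "{x. ?Q *v x = 0}"] by auto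
    define \<mu> where "\<mu> = {W. irreducible_sub W \<and> isomorphic U W}"
    have \<mu>: "\<mu> \<in> labels" "U \<in> \<mu>" using U iso_refl by (auto simp: \<mu>_def labels_eq)
    obtain x where x: "x \<in> U" "x \<noteq> 0" using irreducibleD(2,4)[OF U(1)] by blast
    have "x = P \<mu> *v x" using P_fixes[OF UnionI[OF \<mu>(2) x(1)]] by simp
    then have "?Q *v x = x" using QP[OF \<mu>(1)] by (metis matrix_vector_mul_assoc)
    then show False using U(2) x by auto
  qed
  have "?Q ** ?Q = ?Q" by (simp add: mat_mult_sum_right QP)
  then have "?Q *v (x - ?Q *v x) = 0" for x
    by (simp add: matrix_vector_mult_diff_distrib matrix_vector_mul_assoc)
  then have "x - ?Q *v x = 0" for x using ker by blast
  then show ?thesis by (simp add: matrix_eq)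
qed

text \<open>The maximum of the quadratic form of \<open>K\<close> on the unit sphere is an eigenvalue.\<close>

lemma schur_scalar:
  assumes U: "irreducible_sub U" and K: "intertwiner K" and adj: "adj K = K"
    and KU: "\<And>x. x \<in> U \<Longrightarrow> K *v x \<in> U"
  obtains c where "\<And>x. x \<in> U \<Longrightarrow> K *v x = c *s x"
proof -
  note D = irreducibleD[OF U]
  have subU: "subspace U" by (rule subspace_vec_subspace[OF D(3)])
  define f where "f v = inner v (K *v v)" for v
  obtain u where u: "u \<in> U" "u \<noteq> 0" using D(2,4) by blast
  have cont: "continuous_on (U \<inter> sphere 0 1) f"
    unfolding f_def by (intro continuous_intros linear_continuous_on matrix_vector_mul_bounded_linear)
  have "compact (U \<inter> sphere 0 1)"
    by (intro closed_Int_compact closed_subspace[OF subU]) simp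
  moreover have "u /\<^sub>R norm u \<in> U \<inter> sphere 0 1"
    using u subspace_scale[OF subU] by simp
  ultimately obtain v where v: "v \<in> U \<inter> sphere 0 1" "\<And>w. w \<in> U \<inter> sphere 0 1 \<Longrightarrow> f w \<le> f v"
    using continuous_attains_sup[OF _ _ cont] by blast
  define b where "b = f v"
  have bound: "f w \<le> b * inner w w" if "w \<in> U" for w
  proof (cases "w = 0")
    case False
    have "w /\<^sub>R norm w \<in> U \<inter> sphere 0 1" using that False subspace_scale[OF subU] by simp
    from v(2)[OF this] have "f w / (norm w * norm w) \<le> b"
      by (simp add: f_def b_def matrix_vector_scaleR divide_inverse mult_ac)
    then show ?thesis
      using False by (simp add: divide_le_eq power2_norm_eq_inner[symmetric] power2_eq_square mult_ac split: if_splits)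
  qed (simp add: f_def)
  define y where "y = b *\<^sub>R v - K *v v"
  have yU: "y \<in> U" using v(1) KU subspace_scale[OF subU] subspace_diff[OF subU] by (simp add: y_def)
  \<comment> \<open>Applies \<open>bound\<close> to the perturbed maximizer
    \<open>v - e *\<^sub>R y\<close>: the first-order contribution 2 e |y|^2 must be dominated by
    the second-order term.\<close>
  have small: "2 * inner y y \<le> e * (b * inner y y - f y)" if "e > 0" for e
  proof -
    have sym: "inner v (K *v y) = inner y (K *v v)"
      using inner_adj[of K v y] adj by (simp add: inner_commute)
    have vv: "inner v v = 1" using v(1) by (simp add: dot_square_norm)
    have "v - e *\<^sub>R y \<in> U" using v(1) yU subspace_scale[OF subU] subspace_diff[OF subU] by simp
    from bound[OF this]
    have "f v - 2 * e * inner y (K *v v) + e * e * f y \<le> b * (1 - 2 * e * inner y v + e * e * inner y y)"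
      unfolding f_def
      by (simp add: matrix_vector_mult_diff_distrib matrix_vector_scaleR inner_diff_left inner_diff_right
          sym vv inner_commute[of v y] algebra_simps)
    then have "2 * e * (b * inner y v - inner y (K *v v)) \<le> e * (e * (b * inner y y - f y))"
      by (simp add: b_def algebra_simps)
    moreover have "b * inner y v - inner y (K *v v) = inner y y"
      by (simp add: y_def inner_diff_right)
    ultimately have "e * (2 * inner y y) \<le> e * (e * (b * inner y y - f y))" by simp
    then show ?thesis using that by simp
  qed
  have "y = 0"
  proof (rule ccontr)
    assume "y \<noteq> 0"
    define q where "q = b * inner y y - f y"
    \<comment> \<open>Chosen so that e q is at most |y|^2, whereas \<open>small\<close> demands at
      least 2 |y|^2.\<close>
    define e where "e = inner y y / (\<bar>q\<bar> + 1)"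
    have pos: "inner y y > 0" using \<open>y \<noteq> 0\<close> by simp
    have "e > 0" using pos by (simp add: e_def)
    have "e * q \<le> e * (\<bar>q\<bar> + 1)" using \<open>e > 0\<close> by (intro mult_left_mono) auto
    also have "\<dots> = inner y y" by (simp add: e_def)
    finally show False using small[OF \<open>e > 0\<close>] pos by (simp add: q_def)
  qed
  then have Kv: "K *v v = complex_of_real b *s v" by (simp add: y_def scaleR_eq_smult)
  \<comment> \<open>\<open>L\<close> annihilates \<open>v\<close>, so it is not injective on
    \<open>U\<close> and \<open>schur_alternative\<close> makes it vanish there.\<close>
  define L where "L = K - complex_of_real b *\<^sub>m mat 1"
  have L: "L *v x = K *v x - complex_of_real b *s x" for x
    by (simp add: L_def matrix_vector_mult_diff_rdistrib cscale_mult_vec)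
  have "intertwiner L"
    using K by (simp add: L_def intertwiner_def mat_mult_diff_left mat_mult_diff_right mult_cscale_left mult_cscale_right)
  moreover have "\<not> inj_on ((*v) L) U"
  proof
    assume "inj_on ((*v) L) U"
    moreover have "L *v v = L *v 0" by (simp add: L Kv)
    ultimately have "v = 0" using inj_onD[of "(*v) L" U v 0] v(1) D(4) by blast
    then show False using v(1) by simp
  qed
  ultimately have "\<And>x. x \<in> U \<Longrightarrow> L *v x = 0" using schur_alternative[OF U] by blast
  then show ?thesis using that[of "complex_of_real b"] by (simp add: L)
qed

text \<open>\<open>Z\<close> commutes with the projection onto an irreducible \<open>U\<close>, so
  it preserves \<open>U\<close> and is a scalar there; isomorphisms with the other members of \<mu>,
  extended to intertwiners, carry the same scalar over.\<close>

lemma double_commutant_scalar: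
  assumes \<mu>: "\<mu> \<in> labels" and Z: "intertwiner Z" "adj Z = Z"
    and comm: "\<And>C. intertwiner C \<Longrightarrow> C ** Z = Z ** C"
  obtains c where "Z ** P \<mu> = c *\<^sub>m P \<mu>"
proof -
  obtain U where U: "irreducible_sub U" "\<mu> = {W. irreducible_sub W \<and> isomorphic U W}" using labelE[OF \<mu>] by blast
  note D = irreducibleD[OF U(1)]
  have "Z *v x \<in> U" if "x \<in> U" for x
  proof -
    have "Z *v x = Z *v (orth_proj U *v x)" using that by (simp add: orth_proj_fixes D)
    also have "\<dots> = orth_proj U *v (Z *v x)"
      by (simp add: matrix_vector_mul_assoc comm[OF intertwiner_orth_proj[OF D(1)]])
    finally show ?thesis using orth_proj_in[OF D(3)] by metis
  qed
  then obtain c where c: "\<And>x. x \<in> U \<Longrightarrow> Z *v x = c *s x"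
    using schur_scalar[OF U(1) Z] by blast
  have "Z *v x = (c *\<^sub>m mat 1) *v x" if x: "x \<in> \<Union>\<mu>" for x
  proof -
    obtain W where W: "W \<in> \<mu>" "x \<in> W" using x by blast
    then have "isomorphic U W" using U(2) by blast
    then obtain C where C: "intertwiner C" "bij_betw ((*v) C) U W" using iso_intertwiner[OF U(1)] by blast
    obtain y where y: "y \<in> U" "x = C *v y" using C(2) W(2) by (auto simp: bij_betw_def)
    have "Z *v x = C *v (Z *v y)" by (simp add: y(2) matrix_vector_mul_assoc comm[OF C(1)])
    then show ?thesis by (simp add: c[OF y(1)] y(2) vec.scale cscale_mult_vec)
  qed
  then have "Z ** P \<mu> = (c *\<^sub>m mat 1) ** P \<mu>" by (rule matrix_eqI_isotypic)
  then show ?thesis by (intro that[of c]) (simp add: mult_cscale_left)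
qed

end

section \<open>Positive operators\<close>

lemma positive_op_conj:
  assumes "positive_op A" shows "positive_op (B ** A ** adj B)"
  unfolding positive_op_def
proof (intro conjI allI)
  show "adj (B ** A ** adj B) = B ** A ** adj B"
    using assms by (simp add: positive_op_def adj_mult matrix_mul_assoc)
  fix v
  have "cinner v ((B ** A ** adj B) *v v) = cinner (adj B *v v) (A *v (adj B *v v))"
    by (simp add: matrix_vector_mul_assoc[symmetric] cinner_adj[of v B])
  then show "0 \<le> Re (cinner v ((B ** A ** adj B) *v v))"
    using assms by (simp add: positive_op_def)
qed

lemma cinner_add_vec: "cinner u (v + w) = cinner u v + cinner u w"
  by (simp add: cinner_def algebra_simps sum.distrib)

lemma positive_op_add: "positive_op A \<Longrightarrow> positive_op B \<Longrightarrow> positive_op (A + B)"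
  by (simp add: positive_op_def adj_add matrix_vector_mult_add_rdistrib cinner_add_vec)

lemma positive_op_zero: "positive_op 0"
  by (simp add: positive_op_def cinner_def)

lemma positive_op_sum: "(\<And>i. i \<in> I \<Longrightarrow> positive_op (f i)) \<Longrightarrow> positive_op (sum f I)"
  by (induction I rule: infinite_finite_induct) (simp_all add: positive_op_add positive_op_zero)

lemma positive_op_scale: "positive_op A \<Longrightarrow> 0 \<le> r \<Longrightarrow> positive_op (complex_of_real r *\<^sub>m A)"
  by (simp add: positive_op_def adj_cscale cscale_mult_vec cinner_smult_right)

lemma positive_op_one: "positive_op (mat 1)"
  by (simp add: positive_op_def cinner_self)

lemma positive_op_projection: "adj Q = Q \<Longrightarrow> Q ** Q = Q \<Longrightarrow> positive_op Q"
  using positive_op_conj[OF positive_op_one, of Q] by simp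

lemma positive_op_trace:
  assumes A: "positive_op (A :: 'm::finite cmat)"
  obtains r where "trace A = complex_of_real r" "0 \<le> r"
proof -
  have "0 \<le> Re (A $ i $ i)" for i
  proof -
    have "cinner (axis i 1) (A *v axis i 1) = A $ i $ i"
      by (simp add: cinner_def matrix_vector_mult_nth axis_def if_distrib[of "times _"]
          if_distrib[of "\<lambda>x. x * _"] if_distrib[of cnj] cong: if_cong)
    then show ?thesis using A unfolding positive_op_def by metis
  qed
  moreover have "Im (A $ i $ i) = 0" for i
  proof -
    have "cnj (A $ i $ i) = A $ i $ i" using A by (metis adj_nth positive_op_def)
    then show ?thesis by (simp add: complex_eq_iff)
  qed
  ultimately have "trace A = complex_of_real (\<Sum>i\<in>UNIV. Re (A $ i $ i))"
    "0 \<le> (\<Sum>i\<in>UNIV. Re (A $ i $ i))"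
    by (auto simp: trace_def complex_eq_iff sum_nonneg)
  then show ?thesis using that by blast
qed

section \<open>The localized POVM\<close>

lemma
  fixes A :: "'m::finite cmat"
  shows linear_mult_left: "linear (\<lambda>X :: 'm cmat. A ** X)"
    and linear_mult_right: "linear (\<lambda>X :: 'm cmat. X ** A)"
  by (auto intro!: linearI simp: matrix_add_ldistrib matrix_add_rdistrib scaleR_mult_left scaleR_mult_right)

context gauge
begin

lemma one_in_G: "mat 1 \<in> G"
  by (simp add: unitary_centralizer_def unitary_def)

text \<open>An operator commuting with all products of gauge unitaries is fixed by the twirl, whose
  values lie in the span by construction. This is the commutation theorem for the tensor power of
  \<A>.\<close>

lemma tensor_pow_algebra_iff:
  "X \<in> tensor_pow_algebra \<A> \<longleftrightarrow> (\<forall>V. (\<forall>k. V k \<in> G) \<longrightarrow> X ** tensor_op V = tensor_op V ** X)"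
  for X :: "('n::finite, 'd) tensor_mat"
proof
  assume X: "X \<in> tensor_pow_algebra \<A>"
  show "\<forall>V. (\<forall>k. V k \<in> G) \<longrightarrow> X ** tensor_op V = tensor_op V ** X"
  proof (intro allI impI)
    fix V :: "'n \<Rightarrow> 'd cmat" assume V: "\<forall>k. V k \<in> G"
    have "cmat.subspace (commutant {tensor_op V})" by (rule subspace_commutant)
    moreover have "f k ** V k = V k ** f k" if "f k \<in> \<A>" for f k
      using gauge_groupD(2)[of "V k" \<A> "f k"] V that by simp
    then have "{tensor_op f | f. \<forall>k. f k \<in> \<A>} \<subseteq> commutant {tensor_op V}"
      by (auto simp: commutant_def tensor_op_mult)
    ultimately have "tensor_pow_algebra \<A> \<subseteq> commutant {tensor_op V}"
      unfolding tensor_pow_algebra_def by (intro cmat.span_minimal)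
    then show "X ** tensor_op V = tensor_op V ** X" using X by (auto simp: commutant_def)
  qed
next
  assume X: "\<forall>V. (\<forall>k. V k \<in> G) \<longrightarrow> X ** tensor_op V = tensor_op V ** X"
  have "twirl_pow \<A> X = X"
  proof (rule twirl_pow_const[where f = "\<lambda>X. X"])
    fix V :: "'n \<Rightarrow> 'd cmat" assume V: "\<And>k. V k \<in> G"
    have "tensor_op V ** adj (tensor_op V) = mat 1"
      using unitaryD(2)[OF gauge_groupD(1)[OF V]] by (simp add: adj_tensor_op tensor_op_mult tensor_op_one)
    moreover have "tensor_op V ** X = X ** tensor_op V" using X V by simp
    ultimately show "tensor_op V ** X ** adj (tensor_op V) = X" by (simp add: matrix_mul_assoc[symmetric])
  qed (auto intro: linearI)
  then show "X \<in> tensor_pow_algebra \<A>" using twirl_pow_in[of X] by simp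
qed

lemma tensor_pow_algebra_mult:
  fixes X Y :: "('n::finite, 'd) tensor_mat"
  assumes "X \<in> tensor_pow_algebra \<A>" "Y \<in> tensor_pow_algebra \<A>"
  shows "X ** Y \<in> tensor_pow_algebra \<A>"
  unfolding tensor_pow_algebra_iff
proof (intro allI impI)
  fix V :: "'n \<Rightarrow> 'd cmat" assume V: "\<forall>k. V k \<in> G"
  have "X ** Y ** tensor_op V = X ** tensor_op V ** Y"
    using assms(2) V by (simp add: tensor_pow_algebra_iff matrix_mul_assoc[symmetric])
  then show "X ** Y ** tensor_op V = tensor_op V ** (X ** Y)"
    using assms(1) V by (simp add: tensor_pow_algebra_iff matrix_mul_assoc)
qed

lemma local_symmetry_of_algebra:
  assumes "\<And>B. B \<in> \<Sigma> \<Longrightarrow> M B \<in> tensor_pow_algebra \<A>"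
  shows "local_symmetry G \<Sigma> M"
  using assms one_in_G unfolding local_symmetry_def local_op_def tensor_pow_algebra_iff by simp

lemma twirl_pow_add: "twirl_pow \<A> (X + Y) = twirl_pow \<A> X + twirl_pow \<A> Y"
  and twirl_pow_cscale: "twirl_pow \<A> (c *\<^sub>m X) = c *\<^sub>m twirl_pow \<A> X"
  by (simp_all add: twirl_pow_def superop_pow_add superop_pow_cscale)

lemma adj_twirl_pow:
  assumes "adj X = X" shows "adj (twirl_pow \<A> X) = twirl_pow \<A> X"
  by (rule twirl_pow_transfer[where f = adj and g = "\<lambda>X. X"])
    (use assms bounded_linear_adj bounded_linear.linear in \<open>auto intro: linearI simp: adj_mult matrix_mul_assoc\<close>)

lemma positive_twirl_pow:
  fixes X :: "('n::finite, 'd) tensor_mat"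
  assumes X: "positive_op X" shows "positive_op (twirl_pow \<A> X)"
  unfolding positive_op_def
proof (intro conjI allI)
  show "adj (twirl_pow \<A> X) = twirl_pow \<A> X" using X by (simp add: positive_op_def adj_twirl_pow)
  fix v
  show "0 \<le> Re (cinner v (twirl_pow \<A> X *v v))"
  proof (rule twirl_pow_nonneg)
    show "linear (\<lambda>A. Re (cinner v (A *v v)))"
      by (rule linearI) (simp_all add: matrix_vector_mult_add_rdistrib cinner_add_vec scaleR_eq_cscale
          cscale_mult_vec cinner_smult_right)
  qed (use positive_op_conj[OF X] in \<open>auto simp: positive_op_def\<close>)
qed

text \<open>\<open>C\<close> commutes with the averaging unitaries, so they cancel under the trace
  by cyclicity.\<close>

lemma trace_mult_twirl_pow:
  fixes X :: "('n::finite, 'd) tensor_mat"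
  assumes C: "C \<in> tensor_pow_algebra \<A>"
  shows "trace (C ** twirl_pow \<A> X) = trace (C ** X)"
proof (rule twirl_pow_const[where f = "\<lambda>A. trace (C ** A)"])
  show "linear (\<lambda>A. trace (C ** A))"
    by (rule linearI) (simp_all add: matrix_add_ldistrib trace_add scaleR_eq_cscale mult_cscale_right
        trace_cscale scaleR_conv_of_real)
  fix V :: "'n \<Rightarrow> 'd cmat" assume V: "\<And>k. V k \<in> G"
  have u: "adj (tensor_op V) ** tensor_op V = mat 1"
    using unitaryD(1)[OF gauge_groupD(1)[OF V]] by (simp add: adj_tensor_op tensor_op_mult tensor_op_one)
  have "trace (C ** (tensor_op V ** X ** adj (tensor_op V))) = trace (tensor_op V ** (C ** X ** adj (tensor_op V)))"
    using C V by (simp add: tensor_pow_algebra_iff matrix_mul_assoc)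
  also have "\<dots> = trace (C ** X ** (adj (tensor_op V) ** tensor_op V))"
    by (subst trace_cyclic) (simp only: matrix_mul_assoc)
  finally show "trace (C ** (tensor_op V ** X ** adj (tensor_op V))) = trace (C ** X)" by (simp add: u)
qed

lemma star_representation_gauge: "star_representation (gauge_group' \<A>) tensor_pow"
proof
  fix U assume "U \<in> gauge_group' \<A>"
  then have "adj U \<in> gauge_group' \<A>"
    using von_neumann_algebraD(4)[OF vN] by (simp add: gauge_group'_eq[OF vN] unitary_adj)
  then show "\<exists>h\<in>gauge_group' \<A>. tensor_pow h = adj (tensor_pow U)" by (metis adj_tensor_pow)
qed

end

locale exchange_gauge = gauge \<A> + star_representation "gauge_group' \<A>" "tensor_pow :: 'd cmat \<Rightarrow> ('n::finite, 'd) tensor_mat"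
  for \<A> :: "'d::finite cmat set" +
  fixes s :: exchange_sign
begin

abbreviation "Q \<equiv> exchange_proj s :: ('n, 'd) tensor_mat"
abbreviation "Z \<equiv> twirl_pow \<A> Q"
abbreviation "p \<equiv> p_coeff \<A> s"

text \<open>Polarization over \<A> itself: \<open>gauge_group'\<close> consists of its unitaries, so
  an intertwiner meets the assumptions of \<open>commutes_with_unitary_powers\<close>.\<close>

lemma intertwiner_commutes:
  assumes "intertwiner C" "X \<in> tensor_pow_algebra \<A>" "\<And>\<pi>. \<pi> permutes UNIV \<Longrightarrow> tensor_permute \<pi> X = X"
  shows "C ** X = X ** C"
proof -
  interpret commutes_with_unitary_powers \<A> C
    by unfold_locales
      (use assms(1)[unfolded intertwiner_def, unfolded gauge_group'_eq[OF vN]] vN in auto)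
  show ?thesis by (rule symmetric_commutes[OF assms(2,3)])
qed

lemma intertwiner_tensor_op:
  assumes "\<And>k. V k \<in> G" shows "intertwiner (tensor_op V)"
  unfolding intertwiner_def unfolding gauge_group'_eq[OF vN]
  using gauge_groupD(2)[OF assms] by (simp add: tensor_pow_def tensor_op_mult)

text \<open>Products of gauge unitaries are intertwiners, and isotypic projections commute with
  every intertwiner.\<close>

lemma P_in_algebra: "\<mu> \<in> labels \<Longrightarrow> P \<mu> \<in> tensor_pow_algebra \<A>"
  unfolding tensor_pow_algebra_iff using P_commutes_intertwiner intertwiner_tensor_op by simp

lemma twirl_exchange_permute:
  assumes "\<pi> permutes UNIV"
  shows "tensor_permute \<pi> (twirl_pow \<A> (Q ** X ** Q)) = twirl_pow \<A> (Q ** X ** Q)"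
  unfolding twirl_pow_def using superop_pow_permute[OF assms] exchange_conj_permute_fixed[OF assms] by metis

lemma P_twirl_commute:
  assumes "\<mu> \<in> labels"
  shows "P \<mu> ** twirl_pow \<A> (Q ** X ** Q) = twirl_pow \<A> (Q ** X ** Q) ** P \<mu>"
  by (intro intertwiner_commutes intertwiner_P assms twirl_pow_in twirl_exchange_permute)

lemma Q_one_Q: "Q ** mat 1 ** Q = Q"
  by (simp add: exchange_proj_idem)

lemma positive_Z: "positive_op Z"
  by (intro positive_twirl_pow positive_op_projection) (simp_all add: adj_exchange_proj exchange_proj_idem)

lemma intertwiner_Z: "intertwiner Z"
  unfolding intertwiner_def
proof
  fix W assume "W \<in> gauge_group' \<A>"
  then have W: "W \<in> \<A>" by (simp add: gauge_group'_eq[OF vN])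
  show "Z ** tensor_pow W = tensor_pow W ** Z"
  proof (rule twirl_pow_transfer[OF linear_mult_right linear_mult_left])
    fix V :: "'n \<Rightarrow> 'd cmat" assume V: "\<And>k. V k \<in> G"
    have 1: "tensor_op V ** tensor_pow W = tensor_pow W ** tensor_op V"
      using gauge_groupD(2)[OF V W] by (simp add: tensor_pow_def tensor_op_mult)
    have 2: "adj (tensor_op V) ** tensor_pow W = tensor_pow W ** adj (tensor_op V)"
      using gauge_groupD(2)[OF gauge_group_adj[OF V] W] by (simp add: adj_tensor_op tensor_pow_def tensor_op_mult)
    have "tensor_op V ** Q ** adj (tensor_op V) ** tensor_pow W = tensor_op V ** (Q ** tensor_pow W) ** adj (tensor_op V)"
      by (simp add: matrix_mul_assoc[symmetric] 2)
    also have "\<dots> = (tensor_op V ** tensor_pow W) ** Q ** adj (tensor_op V)"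
      by (simp only: exchange_proj_tensor_pow matrix_mul_assoc)
    finally show "tensor_op V ** Q ** adj (tensor_op V) ** tensor_pow W = tensor_pow W ** (tensor_op V ** Q ** adj (tensor_op V))"
      by (simp only: 1 matrix_mul_assoc)
  qed
qed

text \<open>Schur's lemma gives some scalar; taking the trace identifies it with
  \<open>p_coeff\<close>.\<close>

lemma Z_P: assumes \<mu>: "\<mu> \<in> labels" shows "Z ** P \<mu> = p \<mu> *\<^sub>m P \<mu>" "P \<mu> ** Z = p \<mu> *\<^sub>m P \<mu>"
proof -
  have "C ** Z = Z ** C" if "intertwiner C" for C
    using intertwiner_commutes[OF that twirl_pow_in twirl_exchange_permute, of "mat 1"] by (simp only: Q_one_Q)
  then obtain c where c: "Z ** P \<mu> = c *\<^sub>m P \<mu>"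
    using double_commutant_scalar[OF \<mu> intertwiner_Z] positive_Z positive_op_def by blast
  have "p \<mu> = trace (c *\<^sub>m P \<mu>) / trace (P \<mu>)"
    unfolding p_coeff_def by (simp only: c trace_cyclic[of "P \<mu>"])
  then have "p \<mu> = c" by (simp add: trace_cscale trace_P[OF \<mu>])
  then show "Z ** P \<mu> = p \<mu> *\<^sub>m P \<mu>" using c by simp
  then show "P \<mu> ** Z = p \<mu> *\<^sub>m P \<mu>"
    using P_twirl_commute[OF \<mu>, of "mat 1"] by (simp only: Q_one_Q)
qed

text \<open>An eigenvalue of the positive operator \<open>Z\<close>. The sign is what makes the
  weights in \<open>Phi\<close> preserve positivity.\<close>

lemma p_nonneg:
  assumes \<mu>: "\<mu> \<in> labels" obtains r where "p \<mu> = complex_of_real r" "0 \<le> r"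
proof -
  obtain v where v: "v \<noteq> 0" "P \<mu> *v v = v" using P_nonzero_vec[OF \<mu>] .
  have "Z *v v = p \<mu> *s v"
    using arg_cong[OF Z_P(1)[OF \<mu>], of "\<lambda>A. A *v v"] v(2) by (simp add: matrix_vector_mul_assoc[symmetric] cscale_mult_vec)
  then have c: "cinner v (Z *v v) = p \<mu> * complex_of_real ((norm v)\<^sup>2)"
    by (simp add: cinner_smult_right cinner_self)
  have "cnj (cinner v (Z *v v)) = cinner v (Z *v v)"
    using cinner_adj[of v Z v] positive_Z by (simp add: cnj_cinner positive_op_def)
  then have "cnj (p \<mu>) = p \<mu>" unfolding c using v(1) by simp
  then have im: "Im (p \<mu>) = 0" by (simp add: complex_eq_iff)
  have "Re (cinner v (Z *v v)) = Re (p \<mu>) * (norm v)\<^sup>2" by (simp add: c del: of_real_power)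
  then have "0 \<le> Re (p \<mu>) * (norm v)\<^sup>2" using positive_Z by (metis positive_op_def)
  then have "0 \<le> Re (p \<mu>)" using v(1) by (simp add: zero_le_mult_iff)
  then show ?thesis using that[of "Re (p \<mu>)"] im by (simp add: complex_eq_iff)
qed

lemma intertwiner_Q: "intertwiner Q"
  by (simp add: intertwiner_def exchange_proj_tensor_pow)

text \<open>\<open>P \<mu> ** Q\<close> is a projection, as its factors commute, so its squared
  Frobenius norm is its trace, which equals that of \<open>P \<mu> ** Z\<close>.\<close>

lemma p_zero:
  assumes \<mu>: "\<mu> \<in> labels" and "p \<mu> = 0" shows "P \<mu> ** Q = 0"
proof -
  have comm: "P \<mu> ** Q = Q ** P \<mu>" by (rule P_commutes_intertwiner[OF \<mu> intertwiner_Q])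
  have "adj (P \<mu> ** Q) ** (P \<mu> ** Q) = Q ** (P \<mu> ** P \<mu>) ** Q"
    by (simp add: adj_mult adj_P adj_exchange_proj matrix_mul_assoc)
  also have "\<dots> = P \<mu> ** (Q ** Q)" by (simp add: P_idem comm[symmetric] matrix_mul_assoc)
  finally have "trace (adj (P \<mu> ** Q) ** (P \<mu> ** Q)) = trace (P \<mu> ** Q)" by (simp add: exchange_proj_idem)
  also have "\<dots> = trace (P \<mu> ** Z)" by (rule trace_mult_twirl_pow[OF P_in_algebra[OF \<mu>], symmetric])
  also have "\<dots> = 0" using Z_P(2)[OF \<mu>] assms(2) by (simp add: trace_def)
  finally show ?thesis by (simp add: trace_adj_mult_eq_0)
qed

section \<open>The map \<open>Phi\<close> and the localizer\<close>

definition "active = {\<mu> \<in> labels. p \<mu> \<noteq> 0}"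

lemma finite_active: "finite active" by (simp add: active_def finite_labels)

lemma Phi_eq: "Phi \<A> s X = (\<Sum>\<mu>\<in>active. inverse (p \<mu>) *\<^sub>m (P \<mu> ** twirl_pow \<A> (Q ** X ** Q) ** P \<mu>))"
  by (simp add: Phi_def active_def irrep_labels_def)

lemma sum_P_active_Q: "(\<Sum>\<mu>\<in>active. P \<mu>) ** Q = Q"
proof -
  have "(\<Sum>\<mu>\<in>active. P \<mu>) ** Q = (\<Sum>\<mu>\<in>labels. P \<mu>) ** Q"
    unfolding mat_mult_sum_left
    by (rule sum.mono_neutral_left) (auto simp: finite_labels active_def p_zero)
  then show ?thesis by (simp add: sum_P)
qed

lemma Phi_one: "Phi \<A> s (mat 1 :: ('n, 'd) tensor_mat) = (\<Sum>\<mu>\<in>active. P \<mu>)"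
  unfolding Phi_eq
proof (rule sum.cong)
  fix \<mu> assume "\<mu> \<in> active"
  then have \<mu>: "\<mu> \<in> labels" "p \<mu> \<noteq> 0" by (auto simp: active_def)
  show "inverse (p \<mu>) *\<^sub>m (P \<mu> ** twirl_pow \<A> (Q ** mat 1 ** Q) ** P \<mu>) = P \<mu>"
    using \<mu>(2) by (simp only: Q_one_Q Z_P(2)[OF \<mu>(1)] mult_cscale_left P_idem) simp
qed simp

text \<open>\<open>X\<close> enters \<open>Phi\<close> only through its compression
  \<open>Y\<close>, which inherits the global symmetry because the exchange projection commutes with
  tensor powers.\<close>

lemma Phi_exchange:
  fixes X :: "('n, 'd) tensor_mat"
  assumes sym: "\<And>V. V \<in> G \<Longrightarrow> X ** tensor_pow V = tensor_pow V ** X"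
  shows "Phi \<A> s X ** Q = Q ** X ** Q"
proof -
  define Y where "Y = Q ** X ** Q"
  have "Y ** tensor_pow V = tensor_pow V ** Y" if "V \<in> G" for V
  proof -
    have "Y ** tensor_pow V = Q ** (X ** tensor_pow V) ** Q"
      by (simp add: Y_def matrix_mul_assoc[symmetric] exchange_proj_tensor_pow)
    also have "\<dots> = (Q ** tensor_pow V) ** X ** Q"
      by (simp only: sym[OF that] matrix_mul_assoc)
    finally show ?thesis by (simp only: exchange_proj_tensor_pow Y_def matrix_mul_assoc)
  qed
  moreover have "Q ** Y ** Q = Y"
    by (simp add: Y_def matrix_mul_assoc exchange_proj_idem) (simp add: matrix_mul_assoc[symmetric] exchange_proj_idem)
  ultimately have TY: "twirl_pow \<A> Y ** Q = Z ** Y" by (intro twirl_pow_global_symmetric)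
  have QY: "Q ** Y = Y" by (simp add: Y_def matrix_mul_assoc exchange_proj_idem)
  have summand: "(inverse (p \<mu>) *\<^sub>m (P \<mu> ** twirl_pow \<A> Y ** P \<mu>)) ** Q = P \<mu> ** Y" if "\<mu> \<in> active" for \<mu>
  proof -
    have \<mu>: "\<mu> \<in> labels" "p \<mu> \<noteq> 0" using that by (auto simp: active_def)
    have comm: "twirl_pow \<A> Y ** P \<mu> = P \<mu> ** twirl_pow \<A> Y"
      unfolding Y_def by (rule P_twirl_commute[OF \<mu>(1), symmetric])
    have "P \<mu> ** twirl_pow \<A> Y ** P \<mu> = P \<mu> ** (twirl_pow \<A> Y ** P \<mu>)"
      by (simp only: matrix_mul_assoc)
    also have "\<dots> = P \<mu> ** P \<mu> ** twirl_pow \<A> Y"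
      by (simp only: comm matrix_mul_assoc)
    finally have "P \<mu> ** twirl_pow \<A> Y ** P \<mu> ** Q = P \<mu> ** (Z ** Y)"
      by (simp add: P_idem matrix_mul_assoc[symmetric] TY)
    also have "\<dots> = p \<mu> *\<^sub>m (P \<mu> ** Y)" by (simp add: matrix_mul_assoc Z_P(2)[OF \<mu>(1)] mult_cscale_left)
    finally show ?thesis using \<mu>(2) by (simp add: mult_cscale_left)
  qed
  have "Phi \<A> s X ** Q = (\<Sum>\<mu>\<in>active. P \<mu> ** Y)"
    unfolding Phi_eq mat_mult_sum_left Y_def[symmetric] by (intro sum.cong summand refl)
  \<comment> \<open>Y = Q Y lets the sum over the labels with nonzero coefficient act as the
    identity.\<close>
  also have "\<dots> = (\<Sum>\<mu>\<in>active. P \<mu>) ** Q ** Y" by (simp add: mat_mult_sum_left[symmetric] matrix_mul_assoc[symmetric] QY)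
  finally show ?thesis by (simp add: sum_P_active_Q QY Y_def[symmetric])
qed

lemma Phi_in_algebra:
  fixes X :: "('n, 'd) tensor_mat"
  shows "Phi \<A> s X \<in> tensor_pow_algebra \<A>"
  unfolding Phi_eq tensor_pow_algebra_def
proof (intro cmat.span_sum cmat.span_scale, fold tensor_pow_algebra_def)
  fix \<mu> assume "\<mu> \<in> active"
  then show "P \<mu> ** twirl_pow \<A> (Q ** X ** Q) ** P \<mu> \<in> tensor_pow_algebra \<A>"
    by (intro tensor_pow_algebra_mult P_in_algebra twirl_pow_in) (auto simp: active_def)
qed

lemma localizer_in_algebra:
  fixes X :: "('n, 'd) tensor_mat"
  shows "localizer \<A> s X \<in> tensor_pow_algebra \<A>"
proof -
  have "(mat 1 :: ('n, 'd) tensor_mat) \<in> tensor_pow_algebra \<A>" by (simp add: tensor_pow_algebra_iff)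
  then show ?thesis
    unfolding localizer_def using Phi_in_algebra[of X] Phi_in_algebra[of "mat 1"]
    unfolding tensor_pow_algebra_def by (intro cmat.span_add cmat.span_scale cmat.span_diff)
qed

lemma localizer_one: "localizer \<A> s (mat 1 :: ('n, 'd) tensor_mat) = mat 1"
proof -
  have "trace (mat 1 :: ('n, 'd) tensor_mat) = of_nat (CARD('d) ^ CARD('n))"
    by (simp add: trace_def mat_def card_fun)
  moreover have "of_nat (CARD('d) ^ CARD('n)) \<noteq> (0 :: complex)" by simp
  ultimately show ?thesis by (simp add: localizer_def)
qed

lemma linear_Phi: "linear (Phi \<A> s :: ('n, 'd) tensor_mat \<Rightarrow> _)"
proof (rule linearI)
  fix X Y :: "('n, 'd) tensor_mat" and r :: real
  show "Phi \<A> s (X + Y) = Phi \<A> s X + Phi \<A> s Y"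
    unfolding Phi_eq
    by (simp add: matrix_add_ldistrib matrix_add_rdistrib twirl_pow_add cmat.scale_right_distrib sum.distrib)
  show "Phi \<A> s (r *\<^sub>R X) = r *\<^sub>R Phi \<A> s X"
    unfolding Phi_eq scaleR_eq_cscale
    by (simp add: mult_cscale_left mult_cscale_right twirl_pow_cscale cmat.scale_sum_right mult.commute)
qed

lemma linear_localizer: "linear (localizer \<A> s :: ('n, 'd) tensor_mat \<Rightarrow> _)"
  by (rule linearI)
    (simp_all add: localizer_def linear_add[OF linear_Phi] linear_scale[OF linear_Phi, unfolded scaleR_eq_cscale] trace_add add_divide_distrib
      cmat.scale_left_distrib scaleR_eq_cscale trace_cscale cmat.scale_right_distrib)

lemma positive_Phi:
  fixes X :: "('n, 'd) tensor_mat"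
  assumes X: "positive_op X" shows "positive_op (Phi \<A> s X)"
  unfolding Phi_eq
proof (rule positive_op_sum)
  fix \<mu> assume "\<mu> \<in> active"
  then have \<mu>: "\<mu> \<in> labels" by (simp add: active_def)
  obtain r where r: "p \<mu> = complex_of_real r" "0 \<le> r" using p_nonneg[OF \<mu>] .
  have "positive_op (Q ** X ** adj Q)" by (rule positive_op_conj[OF X])
  then have "positive_op (twirl_pow \<A> (Q ** X ** Q))" by (intro positive_twirl_pow) (simp add: adj_exchange_proj)
  then have "positive_op (P \<mu> ** twirl_pow \<A> (Q ** X ** Q) ** P \<mu>)"
    using positive_op_conj[of _ "P \<mu>"] by (simp add: adj_P)
  from positive_op_scale[OF this, of "inverse r"]
  show "positive_op (inverse (p \<mu>) *\<^sub>m (P \<mu> ** twirl_pow \<A> (Q ** X ** Q) ** P \<mu>))"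
    using r by simp
qed

text \<open>1 - Phi(1) is the projection onto the components with vanishing coefficient, so the
  trace term is positive as well.\<close>

lemma positive_localizer:
  fixes X :: "('n, 'd) tensor_mat"
  assumes X: "positive_op X" shows "positive_op (localizer \<A> s X)"
proof -
  let ?E = "\<Sum>\<mu>\<in>active. P \<mu>"
  have E: "adj ?E = ?E" "?E ** ?E = ?E"
  proof -
    show "adj ?E = ?E" by (simp add: adj_sum adj_P)
    have "?E ** P \<mu> = P \<mu>" if "\<mu> \<in> active" for \<mu>
    proof -
      have "?E ** P \<mu> = (\<Sum>\<nu>\<in>active. if \<nu> = \<mu> then P \<mu> else 0)"
        unfolding mat_mult_sum_left using that
        by (intro sum.cong) (auto simp: P_idem P_orthogonal active_def)
      then show ?thesis using finite_active that by simp
    qed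
    then show "?E ** ?E = ?E" by (simp add: mat_mult_sum_right)
  qed
  have "positive_op (mat 1 - ?E)"
    by (rule positive_op_projection) (simp_all add: adj_diff E mat_mult_diff_left mat_mult_diff_right)
  moreover obtain r where "trace X = complex_of_real r" "0 \<le> r" using positive_op_trace[OF X] .
  ultimately have "positive_op (complex_of_real (r / real (CARD('d) ^ CARD('n))) *\<^sub>m (mat 1 - ?E))"
    by (intro positive_op_scale) auto
  then show ?thesis
    unfolding localizer_def Phi_one using \<open>trace X = complex_of_real r\<close> by (intro positive_op_add positive_Phi X) simp
qed

lemma localizer_exchange:
  fixes X :: "('n, 'd) tensor_mat"
  assumes "\<And>V. V \<in> G \<Longrightarrow> X ** tensor_pow V = tensor_pow V ** X"
  shows "localizer \<A> s X ** Q = Q ** X ** Q"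
  by (simp add: localizer_def matrix_add_rdistrib mult_cscale_left mat_mult_diff_left Phi_exchange[OF assms]
      Phi_one sum_P_active_Q)

text \<open>Countable additivity transfers because a linear map in finite dimension is continuous.
  For the statistics, a state inside the exchange subspace sees an operator only through its
  compression.\<close>

theorem localizer_povm:
  fixes M :: "'w set \<Rightarrow> ('n, 'd) tensor_mat"
  assumes M: "povm \<Omega> \<Sigma> M" and sym: "global_symmetry G \<Sigma> M"
  shows "povm \<Omega> \<Sigma> (\<lambda>B. localizer \<A> s (M B))"
    and "same_statistics s \<Sigma> (\<lambda>B. localizer \<A> s (M B)) M"
proof -
  have bl: "bounded_linear (localizer \<A> s :: ('n, 'd) tensor_mat \<Rightarrow> _)"
    using linear_localizer by (simp add: linear_conv_bounded_linear)
  show "povm \<Omega> \<Sigma> (\<lambda>B. localizer \<A> s (M B))"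
    using M unfolding povm_def by (auto intro: positive_localizer bounded_linear.sums[OF bl] simp: localizer_one)
  show "same_statistics s \<Sigma> (\<lambda>B. localizer \<A> s (M B)) M"
    unfolding same_statistics_def
  proof (intro ballI allI impI)
    fix B and \<rho> :: "('n, 'd) tensor_mat"
    assume B: "B \<in> \<Sigma>" and \<rho>: "density_op \<rho> \<and> Q ** \<rho> ** Q = \<rho>"
    have "Q ** \<rho> = \<rho>" using \<rho> by (metis exchange_proj_idem matrix_mul_assoc)
    have "\<rho> ** Q = \<rho>" using \<rho> by (metis exchange_proj_idem matrix_mul_assoc)
    have "trace (\<rho> ** localizer \<A> s (M B)) = trace (Q ** (\<rho> ** localizer \<A> s (M B)))"
      by (simp add: matrix_mul_assoc \<open>Q ** \<rho> = \<rho>\<close>)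
    also have "\<dots> = trace (\<rho> ** (localizer \<A> s (M B) ** Q))"
      by (subst trace_cyclic) (simp only: matrix_mul_assoc)
    also have "\<dots> = trace (\<rho> ** (Q ** M B ** Q))"
      using sym B by (subst localizer_exchange) (auto simp: global_symmetry_def)
    also have "\<dots> = trace (\<rho> ** M B ** Q)" by (simp add: matrix_mul_assoc \<open>\<rho> ** Q = \<rho>\<close>)
    also have "\<dots> = trace (\<rho> ** M B)"
      by (subst trace_cyclic) (simp add: matrix_mul_assoc \<open>Q ** \<rho> = \<rho>\<close>)
    finally show "trace (\<rho> ** localizer \<A> s (M B)) = trace (\<rho> ** M B)" .
  qed
qed

end

theorem corollary10:
  fixes \<A> :: "(complex ^ 'd::finite ^ 'd) set"
    and s :: exchange_sign
    and \<Omega> :: "'w set" and \<Sigma> :: "'w set set"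
    and M :: "'w set \<Rightarrow> ('n::finite, 'd) tensor_mat"
  assumes "von_neumann_algebra \<A>"
    and "sigma_algebra \<Omega> \<Sigma>"
    and "povm \<Omega> \<Sigma> M"
    and "global_symmetry (gauge_group \<A>) \<Sigma> M"
  shows "(\<exists>M' :: 'w set \<Rightarrow> ('n, 'd) tensor_mat.
            povm \<Omega> \<Sigma> M' \<and> local_symmetry (gauge_group \<A>) \<Sigma> M' \<and>
            (\<forall>B\<in>\<Sigma>. M' B \<in> tensor_pow_algebra \<A>) \<and>
            same_statistics s \<Sigma> M' M) \<and>
         (let M' = (\<lambda>B. localizer \<A> s (M B)) in
            povm \<Omega> \<Sigma> M' \<and> local_symmetry (gauge_group \<A>) \<Sigma> M' \<and>
            (\<forall>B\<in>\<Sigma>. M' B \<in> tensor_pow_algebra \<A>) \<and>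
            same_statistics s \<Sigma> M' M)"
proof -
  interpret gauge \<A> by unfold_locales (rule assms(1))
  interpret star_representation "gauge_group' \<A>" "tensor_pow :: 'd cmat \<Rightarrow> ('n, 'd) tensor_mat"
    by (rule star_representation_gauge)
  interpret exchange_gauge \<A> s ..
  let ?M' = "\<lambda>B. localizer \<A> s (M B)"
  have "povm \<Omega> \<Sigma> ?M' \<and> local_symmetry (gauge_group \<A>) \<Sigma> ?M' \<and>
      (\<forall>B\<in>\<Sigma>. ?M' B \<in> tensor_pow_algebra \<A>) \<and> same_statistics s \<Sigma> ?M' M"
    using localizer_povm[OF assms(3,4)] local_symmetry_of_algebra[of \<Sigma> ?M'] localizer_in_algebra by blast
  then show ?thesis unfolding Let_def by blast
qed

end
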